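(* For every $\varepsilon>0$ there is $p_0(\varepsilon)$ such that for every prime $p\geq p_0$ and every divisor $t$ of $p-1$ with $t\geq p^{1/2}$, one has $H_p(t)\leq p^{\frac{437}{480}+\varepsilon}$.
   Context: For a prime $p$ and a divisor $t$ of $p-1$, let $\Gamma\subseteq\mathbb{F}_p^\times$ be the (unique) multiplicative subgroup of order $t$. $H_p(t)$ is the largest integer $H$ for which there exist $a\in\mathbb{F}_p^\times$ and $u\in\mathbb{F}_p$ such that $u+j\notin a\Gamma$ for all $j=1,\dots,H$ (the maximal gap between consecutive elements of a coset of $\Gamma$). *)

theory Defs
  imports Complex_Main "HOL-Algebra.Multiplicative_Group" "HOL-Number_Theory.Residues"
begin

abbreviation Fp :: "nat \<Rightarrow> int ring" where
  "Fp p \<equiv> residue_ring (int p)"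

abbreviation Fp_units :: "nat \<Rightarrow> int monoid" where
  "Fp_units p \<equiv> mult_of (Fp p)"

definition subgroup_of_order :: "nat \<Rightarrow> nat \<Rightarrow> int set" where
  "subgroup_of_order p t = (THE \<Gamma>. subgroup \<Gamma> (Fp_units p) \<and> card \<Gamma> = t)"

definition is_gap :: "nat \<Rightarrow> nat \<Rightarrow> nat \<Rightarrow> bool" where
  "is_gap p t H \<longleftrightarrow>
     (\<exists>a \<in> carrier (Fp_units p). \<exists>u \<in> carrier (Fp p). \<forall>j \<in> {1..H}.
        u \<oplus>\<^bsub>Fp p\<^esub> (int j mod int p) \<notin> a <#\<^bsub>Fp_units p\<^esub> subgroup_of_order p t)"

definition max_gap :: "nat \<Rightarrow> nat \<Rightarrow> nat" where
  "max_gap p t = (GREATEST H. is_gap p t H)"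

text \<open>
  For a prime \<open>p\<close> and \<open>t\<close> dividing \<open>p - 1\<close> both descriptions above are proper:
  there is exactly one subgroup of order \<open>t\<close>, and the gap lengths are bounded and include \<open>0\<close>.
\<close>

lemma ex1_subgroup_of_order:
  assumes p: "prime p" and t: "t dvd p - 1"
  shows "\<exists>!\<Gamma>. subgroup \<Gamma> (Fp_units p) \<and> card \<Gamma> = t"
proof -
  interpret residues_prime p "Fp p"
    by unfold_locales (use p in auto)
  interpret G: group "Fp_units p" by (rule field_mult_group)
  have fin: "finite (carrier (Fp_units p))" by (rule finite_mult_of) (rule finite)
  have p1: "p - 1 > 0" using p prime_gt_1_nat[of p] by simp
  have ord: "order (Fp_units p) = p - 1"
    by (subst order_mult_of) (simp_all add: order_def res_carrier_eq)
  have t0: "t > 0" using t p1 by (metis dvd_0_left_iff gr0I)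
  obtain g where g: "g \<in> carrier (Fp_units p)"
      "carrier (Fp_units p) = {g [^]\<^bsub>Fp p\<^esub> i |i::nat. i \<in> UNIV}"
    using finite_field_mult_group_has_gen[OF finite] by blast
  have og: "G.ord g = p - 1"
  proof -
    have "generate (Fp_units p) {g} = carrier (Fp_units p)"
      using G.generate_pow_nat[OF g(1)] G.ord_ge_1[OF fin g(1)] g(2)
      by (auto simp: nat_pow_mult_of)
    thus ?thesis using G.generate_pow_card[OF g(1)] ord by (simp add: order_def)
  qed
  define h where "h = g [^]\<^bsub>Fp_units p\<^esub> ((p - 1) div t)"
  have hc: "h \<in> carrier (Fp_units p)" unfolding h_def using g(1) by (rule G.nat_pow_closed)
  have oh: "G.ord h = t"
  proof -
    have "(p - 1) div t dvd p - 1" using t by (metis dvd_div_mult_self dvd_triv_left)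
    moreover have "(p - 1) div t \<noteq> 0" using t p1 t0 by (auto simp: dvd_div_eq_0_iff)
    ultimately have "G.ord h = (p - 1) div ((p - 1) div t)"
      unfolding h_def using G.ord_pow[of g "(p-1) div t"] g(1) og by simp
    moreover obtain k where "p - 1 = t * k" using t ..
    ultimately show ?thesis using t0 p1 by auto
  qed
  have ex: "subgroup (generate (Fp_units p) {h}) (Fp_units p) \<and> card (generate (Fp_units p) {h}) = t"
    using G.generate_is_subgroup[of "{h}"] hc G.generate_pow_card[OF hc] oh by simp
  define Z where "Z = {x \<in> carrier (Fp p). x [^]\<^bsub>Fp p\<^esub> t = \<one>\<^bsub>Fp p\<^esub>}"
  have Z: "finite Z" "card Z \<le> t"
    unfolding Z_def using num_roots_le_deg[OF finite, of t] t0 by (auto intro: finite_subset[OF _ finite])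
  have un: "\<Gamma> = Z" if S: "subgroup \<Gamma> (Fp_units p)" "card \<Gamma> = t" for \<Gamma>
  proof -
    interpret S: group "(Fp_units p)\<lparr>carrier := \<Gamma>\<rparr>"
      using S(1) G.subgroup_imp_group by blast
    have sub: "\<Gamma> \<subseteq> carrier (Fp_units p)" using S(1) by (rule subgroup.subset)
    have "\<Gamma> \<subseteq> Z"
    proof
      fix x assume x: "x \<in> \<Gamma>"
      have "x [^]\<^bsub>(Fp_units p)\<lparr>carrier := \<Gamma>\<rparr>\<^esub> t = \<one>\<^bsub>(Fp_units p)\<lparr>carrier := \<Gamma>\<rparr>\<^esub>"
        using S.pow_order_eq_1[of x] x S(2) by (simp add: order_def)
      hence "x [^]\<^bsub>Fp_units p\<^esub> t = \<one>\<^bsub>Fp_units p\<^esub>"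
        by (simp add: nat_pow_consistent[symmetric] G.nat_pow_consistent[symmetric])
      thus "x \<in> Z" using x sub unfolding Z_def by (auto simp: nat_pow_mult_of)
    qed
    thus ?thesis using Z S(2) by (metis card_seteq)
  qed
  show ?thesis using ex un by metis
qed

lemma subgroup_of_order:
  assumes "prime p" and "t dvd p - 1"
  shows "subgroup (subgroup_of_order p t) (Fp_units p)" "card (subgroup_of_order p t) = t"
  using theI'[OF ex1_subgroup_of_order[OF assms]] unfolding subgroup_of_order_def by auto

lemma is_gap_0:
  assumes "prime p"
  shows "is_gap p t 0"
proof -
  interpret residues_prime p "Fp p"
    by unfold_locales (use assms in auto)
  have "1 \<in> carrier (Fp_units p)" using prime_gt_1_nat[OF assms]
    by (simp add: res_carrier_eq res_zero_eq)
  moreover have "0 \<in> carrier (Fp p)" using prime_gt_1_nat[OF assms] by (simp add: res_carrier_eq)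
  ultimately show ?thesis unfolding is_gap_def by fastforce
qed

lemma is_gap_less:
  assumes p: "prime p" and t: "t dvd p - 1" and H: "is_gap p t H"
  shows "H < p"
proof (rule ccontr)
  assume "\<not> H < p"
  hence pH: "p \<le> H" by simp
  interpret residues_prime p "Fp p"
    by unfold_locales (use p in auto)
  interpret G: group "Fp_units p" by (rule field_mult_group)
  from H obtain a u where a: "a \<in> carrier (Fp_units p)" and u: "u \<in> carrier (Fp p)"
    and gap: "\<And>j. j \<in> {1..H} \<Longrightarrow>
      u \<oplus>\<^bsub>Fp p\<^esub> (int j mod int p) \<notin> a <#\<^bsub>Fp_units p\<^esub> subgroup_of_order p t"
    unfolding is_gap_def by blast
  have a': "a \<in> a <#\<^bsub>Fp_units p\<^esub> subgroup_of_order p t"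
    using subgroup.one_closed[OF subgroup_of_order(1)[OF p t]] a G.r_one[OF a]
    unfolding l_coset_def by force
  define j where "j = (if a - u > 0 then nat (a - u) else nat (a - u + int p))"
  have ac: "0 \<le> a" "a < int p" and uc: "0 \<le> u" "u < int p"
    using a u by (auto simp: res_carrier_eq)
  have "j \<in> {1..H}" using ac uc pH unfolding j_def by auto
  moreover have "u \<oplus>\<^bsub>Fp p\<^esub> (int j mod int p) = a"
    using ac uc unfolding j_def by (auto simp: res_add_eq mod_simps)
  ultimately show False using gap a' by metis
qed

lemma is_gap_max_gap:
  assumes "prime p" and "t dvd p - 1"
  shows "is_gap p t (max_gap p t)"
  unfolding max_gap_def
  using GreatestI_nat[of "is_gap p t" 0 p] is_gap_0 is_gap_less assms less_imp_le by metis

lemma le_max_gap: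
  assumes "prime p" and "t dvd p - 1" and "is_gap p t H"
  shows "H \<le> max_gap p t"
  unfolding max_gap_def
  using Greatest_le_nat[of "is_gap p t" H p] is_gap_less assms less_imp_le by metis

end

theory Submission
  imports Defs "HOL-Computational_Algebra.Polynomial_Factorial" "HOL-Analysis.Convex"
    "HOL-Real_Asymp.Real_Asymp"
begin

hide_const (open) Module.smult UnivPoly.coeff UnivPoly.monom

text \<open>
  Let \<open>\<Gamma>\<close> be the subgroup of order \<open>t\<close> and \<open>S(c) = \<Sum>\<^sub>g\<^sub>\<in>\<^sub>\<Gamma> e(cg/p)\<close>. A gap of length \<open>H\<close> forces
  \<open>\<Sum>\<^sub>c\<^sub>\<le>\<^sub>h |S(ac)| \<ge> t/4\<close> with \<open>h\<close> slightly larger than \<open>p/H\<close>. By the Cauchy-Schwarz inequality the fourth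
  power of this sum is at most \<open>h\<^sup>2 N p E / t\<close>, where \<open>E\<close> is the additive energy of \<open>\<Gamma>\<close> and \<open>N\<close> is the
  number of \<open>x, y \<le> h\<close> with \<open>x/y \<in> \<Gamma>\<close>.

  For \<open>N\<close>, let \<open>M(R)\<close> be the number of reduced fractions of height at most \<open>R\<close> that lie in \<open>\<Gamma>\<close>.
  Products of fractions almost never coincide, so \<open>M(R)\<^sup>n\<close> is essentially at most \<open>M(R\<^sup>n)\<close>, and a
  spacing argument gives \<open>M(X) \<le> 2t(1 + X\<^sup>2/p)\<close>. With \<open>n\<close> near \<open>log p / (2 log R)\<close> one obtains
  \<open>N \<le> h p\<^sup>1\<^sup>/\<^sup>1\<^sup>6\<^sup>0\<^sup>+\<^sup>o\<^sup>(\<^sup>1\<^sup>)\<close> when \<open>t\<close> is near \<open>p\<^sup>1\<^sup>/\<^sup>2\<close> and \<open>h \<le> p\<^sup>4\<^sup>3\<^sup>/\<^sup>4\<^sup>8\<^sup>0\<close>.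

  The energy satisfies \<open>E \<le> t\<^sup>4\<^sup>9\<^sup>/\<^sup>2\<^sup>0\<^sup>+\<^sup>o\<^sup>(\<^sup>1\<^sup>)\<close> when \<open>t\<close> is near \<open>p\<^sup>1\<^sup>/\<^sup>2\<close>. Stepanov's method bounds the number of
  \<open>x\<close> whose pair \<open>(x\<^sup>t, (1-x)\<^sup>t)\<close> lies in a prescribed set. If the differences \<open>P\<close> with about \<open>\<Delta>\<close>
  representations carry the energy, then a trace inequality for the matrices \<open>1\<^sub>P(a-b)\<close> and \<open>r(a-b)\<close>
  on \<open>\<Gamma>\<close> makes \<open>\<Sum>\<^sub>x\<^sub>,\<^sub>y\<^sub>\<in>\<^sub>P r(x-y)\<^sup>2\<close> large. Writing \<open>x - y = z\<close> as \<open>x/z - y/z = 1\<close>, Stepanov's bound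
  controls this sum up to the multiplicity with which a pair of cosets arises from triples in \<open>P\<close>;
  that multiplicity is governed by the multiplicative energy of \<open>P\<close>, which Stepanov's bound
  controls again.
\<close>

section \<open>Vanishing of integer polynomials modulo a prime\<close>

text \<open>The exponent is 1 - \<eta> with \<eta> = 43/480, and the critical case is t near
  p^(1/2). There the fourth-power inequality is contradicted for h slightly below p^\<eta> once
  3\<eta> + \<rho> = 5/2 - 1 - 49/40 = 11/40, where p^\<rho> is the loss in the bound for N. This
  loss is forced by n being an integer: p^(1/2) is rarely a power of R, and a deviation of log R /
  log p from 1/(2n) by at most \<rho> costs p^\<rho>. With n >= 6 the intervals reach up to 1/12 +
  \<rho>; taking this as \<eta> gives 4\<rho> = 1/40, so \<rho> = 1/160. A gap is tested with a
  fixed power of an interval kernel, about 8/\<epsilon> factors, which makes all frequencies beyond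
  h negligible at the cost of a constant factor in the length of the interval. The energy bound is
  used for t below p^(3/5) only, where the inequalities between powers of t and p that Stepanov's
  method requires hold. For larger t the estimate |S(c)| <= p^(1/2) is already strong enough.
  Polynomials over the field with p elements are represented in Z[X], with divisibility by the
  constant p in place of vanishing.\<close>

lemma poly_dvd_of_const_dvd:
  fixes c :: int assumes "[:c:] dvd f" shows "c dvd poly f x"
  using assms by (auto elim!: dvdE)

lemma const_poly_dvd_const:
  fixes c a :: int assumes "c dvd a" shows "[:c:] dvd [:a:]"
  using assms by (auto simp: const_poly_dvd_iff coeff_pCons split: nat.splits)

lemma smult_sum_right: "smult c (\<Sum>i\<in>I. f i) = (\<Sum>i\<in>I. smult c (f i))"
  by (induction I rule: infinite_finite_induct) (simp_all add: smult_add_right)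

lemma pderiv_sum: "pderiv (\<Sum>i\<in>I. f i) = (\<Sum>i\<in>I. pderiv (f i))"
  by (induction I rule: infinite_finite_induct) (simp_all add: pderiv_add)

text \<open>The derivation \<open>X(1-X) d/dX\<close> multiplies \<open>X\<^sup>m (1-X)\<^sup>n\<close> by a polynomial of low degree, so on points with
  prescribed \<open>t\<close>-th powers of \<open>x\<close> and \<open>1-x\<close> few linear conditions make its iterates vanish.\<close>

definition theta :: "int poly \<Rightarrow> int poly" where
  "theta f = [:0, 1, -1:] * pderiv f"

lemma theta_add: "theta (f + g) = theta f + theta g"
  by (simp add: theta_def pderiv_add algebra_simps)

lemma theta_smult: "theta (smult c f) = smult c (theta f)"
  by (simp add: theta_def pderiv_smult)

lemma theta_pow_add: "(theta ^^ k) (f + g) = (theta ^^ k) f + (theta ^^ k) g"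
  by (induction k) (simp_all add: theta_add)

lemma theta_pow_smult: "(theta ^^ k) (smult c f) = smult c ((theta ^^ k) f)"
  by (induction k) (simp_all add: theta_smult)

lemma theta_pow_sum: "(theta ^^ k) (\<Sum>i\<in>I. f i) = (\<Sum>i\<in>I. (theta ^^ k) (f i))"
proof (induction I rule: infinite_finite_induct)
  case (insert x F)
  thus ?case by (simp add: theta_pow_add)
next
  case empty
  show ?case using theta_pow_smult[of k 0 0] by simp
next
  case (infinite A)
  thus ?case using theta_pow_smult[of k 0 0] by simp
qed

lemma theta_root_power:
  "theta ([:-x, 1:] ^ Suc i * g) =
     [:-x, 1:] ^ i * (smult (int (Suc i)) ([:0, 1, -1:] * g) + [:-x, 1:] * theta g)"
proof -
  have "pderiv ([:-x, 1:] ^ Suc i) = smult (int (Suc i)) ([:-x, 1:] ^ i)"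
    by (simp only: pderiv_power_Suc) (simp add: pderiv_pCons)
  thus ?thesis
    unfolding theta_def by (simp add: pderiv_mult algebra_simps del: mult_pCons_left mult_pCons_right)
qed

text \<open>Each application of \<open>theta\<close> removes one factor X - x and contributes the
  current exponent times x(1-x). The iterates at x thus play the role of Taylor
  coefficients.\<close>

lemma poly_theta_pow_root:
  "poly ((theta ^^ j) ([:-x, 1:] ^ j * g)) x = fact j * (x * (1 - x)) ^ j * poly g x"
proof (induction j arbitrary: g)
  case (Suc j)
  show ?case
    by (simp only: funpow_Suc_right o_apply theta_root_power Suc.IH)
      (simp add: algebra_simps power_mult_distrib)
qed simp

lemma split_off_root:
  fixes f g a s c :: "'a :: comm_ring_1"
  assumes "g = a * s + c"
  shows "f - a ^ Suc D * s = (f - a ^ D * g) + a ^ D * c"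
  unfolding assms by (simp add: algebra_simps)

lemma split_off_root_cofactor:
  fixes M g g' k a s c :: "'a :: comm_ring_1"
  assumes "g = a * s + c"
  shows "a ^ Suc D * k - M * g = a * (a ^ D * k - M * s) - M * c"
    and "g - a ^ Suc D * g' = a * (s - a ^ D * g') + c"
  unfolding assms by (simp_all add: algebra_simps)

text \<open>Roots are split off one at a time. The D-th iterate at x is, modulo p, D! (x(1-x))^D
  times the value of the cofactor, and the first two factors are units because D < p at that stage
  and x is neither 0 nor 1 modulo p.\<close>

lemma root_order_mod_prime:
  fixes p :: nat
  assumes p: "prime p" and D: "D \<le> p" and x: "\<not> int p dvd x" "\<not> int p dvd 1 - x"
    and van: "\<And>k. k < D \<Longrightarrow> int p dvd poly ((theta ^^ k) f) x"
  shows "\<exists>g. [:int p:] dvd f - [:-x, 1:] ^ D * g"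
  using D van
proof (induction D)
  case 0
  show ?case by (intro exI[of _ f]) simp
next
  case (Suc D)
  have pp: "prime (int p)" using p by simp
  from Suc obtain g where g: "[:int p:] dvd f - [:-x, 1:] ^ D * g" by auto
  then obtain h where "f - [:-x, 1:] ^ D * g = [:int p:] * h" by (elim dvdE)
  hence f: "f = [:-x, 1:] ^ D * g + smult (int p) h"
    by (simp add: diff_eq_eq)
  have "int p dvd poly ((theta ^^ D) f) x" using Suc.prems by simp
  also have "poly ((theta ^^ D) f) x = fact D * (x * (1 - x)) ^ D * poly g x
      + int p * poly ((theta ^^ D) h) x"
    unfolding f theta_pow_add theta_pow_smult by (simp only: poly_add poly_smult poly_theta_pow_root)
  finally have "int p dvd fact D * (x * (1 - x)) ^ D * poly g x"
    by (simp add: dvd_add_left_iff)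
  moreover have "\<not> int p dvd fact D"
    using Suc.prems(1) p by (metis Suc_le_eq int_dvd_int_iff not_le of_nat_fact prime_dvd_fact_iff)
  moreover have "\<not> int p dvd (x * (1 - x)) ^ D"
    using x pp by (meson prime_dvd_mult_iff prime_dvd_power)
  ultimately have "int p dvd poly g x" using pp by (meson prime_dvd_mult_iff)
  hence d: "[:int p:] dvd [:poly g x:]" by (rule const_poly_dvd_const)
  have "g = [:-x, 1:] * synthetic_div g x + [:poly g x:]" by (simp only: synthetic_div_correct')
  hence "f - [:-x, 1:] ^ Suc D * synthetic_div g x = (f - [:-x, 1:] ^ D * g) + [:-x, 1:] ^ D * [:poly g x:]"
    by (rule split_off_root)
  thus ?case using dvd_add[OF g dvd_mult[OF d]] by metis
qed

section \<open>Roots with multiplicity modulo p\<close>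

lemma prime_elem_const_int: "prime (p::nat) \<Longrightarrow> prime_elem [:int p:]"
  by (intro lift_prime_elem_poly prime_imp_prime_elem) simp

text \<open>This stands in for coprimality of (X-y)^D and M over the field with p elements.
  Evaluation at y shows that g(y) vanishes modulo p, so g contains a factor X - y; that factor can
  be cancelled because \<open>[:int p:]\<close> is a prime element of Z[X].\<close>

lemma cofactor_root_order:
  fixes p :: nat
  assumes p: "prime p" and M: "\<not> int p dvd poly M y" and d: "[:int p:] dvd [:-y, 1:] ^ D * k - M * g"
  shows "\<exists>g'. [:int p:] dvd g - [:-y, 1:] ^ D * g'"
  using d
proof (induction D arbitrary: k g)
  case 0
  show ?case by (intro exI[of _ g]) simp
next
  case (Suc D)
  have pp: "prime (int p)" using p by simp
  have "int p dvd poly ([:-y, 1:] ^ Suc D * k - M * g) y"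
    using Suc.prems by (rule poly_dvd_of_const_dvd)
  hence "int p dvd poly M y * poly g y" by simp
  hence "int p dvd poly g y" using M pp by (meson prime_dvd_mult_iff)
  hence dd: "[:int p:] dvd [:poly g y:]" by (rule const_poly_dvd_const)
  define g1 where "g1 = synthetic_div g y"
  have g: "g = [:-y, 1:] * g1 + [:poly g y:]" unfolding g1_def by (simp only: synthetic_div_correct')
  have "[:int p:] dvd [:-y, 1:] * ([:-y, 1:] ^ D * k - M * g1) - M * [:poly g y:]"
    using Suc.prems unfolding split_off_root_cofactor(1)[OF g] .
  hence "[:int p:] dvd [:-y, 1:] * ([:-y, 1:] ^ D * k - M * g1)"
    using dvd_add[OF _ dvd_mult[OF dd, of M]] by fastforce
  moreover have "\<not> [:int p:] dvd [:-y, 1:]"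
  proof
    assume "[:int p:] dvd [:-y, 1:]"
    hence "int p dvd coeff [:-y, 1:] 1" by (metis const_poly_dvd_iff)
    thus False using p by (simp add: zdvd1_eq)
  qed
  ultimately have "[:int p:] dvd [:-y, 1:] ^ D * k - M * g1"
    using prime_elem_const_int[OF p] prime_elem_dvd_mult_iff by blast
  from Suc.IH[OF this] obtain g' where g': "[:int p:] dvd g1 - [:-y, 1:] ^ D * g'" by blast
  show ?case
    by (rule exI[of _ g'], subst split_off_root_cofactor(2)[OF g]) (intro dvd_add dvd_mult g' dd)
qed

text \<open>If p did not divide g, its highest coefficient that is nonzero modulo p would survive
  multiplication by the monic M, and M * g would have a nonzero coefficient beyond the degree of
  f.\<close>

lemma monic_multiple_small_degree:
  fixes p :: nat and M f g :: "int poly"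
  assumes M: "lead_coeff M = 1" and deg: "degree f < degree M" and d: "[:int p:] dvd f - M * g"
  shows "[:int p:] dvd f"
proof (cases "[:int p:] dvd g")
  case True
  thus ?thesis using d by (metis dvd_mult dvd_diff_left_iff)
next
  case False
  define N where "N = {i. \<not> int p dvd coeff g i}"
  have fin: "finite N"
    by (rule finite_subset[of _ "{..degree g}"]) (auto simp: N_def intro: le_degree)
  have ne: "N \<noteq> {}" using False by (auto simp: N_def const_poly_dvd_iff)
  define n where "n = Max N"
  have nN: "n \<in> N" unfolding n_def using fin ne by simp
  have big: "int p dvd coeff g i" if "i > n" for i
    using that fin unfolding n_def N_def by (metis (mono_tags, lifting) Max_ge leD mem_Collect_eq N_def)
  have "coeff (M * g) (degree M + n) = (\<Sum>i\<le>degree M + n. coeff M i * coeff g (degree M + n - i))"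
    by (simp add: coeff_mult)
  also have "\<dots> = coeff M (degree M) * coeff g n
      + (\<Sum>i\<in>{..degree M + n} - {degree M}. coeff M i * coeff g (degree M + n - i))"
    by (subst sum.remove[of _ "degree M"]) auto
  finally have e: "coeff (M * g) (degree M + n) = coeff g n
      + (\<Sum>i\<in>{..degree M + n} - {degree M}. coeff M i * coeff g (degree M + n - i))" using M by simp
  have "int p dvd (\<Sum>i\<in>{..degree M + n} - {degree M}. coeff M i * coeff g (degree M + n - i))"
  proof (rule dvd_sum)
    fix i assume i: "i \<in> {..degree M + n} - {degree M}"
    show "int p dvd coeff M i * coeff g (degree M + n - i)"
    proof (cases "i < degree M")
      case True
      thus ?thesis using big[of "degree M + n - i"] i by auto
    next
      case False
      thus ?thesis using i by (simp add: coeff_eq_0)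
    qed
  qed
  moreover have "int p dvd coeff f (degree M + n) - coeff (M * g) (degree M + n)"
    using d by (metis const_poly_dvd_iff coeff_diff)
  moreover have "coeff f (degree M + n) = 0" using deg by (simp add: coeff_eq_0)
  ultimately have "int p dvd coeff g n" unfolding e
    by (metis diff_0 dvd_add_left_iff dvd_minus_iff)
  thus ?thesis using nN by (simp add: N_def)
qed

text \<open>The factors (X-x)^D of the points already treated are units at the next point, so they
  can be collected into one product. It is monic of degree \<open>D * card S\<close> and cannot
  divide a nonzero polynomial of smaller degree modulo p.\<close>

lemma degree_ge_roots_mod_prime:
  fixes p :: nat
  assumes p: "prime p" and D: "D \<le> p" and S: "finite S" "S \<subseteq> {2..<int p}"
    and van: "\<And>x k. x \<in> S \<Longrightarrow> k < D \<Longrightarrow> int p dvd poly ((theta ^^ k) f) x"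
    and nz: "\<not> [:int p:] dvd f"
  shows "D * card S \<le> degree f"
proof -
  have pp: "prime (int p)" using p by simp
  have ord: "\<exists>g. [:int p:] dvd f - [:-x, 1:] ^ D * g" if "x \<in> S" for x
  proof (rule root_order_mod_prime[OF p D])
    have "2 \<le> x" "x < int p" using that S by auto
    thus "\<not> int p dvd x" "\<not> int p dvd 1 - x"
      by (auto dest!: zdvd_imp_le simp: dvd_diff_commute[of _ 1])
  qed (use van that in auto)
  have "\<exists>g. [:int p:] dvd f - (\<Prod>x\<in>A. [:-x, 1:] ^ D) * g" if "finite A" "A \<subseteq> S" for A
    using that
  proof (induction A rule: finite_induct)
    case empty
    show ?case by (intro exI[of _ f]) simp
  next
    case (insert y A)
    then obtain g where g: "[:int p:] dvd f - (\<Prod>x\<in>A. [:-x, 1:] ^ D) * g" by auto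
    obtain k where k: "[:int p:] dvd f - [:-y, 1:] ^ D * k" using ord insert.prems by auto
    have "[:int p:] dvd (f - (\<Prod>x\<in>A. [:-x, 1:] ^ D) * g) - (f - [:-y, 1:] ^ D * k)"
      using g k by (rule dvd_diff)
    hence d: "[:int p:] dvd [:-y, 1:] ^ D * k - (\<Prod>x\<in>A. [:-x, 1:] ^ D) * g" by simp
    have "\<not> int p dvd poly (\<Prod>x\<in>A. [:-x, 1:] ^ D) y"
    proof
      assume "int p dvd poly (\<Prod>x\<in>A. [:-x, 1:] ^ D) y"
      hence "int p dvd (\<Prod>x\<in>A. (y - x) ^ D)" by (simp add: poly_prod)
      then obtain x where x: "x \<in> A" "int p dvd (y - x) ^ D"
        using pp insert.hyps(1) by (auto simp: prime_dvd_prod_iff)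
      have "int p dvd y - x" using prime_dvd_power[OF pp x(2)] .
      moreover have "x \<noteq> y" "x \<in> {2..<int p}" "y \<in> {2..<int p}" using x insert S by auto
      ultimately show False
        using cong_less_imp_eq_int[of y "int p" x] by (auto simp: cong_iff_dvd_diff)
    qed
    from cofactor_root_order[OF p this d] obtain g' where g': "[:int p:] dvd g - [:-y, 1:] ^ D * g'" by blast
    have "f - a * b * g' = (f - b * g) + b * (g - a * g')" for a b :: "int poly"
      by (simp add: algebra_simps)
    note e = this[of "[:-y, 1:] ^ D" "\<Prod>x\<in>A. [:-x, 1:] ^ D"]
    show ?case
      by (rule exI[of _ g'], subst prod.insert[OF insert.hyps], subst e) (intro dvd_add dvd_mult g g')
  qed
  from this[OF S(1)] obtain g where g: "[:int p:] dvd f - (\<Prod>x\<in>S. [:-x, 1:] ^ D) * g" by blast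
  have "degree (\<Prod>x\<in>S. [:-x, 1:] ^ D) = (\<Sum>x\<in>S. D)"
    by (subst degree_prod_sum_eq) (auto simp: degree_power_eq)
  moreover have "lead_coeff (\<Prod>x\<in>S. [:-x, 1:] ^ D) = 1"
    by (simp add: lead_coeff_prod lead_coeff_power)
  ultimately show ?thesis
    using monic_multiple_small_degree[OF _ _ g] nz by (simp add: mult.commute) (meson not_le)
qed

text \<open>A nonzero combination of at most T monomials cannot vanish to order T at 1. The operator
  X d/dX - e0 kills the monomial of exponent e0, lowers the order at 1 by only one, and multiplies
  each other coefficient by e - e0, a unit because all exponents are below p.\<close>

lemma sparse_vanishing_at_one:
  fixes p :: nat
  assumes p: "prime p" and "finite S" "S \<subseteq> {..<p}" "card S \<le> T"
    and "[:int p:] dvd (\<Sum>e\<in>S. monom (l e) e) + [:1, -1:] ^ T * R"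
  shows "\<forall>e\<in>S. int p dvd l e"
  using assms(2-)
proof (induction S arbitrary: T l R rule: finite_induct)
  case (insert e0 S)
  have pp: "prime (int p)" using p by simp
  obtain T' where T: "T = Suc T'" using insert by (cases T) auto
  define f where "f = (\<Sum>e\<in>insert e0 S. monom (l e) e) + [:1, -1:] ^ T * R"
  define f' where "f' = [:0, 1:] * pderiv f - smult (int e0) f"
  obtain h where h: "f = smult (int p) h" using insert.prems(3) unfolding f_def by (auto elim!: dvdE)
  have dv: "[:int p:] dvd f'"
    unfolding f'_def h pderiv_smult by (auto simp: const_poly_dvd_iff coeff_pCons split: nat.splits)
  define R' where "R' = [:0,1:] * ([:1,-1:] * pderiv R - smult (int T) R) - smult (int e0) ([:1,-1:] * R)"
  have m: "[:0, 1:] * pderiv (monom (l e) e) - smult (int e0) (monom (l e) e) = monom (l e * (int e - int e0)) e" for e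
    by (cases e) (simp_all add: pderiv_monom monom_Suc[symmetric] smult_monom diff_monom algebra_simps monom_0)
  have pw: "pderiv ([:1, -1:] ^ Suc T') = smult (- int T) ([:1, -1:] ^ T')"
    unfolding T by (simp only: pderiv_power_Suc) (simp add: pderiv_pCons)
  have "f' = (\<Sum>e\<in>insert e0 S. monom (l e * (int e - int e0)) e) + [:1, -1:] ^ T' * R'"
    unfolding f'_def f_def m[symmetric] pderiv_add pderiv_sum T pderiv_mult pw R'_def
    by (simp add: sum_subtractf sum_distrib_left smult_sum_right algebra_simps smult_add_right smult_diff_right T
        del: mult_pCons_left mult_pCons_right) (simp add: smult_add_left[symmetric])
  also have "(\<Sum>e\<in>insert e0 S. monom (l e * (int e - int e0)) e) = (\<Sum>e\<in>S. monom (l e * (int e - int e0)) e)"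
    using insert.hyps by simp
  finally have "[:int p:] dvd (\<Sum>e\<in>S. monom (l e * (int e - int e0)) e) + [:1, -1:] ^ T' * R'"
    using dv by simp
  from insert.IH[OF _ _ this] have IH: "\<forall>e\<in>S. int p dvd l e * (int e - int e0)"
    using insert.prems insert.hyps T by auto
  have S: "int p dvd l e" if "e \<in> S" for e
  proof -
    have "\<not> int p dvd int e - int e0"
    proof
      assume "int p dvd int e - int e0"
      moreover have "e \<noteq> e0" "e < p" "e0 < p" using that insert by auto
      ultimately show False
        using cong_less_modulus_unique_nat[of e e0 p] by (simp add: cong_iff_dvd_diff flip: cong_int_iff)
    qed
    thus ?thesis using IH that pp by (meson prime_dvd_mult_iff)
  qed
  \<comment> \<open>As T is positive, the second summand of f vanishes at 1; only the coefficient at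
    e0 is still undetermined.\<close>
  have "int p dvd poly f 1" unfolding f_def using insert.prems(3) by (rule poly_dvd_of_const_dvd)
  hence "int p dvd l e0 + (\<Sum>e\<in>S. l e)"
    using insert.hyps unfolding f_def T by (simp add: poly_sum poly_monom)
  moreover have "int p dvd (\<Sum>e\<in>S. l e)" by (rule dvd_sum) (rule S)
  ultimately have "int p dvd l e0" by (simp add: dvd_add_left_iff)
  thus ?case using S by auto
qed simp


text \<open>The cofactor of X^m (1-X)^n in the k-th iterate of \<open>theta\<close> at X^m (1-X)^n
  X^a. Keeping the powers apart allows x^t and (1-x)^t to be replaced by constants later. The linear
  factor m(1-X) - nX is the logarithmic derivative of X^m (1-X)^n times X(1-X).\<close>

primrec qp :: "int \<Rightarrow> int \<Rightarrow> nat \<Rightarrow> nat \<Rightarrow> int poly" where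
  "qp m n a 0 = monom 1 a"
| "qp m n a (Suc k) = [:m, -(m + n):] * qp m n a k + [:0, 1, -1:] * pderiv (qp m n a k)"

lemma degree_qp: "degree (qp m n a k) \<le> a + k"
proof (induction k)
  case 0
  show ?case by (simp add: degree_monom_eq)
next
  case (Suc k)
  have "degree ([:m, -(m + n):] * qp m n a k) \<le> 1 + degree (qp m n a k)"
    by (rule order_trans[OF degree_mult_le]) (simp add: degree_pCons_le)
  moreover have "degree ([:0, 1, -1:] * pderiv (qp m n a k)) \<le> 1 + degree (qp m n a k)"
  proof (cases "degree (qp m n a k) = 0")
    case True
    hence "pderiv (qp m n a k) = 0" by (simp add: pderiv_eq_0_iff)
    thus ?thesis by (simp only: mult_zero_right degree_0)
  next
    case False
    have "degree ([:0, 1, -1:] * pderiv (qp m n a k)) \<le> degree [:0, 1, -1::int:] + degree (pderiv (qp m n a k))"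
      by (rule degree_mult_le)
    thus ?thesis using False by (simp add: degree_pderiv)
  qed
  ultimately show ?case using Suc.IH
    by (simp only: qp.simps) (intro order_trans[OF degree_add_le_max], auto)
qed

lemma theta_basis_step:
  "theta ([:0, 1:] ^ m * [:1, -1:] ^ n * q) =
     [:0, 1:] ^ m * [:1, -1:] ^ n * ([:int m, -(int m + int n):] * q + [:0, 1, -1:] * pderiv q)"
proof -
  define x y :: "int poly" where "x = [:0, 1:]" and "y = [:1, -1:]"
  have xy: "[:0, 1, -1:] = x * y" by (simp add: x_def y_def)
  have mn: "[:int m, -(int m + int n):] = of_nat m * y - of_nat n * x"
    by (simp add: x_def y_def of_nat_poly)
  have px: "pderiv x = 1" "pderiv y = -1" by (simp_all add: x_def y_def pderiv_pCons one_pCons)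
  have smult_conv_of_nat: "smult (int k) f = of_nat k * f" for k and f :: "int poly"
    by (simp add: of_nat_poly)
  have dx: "x * pderiv (x ^ m) = of_nat m * x ^ m"
  proof (cases m)
    case (Suc k)
    show ?thesis unfolding Suc pderiv_power_Suc px smult_conv_of_nat by (simp only: power_Suc mult_1_right mult_ac)
  qed simp
  have dy: "y * pderiv (y ^ n) = - of_nat n * y ^ n"
  proof (cases n)
    case (Suc k)
    show ?thesis unfolding Suc pderiv_power_Suc px smult_conv_of_nat
      by (simp only: power_Suc mult_minus_right mult_minus_left mult_1_right mult_ac)
  qed simp
  have "theta (x ^ m * y ^ n * q) = y * (x * pderiv (x ^ m)) * y ^ n * q
      + x * x ^ m * (y * pderiv (y ^ n)) * q + x ^ m * y ^ n * (x * y * pderiv q)"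
    unfolding theta_def xy by (simp add: pderiv_mult algebra_simps)
  also have "\<dots> = x ^ m * y ^ n * ((of_nat m * y - of_nat n * x) * q + x * y * pderiv q)"
    unfolding dx dy by (simp add: algebra_simps)
  finally show ?thesis unfolding xy mn unfolding x_def y_def .
qed

lemma theta_pow_basis:
  "(theta ^^ k) ([:0, 1:] ^ m * [:1, -1:] ^ n * monom 1 a) =
     [:0, 1:] ^ m * [:1, -1:] ^ n * qp (int m) (int n) a k"
  by (induction k) (simp_all add: theta_basis_step del: mult_pCons_left mult_pCons_right)

text \<open>Take the lowest power (1-X)^(tc) whose coefficient polynomial is nonzero modulo p and
  divide by it. What remains is a combination of at most A * B <= t monomials plus a multiple of
  (1-X)^t, so \<open>sparse_vanishing_at_one\<close> applies. The exponents a + tb are distinct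
  since A <= t and below p by the degree condition.\<close>

lemma stepanov_nonvanishing:
  fixes p t A B :: nat and l :: "nat \<times> nat \<times> nat \<Rightarrow> int"
  assumes p: "prime p" and AB: "A * B \<le> t" and deg: "A + t * B \<le> p"
    and nz: "\<exists>w\<in>{..<A} \<times> {..<B} \<times> {..<B}. \<not> int p dvd l w"
  shows "\<not> [:int p:] dvd (\<Sum>w\<in>{..<A} \<times> {..<B} \<times> {..<B}. smult (l w)
     ([:0, 1:] ^ (t * fst (snd w)) * [:1, -1:] ^ (t * snd (snd w)) * monom 1 (fst w)))" (is "\<not> _ dvd ?F")
proof
  assume dv: "[:int p:] dvd ?F"
  from nz obtain a0 b0 c0 where abc: "a0 < A" "b0 < B" "c0 < B" "\<not> int p dvd l (a0, b0, c0)" by auto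
  have "A * 1 \<le> A * B" using abc(2) by (intro mult_le_mono) auto
  hence At: "A \<le> t" using AB by linarith
  define Q where "Q c = (\<Sum>a<A. \<Sum>b<B. monom (l (a, b, c)) (a + t * b))" for c
  have Xm: "smult z ([:0, 1:] ^ m * y * monom 1 a) = y * monom z (a + m)" for z m a and y :: "int poly"
    by (simp add: monom_altdef power_add algebra_simps del: mult_pCons_left mult_pCons_right)
  have "?F = (\<Sum>a<A. \<Sum>b<B. \<Sum>c<B. [:1, -1:] ^ (t * c) * monom (l (a, b, c)) (a + t * b))"
    by (simp only: Xm) (simp add: sum.cartesian_product split_def)
  also have "\<dots> = (\<Sum>c<B. \<Sum>a<A. \<Sum>b<B. [:1, -1:] ^ (t * c) * monom (l (a, b, c)) (a + t * b))"
    by (subst sum.swap[of _ _ "{..<A}", symmetric]) (intro sum.cong refl sum.swap)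
  also have "\<dots> = (\<Sum>c<B. [:1, -1:] ^ (t * c) * Q c)"
    by (simp only: Q_def sum_distrib_left)
  finally have F: "?F = (\<Sum>c<B. [:1, -1:] ^ (t * c) * Q c)" .
  define c1 where "c1 = (LEAST c. c < B \<and> (\<exists>a<A. \<exists>b<B. \<not> int p dvd l (a, b, c)))"
  have c1: "c1 < B \<and> (\<exists>a<A. \<exists>b<B. \<not> int p dvd l (a, b, c1))"
    unfolding c1_def by (rule LeastI[of _ c0]) (use abc in auto)
  have low: "[:int p:] dvd Q c" if "c < c1" for c
  proof -
    have "int p dvd l (a, b, c)" if "a < A" "b < B" for a b
      using not_less_Least[OF \<open>c < c1\<close>[unfolded c1_def]] that c1 \<open>c < c1\<close> by auto
    thus ?thesis unfolding Q_def by (intro dvd_sum) (auto simp: const_poly_dvd_iff)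
  qed
  define R where "R = (\<Sum>c\<in>{c1<..<B}. [:1, -1:] ^ (t * (c - Suc c1)) * Q c)"
  have "{..<B} = {..<c1} \<union> ({c1} \<union> {c1<..<B})" using c1 by auto
  hence "(\<Sum>c<B. [:1, -1:] ^ (t * c) * Q c) = (\<Sum>c<c1. [:1, -1:] ^ (t * c) * Q c)
     + ([:1, -1:] ^ (t * c1) * Q c1 + (\<Sum>c\<in>{c1<..<B}. [:1, -1:] ^ (t * c) * Q c))"
    by (simp only:) (subst sum.union_disjoint, simp, simp, force,
      simp add: sum.union_disjoint del: mult_pCons_left mult_pCons_right)
  also have "(\<Sum>c\<in>{c1<..<B}. [:1, -1:] ^ (t * c) * Q c) = [:1, -1:] ^ (t * c1) * ([:1, -1:] ^ t * R)"
    unfolding R_def sum_distrib_left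
  proof (rule sum.cong)
    fix c assume "c \<in> {c1<..<B}"
    hence "t * c = t * c1 + (t + t * (c - Suc c1))" 
      by (metis Suc_leI add_Suc add_mult_distrib2 greaterThanLessThan_iff le_add_diff_inverse mult_Suc_right add.assoc add.commute)
    thus "[:1, -1:] ^ (t * c) * Q c = [:1, -1:] ^ (t * c1) * ([:1, -1:] ^ t * ([:1, -1:] ^ (t * (c - Suc c1)) * Q c))"
      by (simp only: power_add mult.assoc)
  qed simp
  finally have "?F = (\<Sum>c<c1. [:1, -1:] ^ (t * c) * Q c)
     + [:1, -1:] ^ (t * c1) * (Q c1 + [:1, -1:] ^ t * R)" unfolding F by (simp only: distrib_left)
  moreover have "[:int p:] dvd (\<Sum>c<c1. [:1, -1:] ^ (t * c) * Q c)"
    by (rule dvd_sum) (use low in auto)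
  ultimately have "[:int p:] dvd [:1, -1:] ^ (t * c1) * (Q c1 + [:1, -1:] ^ t * R)"
    using dv by (simp only: dvd_add_right_iff)
  moreover have "\<not> [:int p:] dvd [:1, -1:] ^ (t * c1)"
  proof
    assume "[:int p:] dvd [:1, -1:] ^ (t * c1)"
    hence "int p dvd poly ([:1, -1:] ^ (t * c1)) 0" by (rule poly_dvd_of_const_dvd)
    thus False using p by simp
  qed
  ultimately have d1: "[:int p:] dvd Q c1 + [:1, -1:] ^ t * R"
    using prime_elem_const_int[OF p] prime_elem_dvd_mult_iff by blast
  define S where "S = (\<lambda>(a, b). a + t * b) ` ({..<A} \<times> {..<B})"
  have inj: "inj_on (\<lambda>(a, b). a + t * b) ({..<A} \<times> {..<B})"
  proof (rule inj_onI, clarsimp)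
    fix a b a' b' assume "a < A" "a' < A" and e: "a + t * b = a' + t * b'"
    hence l: "a < t" "a' < t" using At by auto
    have "a = (a + t * b) mod t" "a' = (a' + t * b') mod t" "b = (a + t * b) div t" "b' = (a' + t * b') div t"
      using l by auto
    thus "a = a' \<and> b = b'" using e by metis
  qed
  have "Q c1 = (\<Sum>(a,b)\<in>{..<A} \<times> {..<B}. monom (l (a, b, c1)) (a + t * b))"
    unfolding Q_def by (simp add: sum.cartesian_product)
  also have "\<dots> = (\<Sum>e\<in>S. monom (l (e mod t, e div t, c1)) e)"
    unfolding S_def by (subst sum.reindex[OF inj]) (use At in \<open>auto intro!: sum.cong\<close>)
  finally have Q: "Q c1 = (\<Sum>e\<in>S. monom (l (e mod t, e div t, c1)) e)" .
  have "card S \<le> t" unfolding S_def using card_image[OF inj] AB by simp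
  moreover have "S \<subseteq> {..<p}"
  proof
    fix e assume "e \<in> S"
    then obtain a b where ab: "a < A" "b < B" "e = a + t * b" unfolding S_def by auto
    have "t * b \<le> t * B" using ab by (intro mult_le_mono) auto
    hence "a + t * b < p" using ab(1) deg by linarith
    thus "e \<in> {..<p}" using ab by simp
  qed
  moreover have "finite S" unfolding S_def by simp
  ultimately have "\<forall>e\<in>S. int p dvd l (e mod t, e div t, c1)"
    using sparse_vanishing_at_one[OF p, of S t "\<lambda>e. l (e mod t, e div t, c1)" R] d1 Q by auto
  moreover obtain a b where ab: "a < A" "b < B" "\<not> int p dvd l (a, b, c1)" using c1 by auto
  moreover have "a + t * b \<in> S" unfolding S_def using ab by auto
  moreover have "(a + t * b) mod t = a" "(a + t * b) div t = b" using ab At by auto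
  ultimately show False by metis
qed

text \<open>By pigeonhole two vectors in \<open>{0..<p}\<close> have the same image; their difference is the solution.\<close>

lemma linear_system_mod_prime:
  fixes p :: nat and M :: "'j \<Rightarrow> 'i \<Rightarrow> int"
  assumes p: "prime p" and fin: "finite I" "finite J" and card: "card J < card I"
  obtains l where "\<exists>i\<in>I. \<not> int p dvd l i" "\<forall>j\<in>J. int p dvd (\<Sum>i\<in>I. l i * M j i)"
proof -
  define \<Phi> where "\<Phi> l = (\<lambda>j\<in>J. (\<Sum>i\<in>I. l i * M j i) mod int p)" for l
  have p0: "p > 1" using p prime_gt_1_nat by blast
  have "\<Phi> ` (I \<rightarrow>\<^sub>E {0..<int p}) \<subseteq> (J \<rightarrow>\<^sub>E {0..<int p})"
    unfolding \<Phi>_def using p0 by auto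
  hence "card (\<Phi> ` (I \<rightarrow>\<^sub>E {0..<int p})) \<le> card (J \<rightarrow>\<^sub>E {0..<int p})"
    by (rule card_mono[rotated]) (simp add: fin finite_PiE)
  also have "\<dots> = p ^ card J" using fin by (simp add: card_PiE)
  also have "\<dots> < p ^ card I" using p0 card by simp
  also have "\<dots> = card (I \<rightarrow>\<^sub>E {0..<int p})" using fin by (simp add: card_PiE)
  finally have "\<not> inj_on \<Phi> (I \<rightarrow>\<^sub>E {0..<int p})" by (rule pigeonhole)
  then obtain l1 l2 where l: "l1 \<in> I \<rightarrow>\<^sub>E {0..<int p}" "l2 \<in> I \<rightarrow>\<^sub>E {0..<int p}" "l1 \<noteq> l2" "\<Phi> l1 = \<Phi> l2"
    unfolding inj_on_def by blast
  show thesis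
  proof (rule that[of "\<lambda>i. l1 i - l2 i"])
    obtain i where i: "i \<in> I" "l1 i \<noteq> l2 i" using l(1-3) by (meson PiE_ext)
    have "l1 i \<in> {0..<int p}" "l2 i \<in> {0..<int p}" using l i by auto
    hence "\<not> int p dvd l1 i - l2 i"
      using cong_less_imp_eq_int[of "l1 i" "int p" "l2 i"] i(2) by (auto simp: cong_iff_dvd_diff)
    thus "\<exists>i\<in>I. \<not> int p dvd l1 i - l2 i" using i by blast
    show "\<forall>j\<in>J. int p dvd (\<Sum>i\<in>I. (l1 i - l2 i) * M j i)"
    proof
      fix j assume "j \<in> J"
      hence "(\<Sum>i\<in>I. l1 i * M j i) mod int p = (\<Sum>i\<in>I. l2 i * M j i) mod int p"
        using fun_cong[OF l(4), of j] by (simp add: \<Phi>_def)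
      thus "int p dvd (\<Sum>i\<in>I. (l1 i - l2 i) * M j i)"
        by (simp add: mod_eq_dvd_iff left_diff_distrib sum_subtractf)
    qed
  qed
qed

text \<open>On one class x^t and (1-x)^t are constants, so each of the D iterates agrees there with
  a polynomial of degree below A + D. Making all its coefficients vanish costs D(A+D) linear
  conditions per class. The A * B * B unknowns outnumber them, and the degree of the resulting
  nonzero polynomial bounds its roots counted D times.\<close>

lemma stepanov_bound:
  fixes p t A B D :: nat and UV :: "(int \<times> int) set"
  assumes p: "prime p" and AB: "A * B \<le> t" and deg: "A + t * B \<le> p" and D: "D \<le> p"
    and UV: "finite UV" and num: "card UV * (D * (A + D)) < A * B * B"
    and S: "S \<subseteq> {2..<int p}"
    and cl: "\<And>x. x \<in> S \<Longrightarrow> (x ^ t mod int p, (1 - x) ^ t mod int p) \<in> UV"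
  shows "D * card S \<le> A + 2 * t * B"
proof -
  define I where "I = {..<A} \<times> {..<B} \<times> {..<B}"
  define J where "J = UV \<times> {..<D} \<times> {..<A + D}"
  define q where "q w k = qp (int (t * fst (snd w))) (int (t * snd (snd w))) (fst w) k" for w :: "nat \<times> nat \<times> nat" and k
  define M where "M j w = fst (fst j) ^ fst (snd w) * snd (fst j) ^ snd (snd w) * coeff (q w (fst (snd j))) (snd (snd j))"
    for j :: "(int \<times> int) \<times> nat \<times> nat" and w :: "nat \<times> nat \<times> nat"
  have "card J < card I" using num unfolding I_def J_def by (simp add: card_cartesian_product algebra_simps)
  moreover have "finite I" "finite J" unfolding I_def J_def using UV by auto
  ultimately obtain l where l: "\<exists>w\<in>I. \<not> int p dvd l w" "\<forall>j\<in>J. int p dvd (\<Sum>w\<in>I. l w * M j w)"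
    using linear_system_mod_prime[OF p, of I J M] by blast
  define b where "b w = [:0, 1:] ^ (t * fst (snd w)) * [:1, -1:] ^ (t * snd (snd w)) * monom (1::int) (fst w)" for w :: "nat \<times> nat \<times> nat"
  define F where "F = (\<Sum>w\<in>I. smult (l w) (b w))"
  have nz: "\<not> [:int p:] dvd F"
    unfolding F_def b_def I_def using stepanov_nonvanishing[OF p AB deg] l(1) unfolding I_def by blast
  have "degree F \<le> A + 2 * t * B"
    unfolding F_def
  proof (rule degree_sum_le)
    fix w assume w: "w \<in> I"
    have "degree (smult (l w) (b w)) \<le> degree (b w)" by (rule degree_smult_le)
    also have "\<dots> \<le> degree ([:0, 1::int:] ^ (t * fst (snd w))) + degree ([:1, -1::int:] ^ (t * snd (snd w))) + degree (monom (1::int) (fst w))"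
      unfolding b_def using degree_mult_le order_trans add_le_mono1 by (metis (no_types, lifting))
    also have "\<dots> \<le> t * fst (snd w) + t * snd (snd w) + fst w"
      by (intro add_mono order_trans[OF degree_power_le]) (auto simp: degree_monom_eq)
    also have "\<dots> \<le> t * B + t * B + A"
      using w unfolding I_def by (intro add_mono mult_left_mono) auto
    finally show "degree (smult (l w) (b w)) \<le> A + 2 * t * B" by simp
  qed (simp add: \<open>finite I\<close>)
  moreover have "D * card S \<le> degree F"
  proof (rule degree_ge_roots_mod_prime[OF p D _ S _ nz])
    show "finite S" using S by (rule finite_subset) simp
    fix x k assume x: "x \<in> S" and k: "k < D"
    define u v where "u = x ^ t mod int p" and "v = (1 - x) ^ t mod int p"
    have uv: "(u, v) \<in> UV" using cl[OF x] by (simp add: u_def v_def)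
    have "poly ((theta ^^ k) F) x = (\<Sum>w\<in>I. l w * ((x ^ t) ^ fst (snd w) * ((1 - x) ^ t) ^ snd (snd w) * poly (q w k) x))"
      unfolding F_def theta_pow_sum theta_pow_smult b_def theta_pow_basis q_def[symmetric]
      by (simp add: poly_sum power_mult)
    also have "[\<dots> = (\<Sum>w\<in>I. l w * (u ^ fst (snd w) * v ^ snd (snd w) * poly (q w k) x))] (mod int p)"
      unfolding u_def v_def by (intro cong_sum cong_mult cong_pow cong_refl) (simp_all add: unique_euclidean_semiring_class.cong_def)
    also have "(\<Sum>w\<in>I. l w * (u ^ fst (snd w) * v ^ snd (snd w) * poly (q w k) x)) =
        (\<Sum>w\<in>I. \<Sum>i<A+D. x ^ i * (l w * M ((u, v), k, i) w))"
    proof (rule sum.cong)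
      fix w assume w: "w \<in> I"
      have "degree (q w k) < A + D" unfolding q_def
        by (rule le_less_trans[OF degree_qp]) (use w k in \<open>auto simp: I_def\<close>)
      hence "poly (q w k) x = (\<Sum>i<A+D. coeff (q w k) i * x ^ i)"
        unfolding poly_altdef by (intro sum.mono_neutral_left) (auto simp: coeff_eq_0 not_le)
      thus "l w * (u ^ fst (snd w) * v ^ snd (snd w) * poly (q w k) x) = (\<Sum>i<A+D. x ^ i * (l w * M ((u, v), k, i) w))"
        by (simp add: M_def sum_distrib_left algebra_simps)
    qed simp
    also have "\<dots> = (\<Sum>i<A+D. x ^ i * (\<Sum>w\<in>I. l w * M ((u, v), k, i) w))"
      by (subst sum.swap) (simp add: sum_distrib_left)
    also have "[\<dots> = 0] (mod int p)"
      unfolding cong_0_iff by (intro dvd_sum dvd_mult l(2)[rule_format]) (use uv k in \<open>auto simp: J_def\<close>)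
    finally show "int p dvd poly ((theta ^^ k) F) x" by (simp add: cong_0_iff)
  qed
  ultimately show ?thesis by simp
qed

section \<open>Stepanov's bound\<close>

definition stepanov_points :: "nat \<Rightarrow> nat \<Rightarrow> (int \<times> int) set \<Rightarrow> int set" where
  "stepanov_points p t UV = {x \<in> {2..<int p}. (x ^ t mod int p, (1 - x) ^ t mod int p) \<in> UV}"

lemma finite_stepanov_points [simp]: "finite (stepanov_points p t UV)"
  unfolding stepanov_points_def by (rule finite_subset[of _ "{2..<int p}"]) auto

text \<open>The parameters are \<open>A = D\<close> about \<open>(t\<^sup>2 / 16n)\<^sup>1\<^sup>/\<^sup>3\<close> and \<open>B = t div A\<close>.\<close>

lemma card_stepanov_points_few:
  fixes p t :: nat
  assumes p: "prime p" and t: "t \<ge> 1" "p \<le> t\<^sup>2" and UV: "finite UV" "UV \<noteq> {}"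
    and n: "1024 * card UV * t ^ 4 \<le> p ^ 3"
  shows "real (card (stepanov_points p t UV)) ^ 3 \<le> 442368 * real (card UV) ^ 2 * real t ^ 2"
proof -
  define n where "n = card UV"
  have n1: "n \<ge> 1" using UV by (simp add: n_def Suc_le_eq card_gt_0_iff)
  have p0: "real p > 0" using p prime_gt_0_nat by simp
  have t0: "real t \<ge> 1" using t by simp
  define \<alpha> where "\<alpha> = root 3 (real t ^ 2 / (16 * real n))"
  have \<alpha>3: "\<alpha> ^ 3 = real t ^ 2 / (16 * real n)" unfolding \<alpha>_def by (subst real_root_pow_pos2) auto
  have \<alpha>0: "\<alpha> \<ge> 0" unfolding \<alpha>_def by simp
  have nR: "1024 * real n * real t ^ 4 \<le> real p ^ 3"
  proof -
    have "real (1024 * n * t ^ 4) \<le> real (p ^ 3)" using n unfolding n_def of_nat_le_iff .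
    thus ?thesis by simp
  qed
  \<comment> \<open>The hypothesis on \<open>card UV\<close> is exactly this inequality between
    cubes. It will give t * B <= p/2, which keeps the exponents below p.\<close>
  have "(4 * real t ^ 2 / real p) ^ 3 \<le> \<alpha> ^ 3"
  proof -
    have "64 * real t ^ 6 * (16 * real n) \<le> real t ^ 2 * real p ^ 3"
      using mult_left_mono[OF nR, of "real t ^ 2"] by (simp add: algebra_simps flip: power_add)
    thus ?thesis unfolding \<alpha>3 using p0 n1
      by (simp add: field_simps power_divide flip: power_mult)
  qed
  hence \<alpha>1: "4 * real t ^ 2 / real p \<le> \<alpha>"
    using power_mono_iff[of "4 * real t ^ 2 / real p" \<alpha> 3] \<alpha>0 by simp
  have "real p \<le> real t ^ 2" using t(2) by (metis of_nat_le_iff of_nat_power)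
  hence "4 \<le> 4 * real t ^ 2 / real p" using p0 by (simp add: field_simps)
  hence \<alpha>4: "\<alpha> \<ge> 4" using \<alpha>1 by linarith
  define A where "A = nat \<lfloor>\<alpha>\<rfloor>"
  have A: "real A \<le> \<alpha>" "\<alpha> / 2 \<le> real A" unfolding A_def using \<alpha>4 by linarith+
  have A2: "real A \<ge> 2" using A \<alpha>4 by linarith
  have A3: "real A ^ 3 * (16 * real n) \<le> real t ^ 2"
    using power_mono[OF A(1), of 3] \<alpha>3 n1 by (simp add: field_simps)
  have "real A ^ 3 \<le> (real t / 2) ^ 3"
  proof -
    have "real A ^ 3 * 16 \<le> real A ^ 3 * (16 * real n)" using n1 by (intro mult_left_mono) auto
    also have "\<dots> \<le> real t ^ 2" by (rule A3)
    also have "\<dots> \<le> real t ^ 3" using t0 by (intro power_increasing) auto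
    finally have "real A ^ 3 * 8 \<le> real t ^ 3" using zero_le_power[of "real A" 3] by linarith
    thus ?thesis by (simp add: power_divide)
  qed
  hence At: "real A \<le> real t / 2" using power_mono_iff[of "real A" "real t / 2" 3] by simp
  define B where "B = t div A"
  have AB: "A * B \<le> t" unfolding B_def by simp
  have ABR: "real A * real B \<le> real t" using AB by (metis of_nat_le_iff of_nat_mult)
  have "t < A * (B + 1)" unfolding B_def using A2 by (simp add: dividend_less_times_div)
  hence "real t < real A * (real B + 1)" by (metis of_nat_less_iff of_nat_mult of_nat_add of_nat_1)
  hence AB2: "real t < 2 * (real A * real B)" using At by (simp add: algebra_simps)
  have "real t ^ 2 < (2 * (real A * real B)) ^ 2" using AB2 by (intro power_strict_mono) auto
  hence "real A ^ 3 * (16 * real n) < 4 * (real A ^ 2 * real B ^ 2)" 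
    using A3 by (simp only: power_mult_distrib power2_eq_square[of 2])
  moreover have "real A ^ 3 * (16 * real n) = 4 * (real A ^ 2 * (4 * (real A * real n)))"
    by (simp add: power2_eq_square power3_eq_cube)
  ultimately have "real A ^ 2 * (4 * (real A * real n)) < real A ^ 2 * real B ^ 2" by linarith
  hence "4 * (real A * real n) < real B ^ 2" using A2 by (subst (asm) mult_less_cancel_left_pos) auto
  moreover have "0 \<le> real A * real n" by simp
  ultimately have "2 * (real A * real n) < real B ^ 2" by linarith
  hence "2 * real n * real A < real B ^ 2" by (simp add: mult_ac)
  hence "real A * (2 * real n * real A) < real A * real B ^ 2" using A2 by (intro mult_strict_left_mono) auto
  hence "real (n * (A * (A + A))) < real (A * B * B)" by (simp add: power2_eq_square algebra_simps)
  hence num: "card UV * (A * (A + A)) < A * B * B" unfolding n_def of_nat_less_iff .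
  have tB: "real t * real B \<le> real t ^ 2 / real A"
    using mult_left_mono[OF ABR, of "real t"] A2 by (simp add: field_simps power2_eq_square)
  also have "\<dots> \<le> real t ^ 2 / (\<alpha> / 2)" using A \<alpha>4 by (intro divide_left_mono) auto
  also have "\<dots> \<le> real p / 2" using \<alpha>1 \<alpha>4 p0 by (simp add: field_simps)
  finally have tB2: "real t * real B \<le> real p / 2" .
  have tp: "t \<le> p"
  proof (rule ccontr)
    assume "\<not> t \<le> p"
    hence "p ^ 3 \<le> t ^ 3" by (simp add: power_mono)
    also have "\<dots> \<le> t ^ 4" using t by (intro power_increasing) auto
    also have "\<dots> < 1024 * card UV * t ^ 4" using n1 t unfolding n_def by simp
    finally show False using n by simp
  qed
  have "real (A + t * B) \<le> real p" using tB2 At tp by simp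
  hence deg: "A + t * B \<le> p" unfolding of_nat_le_iff .
  have Ap: "A \<le> p" using deg by simp
  have "A * card (stepanov_points p t UV) \<le> A + 2 * t * B"
    by (rule stepanov_bound[OF p AB deg Ap UV(1) num]) (auto simp: stepanov_points_def)
  hence "real A * real (card (stepanov_points p t UV)) \<le> real A + 2 * (real t * real B)"
    unfolding of_nat_le_iff[where 'a = real, symmetric] by (simp add: mult.assoc)
  also have "\<dots> \<le> real A + 2 * (real t ^ 2 / real A)" using tB by simp
  finally have "real A ^ 2 * real (card (stepanov_points p t UV)) \<le> real A ^ 2 + 2 * real t ^ 2"
    using A2 by (simp add: field_simps power2_eq_square)
  moreover have "real A ^ 2 \<le> real t ^ 2" using At by (intro power_mono) auto
  ultimately have "real A ^ 2 * real (card (stepanov_points p t UV)) \<le> 3 * real t ^ 2" by linarith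
  moreover have "(\<alpha> / 2) ^ 2 * real (card (stepanov_points p t UV)) \<le> real A ^ 2 * real (card (stepanov_points p t UV))"
    using A \<alpha>4 by (intro mult_right_mono power_mono) auto
  ultimately have "\<alpha> ^ 2 * real (card (stepanov_points p t UV)) \<le> 12 * real t ^ 2" by (simp add: power_divide)
  hence "(\<alpha> ^ 2 * real (card (stepanov_points p t UV))) ^ 3 \<le> (12 * real t ^ 2) ^ 3" by (intro power_mono) auto
  hence "(\<alpha> ^ 3) ^ 2 * real (card (stepanov_points p t UV)) ^ 3 \<le> 1728 * real t ^ 6"
    by (simp add: power_mult_distrib flip: power_mult)
  hence "real t ^ 4 * real (card (stepanov_points p t UV)) ^ 3 \<le> real t ^ 4 * (442368 * real n ^ 2 * real t ^ 2)"
    unfolding \<alpha>3 using n1 by (simp add: field_simps power_mult_distrib flip: power_mult power_add)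
  thus ?thesis using t0 unfolding n_def by (subst (asm) mult_le_cancel_left_pos) auto
qed

text \<open>Here b is the largest number of classes to which the preceding bound applies. A larger
  set is cut into blocks of b classes; the extra summand b pays for the last, incomplete
  block.\<close>

lemma card_stepanov_points_many:
  fixes p t :: nat
  assumes p: "prime p" and t: "t \<ge> 1" "p \<le> t\<^sup>2" and tp: "1024 * t ^ 4 \<le> p ^ 3" and UV: "finite UV"
    and b: "b = p ^ 3 div (1024 * t ^ 4)"
  shows "real (card (stepanov_points p t UV)) \<le> 968 * real t ^ 2 / real p * (real (card UV) + real b)"
  using UV
proof (induction "card UV" arbitrary: UV rule: less_induct)
  case less
  have b1: "b \<ge> 1" unfolding b using tp t by (simp add: div_greater_zero_iff Suc_le_eq)
  have p0: "real p > 0" using p prime_gt_0_nat by simp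
  have bp: "b * (1024 * t ^ 4) \<le> p ^ 3" unfolding b by simp
  have "p ^ 3 < 1024 * t ^ 4 * (b + 1)" unfolding b using t by (simp add: dividend_less_times_div)
  also have "\<dots> \<le> 1024 * t ^ 4 * (2 * b)" using b1 by (intro mult_le_mono2) auto
  finally have "real (p ^ 3) \<le> real (1024 * t ^ 4 * (2 * b))" unfolding of_nat_le_iff by simp
  hence bl: "real p ^ 3 \<le> 2048 * real t ^ 4 * real b" by simp
  have small: "real (card (stepanov_points p t V)) \<le> 968 * real t ^ 2 / real p * real b"
    if V: "finite V" "card V \<le> b" for V
  proof (cases "V = {}")
    case True
    thus ?thesis by (simp add: stepanov_points_def)
  next
    case False
    have "1024 * card V * t ^ 4 \<le> b * (1024 * t ^ 4)" using V(2) by simp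
    hence "1024 * card V * t ^ 4 \<le> p ^ 3" using bp by linarith
    from card_stepanov_points_few[OF p t V(1) False this]
    have "real (card (stepanov_points p t V)) ^ 3 \<le> 442368 * real (card V) ^ 2 * real t ^ 2" .
    also have "\<dots> \<le> 442368 * real b ^ 2 * real t ^ 2" using V by (intro mult_mono power_mono) auto
    \<comment> \<open>968 is the cube root of 442368 * 2048 rounded up; 2048 is twice 1024 because
      rounding down to b loses at most a factor 2.\<close>
    also have "\<dots> \<le> (968 * real t ^ 2 / real p * real b) ^ 3"
    proof -
      have "442368 * real b ^ 2 * real t ^ 2 * real p ^ 3 \<le> 442368 * real b ^ 2 * real t ^ 2 * (2048 * real t ^ 4 * real b)"
        using bl by (intro mult_left_mono) auto
      also have "\<dots> = 905969664 * real b ^ 3 * real t ^ 6" by (simp add: eval_nat_numeral)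
      also have "\<dots> \<le> 907039232 * real b ^ 3 * real t ^ 6" by (intro mult_right_mono) auto
      finally show ?thesis using p0 by (simp add: field_simps power_mult_distrib power_divide flip: power_mult)
    qed
    finally show ?thesis by (rule power_le_imp_le_base[of _ 2, simplified]) auto
  qed
  show ?case
  proof (cases "card UV \<le> b")
    case True
    have "968 * real t ^ 2 / real p * real b \<le> 968 * real t ^ 2 / real p * (real (card UV) + real b)"
      by (intro mult_left_mono) auto
    thus ?thesis using small[OF less.prems True] by linarith
  next
    case False
    then obtain V where V: "V \<subseteq> UV" "card V = b" by (metis nat_le_linear obtain_subset_with_card_n)
    have fV: "finite V" using V less.prems finite_subset by blast
    have c: "card (UV - V) = card UV - b" using V fV by (simp add: card_Diff_subset)
    have "stepanov_points p t UV = stepanov_points p t V \<union> stepanov_points p t (UV - V)"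
      unfolding stepanov_points_def using V by auto
    hence "card (stepanov_points p t UV) \<le> card (stepanov_points p t V) + card (stepanov_points p t (UV - V))"
      by (simp add: card_Un_le)
    hence "real (card (stepanov_points p t UV)) \<le> real (card (stepanov_points p t V)) + real (card (stepanov_points p t (UV - V)))"
      by linarith
    also have "\<dots> \<le> 968 * real t ^ 2 / real p * real b + 968 * real t ^ 2 / real p * (real (card (UV - V)) + real b)"
      by (intro add_mono small less) (use V fV c b1 False less.prems in auto)
    also have "\<dots> = 968 * real t ^ 2 / real p * (real (card UV) + real b)"
      using False c by (simp add: ring_distribs of_nat_diff)
    finally show ?thesis .
  qed
qed

text \<open>The alternatives correspond to \<open>card UV\<close> below and above p^3 / (1024 t^4).
  Above it b is at most \<open>card UV\<close>, which doubles 968.\<close>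

lemma card_stepanov_points:
  fixes p t :: nat
  assumes p: "prime p" and t: "t \<ge> 1" "p \<le> t\<^sup>2" and tp: "1024 * t ^ 4 \<le> p ^ 3" and UV: "finite UV"
  shows "real (card (stepanov_points p t UV)) ^ 3 \<le> 442368 * real (card UV) ^ 2 * real t ^ 2 \<or>
    real (card (stepanov_points p t UV)) \<le> 1936 * real (card UV) * real t ^ 2 / real p"
proof (cases "1024 * card UV * t ^ 4 \<le> p ^ 3")
  case True
  show ?thesis
  proof (cases "UV = {}")
    case True
    thus ?thesis by (simp add: stepanov_points_def)
  qed (use card_stepanov_points_few[OF p t UV _ True] in auto)
next
  case False
  define b where "b = p ^ 3 div (1024 * t ^ 4)"
  have "b * (1024 * t ^ 4) \<le> p ^ 3" unfolding b_def by simp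
  hence "b * (1024 * t ^ 4) < card UV * (1024 * t ^ 4)" using False by linarith
  hence "b \<le> card UV" by simp
  hence "968 * real t ^ 2 / real p * (real (card UV) + real b) \<le> 968 * real t ^ 2 / real p * (2 * real (card UV))"
    by (intro mult_left_mono) auto
  thus ?thesis using card_stepanov_points_many[OF p t tp UV b_def] by (simp add: algebra_simps)
qed

section \<open>Sums over a multiplicative subgroup\<close>

lemma sum_swap4:
  "(\<Sum>x\<in>A. \<Sum>y\<in>B. \<Sum>b\<in>C. \<Sum>c\<in>D. h x y b c) = (\<Sum>b\<in>C. \<Sum>c\<in>D. \<Sum>x\<in>A. \<Sum>y\<in>B. h x y b c)"
proof -
  have "(\<Sum>x\<in>A. \<Sum>y\<in>B. \<Sum>b\<in>C. \<Sum>c\<in>D. h x y b c) = (\<Sum>x\<in>A. \<Sum>b\<in>C. \<Sum>y\<in>B. \<Sum>c\<in>D. h x y b c)"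
    by (rule sum.cong[OF refl], rule sum.swap)
  also have "\<dots> = (\<Sum>b\<in>C. \<Sum>x\<in>A. \<Sum>y\<in>B. \<Sum>c\<in>D. h x y b c)" by (rule sum.swap)
  also have "\<dots> = (\<Sum>b\<in>C. \<Sum>x\<in>A. \<Sum>c\<in>D. \<Sum>y\<in>B. h x y b c)"
    by (rule sum.cong[OF refl], rule sum.cong[OF refl], rule sum.swap)
  also have "\<dots> = (\<Sum>b\<in>C. \<Sum>c\<in>D. \<Sum>x\<in>A. \<Sum>y\<in>B. h x y b c)"
    by (rule sum.cong[OF refl], rule sum.swap)
  finally show ?thesis .
qed

text \<open>The subgroup is represented by the congruence x^t = 1. That it has exactly t solutions
  is another way of saying that t divides p - 1.\<close>

locale mult_subgroup =
  fixes p t :: nat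
  assumes prime_p: "prime p" and t_pos: "t \<ge> 1"
    and card_G: "card {x \<in> {0..<int p}. [x ^ t = 1] (mod int p)} = t"
begin

abbreviation F :: "int set" where "F \<equiv> {0..<int p}"
abbreviation U :: "int set" where "U \<equiv> {1..<int p}"

lemma p_gt_1: "int p > 1" using prime_gt_1_nat[OF prime_p] by simp
lemma prime_int_p: "prime (int p)" using prime_p by simp

text \<open>Functions on the field are modelled as p-periodic functions on the integers, so that
  arguments may be added and multiplied without reduction; periodicity is what justifies a change of
  variables in a sum over \<open>F\<close>.\<close>

definition per :: "(int \<Rightarrow> 'a) \<Rightarrow> bool" where
  "per f \<longleftrightarrow> (\<forall>x y. [x = y] (mod int p) \<longrightarrow> f x = f y)"

lemma perD: "per f \<Longrightarrow> [x = y] (mod int p) \<Longrightarrow> f x = f y"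
  unfolding per_def by blast

lemma mod_cong_self: "[x mod int p = x] (mod int p)" by (simp add: unique_euclidean_semiring_class.cong_def)

lemma F_eq_iff: "x \<in> F \<Longrightarrow> y \<in> F \<Longrightarrow> [x = y] (mod int p) \<longleftrightarrow> x = y"
  using cong_less_imp_eq_int by auto

lemma mod_in_F: "x mod int p \<in> F" using p_gt_1 by simp

lemma U_iff: "x \<in> U \<longleftrightarrow> x \<in> F \<and> \<not> int p dvd x"
proof -
  have "\<not> int p dvd x" if "x \<in> U" using that by (auto dest: zdvd_imp_le)
  moreover have "x \<noteq> 0" if "\<not> int p dvd x" using that by auto
  ultimately show ?thesis by force
qed

lemma mod_in_U: "\<not> int p dvd x \<Longrightarrow> x mod int p \<in> U"
  using mod_in_F unfolding U_iff by (simp add: dvd_mod_iff)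

lemma F_split: "F = insert 0 U" using p_gt_1 by auto

lemma sum_shift:
  assumes "per f" shows "(\<Sum>x\<in>F. f (x + c)) = (\<Sum>x\<in>F. f x)"
proof (rule sum.reindex_bij_witness[of F "\<lambda>x. (x - c) mod int p" "\<lambda>x. (x + c) mod int p"])
  fix a assume a: "a \<in> F"
  show "((a + c) mod int p - c) mod int p = a" "((a - c) mod int p + c) mod int p = a"
    using a by (simp_all add: mod_simps)
  show "f ((a + c) mod int p) = f (a + c)" using perD[OF assms mod_cong_self] .
qed (use mod_in_F in auto)

lemma inverse_exists:
  assumes "\<not> int p dvd c" obtains d where "d \<in> U" "[c * d = 1] (mod int p)"
proof -
  have "coprime c (int p)"
    using prime_imp_coprime[OF prime_int_p assms] by (simp add: coprime_commute)
  then obtain e where e: "[c * e = 1] (mod int p)" using cong_solve_coprime_int by blast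
  have "\<not> int p dvd e"
  proof
    assume "int p dvd e"
    hence "[c * e = 0] (mod int p)" by (simp add: cong_0_iff)
    hence "[1 = 0] (mod int p)" using e cong_sym cong_trans by blast
    thus False using p_gt_1 by (simp add: cong_0_iff)
  qed
  hence "e mod int p \<in> U" by (rule mod_in_U)
  moreover have "[c * (e mod int p) = 1] (mod int p)" using e by (simp add: unique_euclidean_semiring_class.cong_def mod_simps)
  ultimately show ?thesis using that by blast
qed

lemma dvd_mult_p: "int p dvd a * b \<longleftrightarrow> int p dvd a \<or> int p dvd b"
  using prime_int_p prime_dvd_mult_iff by blast

lemma cong_inverse_cancel:
  assumes "[c * d = 1] (mod int p)"
  shows "(d * ((c * x) mod int p)) mod int p = x mod int p"
proof -
  have "(d * ((c * x) mod int p)) mod int p = ((c * d) * x) mod int p"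
    by (simp add: mod_simps mult_ac)
  also have "\<dots> = (1 * x) mod int p" using assms unfolding unique_euclidean_semiring_class.cong_def by (metis mod_mult_left_eq)
  finally show ?thesis by simp
qed

lemma sum_scale:
  assumes "per f" "\<not> int p dvd c" shows "(\<Sum>x\<in>F. f (c * x)) = (\<Sum>x\<in>F. f x)"
proof -
  obtain d where d: "d \<in> U" "[c * d = 1] (mod int p)" using inverse_exists[OF assms(2)] .
  have d': "[d * c = 1] (mod int p)" using d by (simp add: mult.commute)
  show ?thesis
  proof (rule sum.reindex_bij_witness[of F "\<lambda>x. (d * x) mod int p" "\<lambda>x. (c * x) mod int p"])
    fix a assume a: "a \<in> F"
    show "d * ((c * a) mod int p) mod int p = a" "c * ((d * a) mod int p) mod int p = a"
      using a cong_inverse_cancel[OF d(2)] cong_inverse_cancel[OF d'] by auto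
    show "f ((c * a) mod int p) = f (c * a)" using perD[OF assms(1) mod_cong_self] .
  qed (use mod_in_F in auto)
qed

definition \<gamma> :: "int \<Rightarrow> real" where "\<gamma> x = of_bool ([x ^ t = 1] (mod int p))"

lemma per_\<gamma>: "per \<gamma>"
proof -
  have "[x ^ t = 1] (mod int p) \<longleftrightarrow> [y ^ t = 1] (mod int p)" if "[x = y] (mod int p)" for x y
    using cong_pow[OF that, of t] by (simp add: unique_euclidean_semiring_class.cong_def)
  thus ?thesis unfolding per_def \<gamma>_def by simp
qed

lemma \<gamma>_cases: "\<gamma> x = 0 \<or> \<gamma> x = 1" by (simp add: \<gamma>_def)
lemma \<gamma>_nonneg [simp]: "\<gamma> x \<ge> 0" by (simp add: \<gamma>_def)
lemma \<gamma>_le_1 [simp]: "\<gamma> x \<le> 1" by (simp add: \<gamma>_def)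
lemma \<gamma>_sq [simp]: "\<gamma> x * \<gamma> x = \<gamma> x" by (simp add: \<gamma>_def)
lemma \<gamma>_sq' [simp]: "\<gamma> x * (\<gamma> x * z) = \<gamma> x * z" by (simp add: \<gamma>_def)
lemma \<gamma>_eq_1: "\<gamma> x = 1 \<longleftrightarrow> [x ^ t = 1] (mod int p)" by (simp add: \<gamma>_def)
lemma \<gamma>_1 [simp]: "\<gamma> 1 = 1" by (simp add: \<gamma>_def)

lemma \<gamma>_dvd: "int p dvd x \<Longrightarrow> \<gamma> x = 0"
proof -
  assume "int p dvd x"
  hence "int p dvd x ^ t" using t_pos by (meson dvd_power dvd_trans less_le_trans zero_less_one)
  hence "\<not> [x ^ t = 1] (mod int p)" using p_gt_1
    by (metis cong_dvd_iff not_prime_unit prime_int_p)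
  thus ?thesis by (simp add: \<gamma>_def)
qed

lemma \<gamma>_0 [simp]: "\<gamma> 0 = 0" by (rule \<gamma>_dvd) simp

lemma \<gamma>_not_dvd: "\<gamma> g = 1 \<Longrightarrow> \<not> int p dvd g" using \<gamma>_dvd by fastforce

lemma \<gamma>_mult: assumes "\<gamma> g = 1" shows "\<gamma> (g * x) = \<gamma> x"
proof -
  have "[g ^ t = 1] (mod int p)" using assms by (simp add: \<gamma>_eq_1)
  hence "[g ^ t * x ^ t = 1 * x ^ t] (mod int p)" by (rule cong_mult) simp
  hence "[(g * x) ^ t = x ^ t] (mod int p)" by (simp add: power_mult_distrib)
  thus ?thesis unfolding \<gamma>_def by (simp add: unique_euclidean_semiring_class.cong_def)
qed

lemma \<gamma>_mult': assumes "\<gamma> g = 1" shows "\<gamma> (x * g) = \<gamma> x"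
  using \<gamma>_mult[OF assms, of x] by (simp add: mult.commute)

lemma sum_\<gamma>: "(\<Sum>x\<in>F. \<gamma> x) = real t"
proof -
  have "(\<Sum>x\<in>F. \<gamma> x) = real (card (F \<inter> {x. [x ^ t = 1] (mod int p)}))"
    unfolding \<gamma>_def by (simp add: of_bool_def sum.If_cases)
  also have "F \<inter> {x. [x ^ t = 1] (mod int p)} = {x \<in> F. [x ^ t = 1] (mod int p)}" by auto
  finally show ?thesis using card_G by simp
qed

text \<open>\<open>rt \<theta> w\<close> counts the \<open>a, c\<close> in the subgroup with \<open>a - \<theta>c = w\<close>, and \<open>En\<close> is the additive energy.\<close>

definition rt :: "int \<Rightarrow> int \<Rightarrow> real" where "rt \<theta> w = (\<Sum>c\<in>F. \<gamma> c * \<gamma> (w + \<theta> * c))"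
abbreviation r :: "int \<Rightarrow> real" where "r \<equiv> rt 1"
definition En :: real where "En = (\<Sum>z\<in>F. (r z)\<^sup>2)"

lemma perI: "(\<And>x y. [x = y] (mod int p) \<Longrightarrow> f x = f y) \<Longrightarrow> per f"
  unfolding per_def by blast

lemmas per_cong = sum.cong refl arg_cong2[where f = "(*)"] perD[OF per_\<gamma>]
  cong_add cong_diff cong_mult cong_refl

lemma per_rt: "per (rt \<theta>)"
  unfolding rt_def[abs_def] by (rule perI) (intro per_cong | assumption)+

lemma rt_nonneg [simp]: "rt \<theta> w \<ge> 0" unfolding rt_def by (intro sum_nonneg) simp

lemma rt_le_t: "rt \<theta> w \<le> real t"
  unfolding rt_def sum_\<gamma>[symmetric] by (intro sum_mono mult_left_le) auto

lemma corr_eq_r: "(\<Sum>y\<in>F. \<gamma> (a + y) * \<gamma> (c + y)) = r (c - a)"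
proof -
  have "(\<Sum>y\<in>F. \<gamma> y * \<gamma> (y + (c - a))) = (\<Sum>y\<in>F. \<gamma> (y + a) * \<gamma> (y + a + (c - a)))"
    by (rule sum_shift[symmetric]) (rule perI, (intro per_cong perD[OF per_rt] | assumption)+)
  thus ?thesis by (simp add: rt_def add.commute)
qed

lemma r_0: "r 0 = real t" by (simp add: rt_def sum_\<gamma>)

lemma sum_rt: "(\<Sum>w\<in>F. rt \<theta> w) = (real t)\<^sup>2"
proof -
  have "(\<Sum>w\<in>F. rt \<theta> w) = (\<Sum>c\<in>F. \<gamma> c * (\<Sum>w\<in>F. \<gamma> (w + \<theta> * c)))"
    unfolding rt_def by (subst sum.swap) (simp add: sum_distrib_left)
  also have "\<dots> = (real t)\<^sup>2"
    by (simp add: sum_shift[OF per_\<gamma>] sum_\<gamma> power2_eq_square flip: sum_distrib_right)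
  finally show ?thesis .
qed

lemma rt_mult_left: assumes "\<gamma> g = 1" shows "rt (\<theta> * g) w = rt \<theta> w"
proof -
  have "rt \<theta> w = (\<Sum>c\<in>F. \<gamma> (g * c) * \<gamma> (w + \<theta> * (g * c)))"
    unfolding rt_def by (rule sum_scale[symmetric, OF _ \<gamma>_not_dvd[OF assms]])
      (rule perI, (intro per_cong perD[OF per_rt] | assumption)+)
  thus ?thesis by (simp add: \<gamma>_mult[OF assms] rt_def mult.assoc)
qed

lemma rt_mult_right: assumes "\<gamma> g = 1" shows "rt \<theta> (g * w) = rt \<theta> w"
proof -
  have "rt \<theta> (g * w) = (\<Sum>c\<in>F. \<gamma> (g * c) * \<gamma> (g * w + \<theta> * (g * c)))"
    unfolding rt_def by (rule sum_scale[symmetric, OF _ \<gamma>_not_dvd[OF assms]])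
      (rule perI, (intro per_cong perD[OF per_rt] | assumption)+)
  also have "\<dots> = (\<Sum>c\<in>F. \<gamma> c * \<gamma> (g * (w + \<theta> * c)))"
    by (simp add: \<gamma>_mult[OF assms] distrib_left mult.left_commute)
  finally show ?thesis by (simp add: \<gamma>_mult[OF assms] rt_def)
qed

text \<open>For the matrices \<open>W(a,b) = w(a-b)\<close> and \<open>R(a,b) = r(a-b)\<close> on the subgroup, \<open>R\<close> is positive semidefinite
  and the constant vector is an eigenvector of both, so the trace of \<open>WRW\<close> is at least \<open>\<omega>\<^sup>2 En / t\<close>;
  the trace is bounded from above by Cauchy-Schwarz over the pairs of differences.\<close>

lemma spectral_inequality:
  assumes w: "per w" and inv: "\<And>g x. \<gamma> g = 1 \<Longrightarrow> w (g * x) = w x"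
    and \<omega>: "\<omega> = (\<Sum>b\<in>F. \<gamma> b * w (1 - b))"
  shows "(\<omega>\<^sup>2 * En / real t)\<^sup>2 \<le> (\<Sum>z\<in>F. (r z) ^ 3) * (\<Sum>x\<in>F. \<Sum>y\<in>F. (w x)\<^sup>2 * (w y)\<^sup>2 * (r (y - x))\<^sup>2)"
proof -
  \<comment> \<open>R is the Gram matrix of the vectors u_y with entries
    \<open>\<gamma> (a + y)\<close>, and \<open>v y\<close> is the transpose of W applied to u_y.
    Summing their squared norms over y therefore gives the trace \<open>TR\<close>.\<close>
  define v where "v y b = (\<Sum>a\<in>F. \<gamma> a * \<gamma> (a + y) * w (a - b))" for y b
  define TR where "TR = (\<Sum>y\<in>F. \<Sum>b\<in>F. \<gamma> b * (v y b)\<^sup>2)"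
  define C where "C x y = (\<Sum>b\<in>F. \<gamma> b * \<gamma> (b + x) * \<gamma> (b + y))" for x y
  have t0: "real t > 0" using t_pos by simp
  have om: "(\<Sum>b\<in>F. \<gamma> b * w (a - b)) = \<omega>" if "\<gamma> a = 1" for a
  proof -
    have "(\<Sum>b\<in>F. \<gamma> b * w (a - b)) = (\<Sum>b\<in>F. \<gamma> (a * b) * w (a - a * b))"
      by (rule sum_scale[symmetric, OF _ \<gamma>_not_dvd[OF that]])
        (rule perI, (intro per_cong perD[OF per_rt] perD[OF w] | assumption)+)
    also have "\<dots> = (\<Sum>b\<in>F. \<gamma> b * w (a * (1 - b)))" by (simp add: \<gamma>_mult[OF that] right_diff_distrib)
    also have "\<dots> = \<omega>" unfolding \<omega> inv[OF that] ..
    finally show ?thesis .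
  qed
  \<comment> \<open>The coordinates of \<open>v y\<close> sum to \<omega> times those of u_y because
    the constant vector is an eigenvector; Cauchy-Schwarz against that vector gives the
    bound.\<close>
  have low: "(\<omega> * r y)\<^sup>2 \<le> real t * (\<Sum>b\<in>F. \<gamma> b * (v y b)\<^sup>2)" for y
  proof -
    have "(\<Sum>b\<in>F. \<gamma> b * (\<gamma> b * v y b)) = (\<Sum>b\<in>F. \<Sum>a\<in>F. \<gamma> a * \<gamma> (a + y) * (\<gamma> b * w (a - b)))"
      by (simp add: v_def sum_distrib_left mult_ac)
    also have "\<dots> = (\<Sum>a\<in>F. \<gamma> a * \<gamma> (a + y) * (\<Sum>b\<in>F. \<gamma> b * w (a - b)))"
      by (subst sum.swap) (simp add: sum_distrib_left)
    also have "\<dots> = (\<Sum>a\<in>F. \<gamma> a * \<gamma> (a + y) * \<omega>)"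
    proof (rule sum.cong)
      fix a show "\<gamma> a * \<gamma> (a + y) * (\<Sum>b\<in>F. \<gamma> b * w (a - b)) = \<gamma> a * \<gamma> (a + y) * \<omega>"
        using \<gamma>_cases[of a] om[of a] by auto
    qed simp
    also have "\<dots> = \<omega> * r y" by (simp add: rt_def sum_distrib_right sum_distrib_left mult_ac add.commute)
    finally have "(\<omega> * r y)\<^sup>2 = (\<Sum>b\<in>F. \<gamma> b * (\<gamma> b * v y b))\<^sup>2" by simp
    also have "\<dots> \<le> (\<Sum>b\<in>F. (\<gamma> b)\<^sup>2) * (\<Sum>b\<in>F. (\<gamma> b * v y b)\<^sup>2)" by (rule Cauchy_Schwarz_ineq_sum)
    also have "\<dots> = real t * (\<Sum>b\<in>F. \<gamma> b * (v y b)\<^sup>2)"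
      by (simp add: power_mult_distrib) (simp add: power2_eq_square sum_\<gamma>)
    finally show ?thesis .
  qed
  have "\<omega>\<^sup>2 * En = (\<Sum>y\<in>F. (\<omega> * r y)\<^sup>2)" by (simp add: En_def sum_distrib_left power_mult_distrib)
  also have "\<dots> \<le> (\<Sum>y\<in>F. real t * (\<Sum>b\<in>F. \<gamma> b * (v y b)\<^sup>2))" by (rule sum_mono) (rule low)
  also have "\<dots> = real t * TR" by (simp add: TR_def sum_distrib_left)
  finally have lo: "\<omega>\<^sup>2 * En / real t \<le> TR" using t0 by (simp add: field_simps)
  have "TR = (\<Sum>y\<in>F. \<Sum>b\<in>F. \<Sum>a\<in>F. \<Sum>c\<in>F. \<gamma> b * \<gamma> a * \<gamma> c * w (a - b) * w (c - b) * (\<gamma> (a + y) * \<gamma> (c + y)))"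
    unfolding TR_def v_def power2_eq_square sum_product by (simp only: sum_distrib_left) (simp only: mult_ac)
  also have "\<dots> = (\<Sum>b\<in>F. \<Sum>a\<in>F. \<Sum>c\<in>F. \<Sum>y\<in>F. \<gamma> b * \<gamma> a * \<gamma> c * w (a - b) * w (c - b) * (\<gamma> (a + y) * \<gamma> (c + y)))"
    by (subst sum.swap, rule sum.cong[OF refl], subst sum.swap, rule sum.cong[OF refl], rule sum.swap)
  also have "\<dots> = (\<Sum>b\<in>F. \<Sum>a\<in>F. \<Sum>c\<in>F. \<gamma> b * \<gamma> a * \<gamma> c * w (a - b) * w (c - b) * r (c - a))"
    by (simp only: sum_distrib_left[symmetric] corr_eq_r)
  \<comment> \<open>With x = a - b and y = c - b the weights no longer involve b, and the sum over b
    alone is \<open>C x y\<close>.\<close>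
  also have "\<dots> = (\<Sum>b\<in>F. \<Sum>x\<in>F. \<Sum>y\<in>F. \<gamma> b * \<gamma> (b + x) * \<gamma> (b + y) * (w x * w y * r (y - x)))"
  proof (rule sum.cong[OF refl])
    fix b
    have "(\<Sum>a\<in>F. \<Sum>c\<in>F. \<gamma> b * \<gamma> a * \<gamma> c * w (a - b) * w (c - b) * r (c - a)) =
       (\<Sum>x\<in>F. \<Sum>c\<in>F. \<gamma> b * \<gamma> (x + b) * \<gamma> c * w (x + b - b) * w (c - b) * r (c - (x + b)))"
      by (rule sum_shift[symmetric])
        (rule perI, (intro per_cong perD[OF per_rt] perD[OF w] | assumption)+)
    also have "\<dots> = (\<Sum>x\<in>F. \<Sum>y\<in>F. \<gamma> b * \<gamma> (x + b) * \<gamma> (y + b) * w (x + b - b) * w (y + b - b) * r (y + b - (x + b)))"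
      by (rule sum.cong[OF refl], rule sum_shift[symmetric])
        (rule perI, (intro per_cong perD[OF per_rt] perD[OF w] | assumption)+)
    finally show "(\<Sum>a\<in>F. \<Sum>c\<in>F. \<gamma> b * \<gamma> a * \<gamma> c * w (a - b) * w (c - b) * r (c - a)) =
       (\<Sum>x\<in>F. \<Sum>y\<in>F. \<gamma> b * \<gamma> (b + x) * \<gamma> (b + y) * (w x * w y * r (y - x)))"
      by (simp add: algebra_simps)
  qed
  also have "\<dots> = (\<Sum>x\<in>F. \<Sum>y\<in>F. C x y * (w x * w y * r (y - x)))"
    by (subst sum.swap, rule sum.cong[OF refl], subst sum.swap) (simp add: C_def sum_distrib_right)
  also have "\<dots> = (\<Sum>(x, y)\<in>F \<times> F. C x y * (w x * w y * r (y - x)))"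
    by (simp add: sum.cartesian_product)
  finally have TR: "TR = (\<Sum>i\<in>F \<times> F. C (fst i) (snd i) * (w (fst i) * w (snd i) * r (snd i - fst i)))"
    by (simp add: split_def)
  have "TR\<^sup>2 \<le> (\<Sum>i\<in>F \<times> F. (C (fst i) (snd i))\<^sup>2) * (\<Sum>i\<in>F \<times> F. (w (fst i) * w (snd i) * r (snd i - fst i))\<^sup>2)"
    unfolding TR by (rule Cauchy_Schwarz_ineq_sum)
  also have "(\<Sum>i\<in>F \<times> F. (w (fst i) * w (snd i) * r (snd i - fst i))\<^sup>2) =
     (\<Sum>x\<in>F. \<Sum>y\<in>F. (w x)\<^sup>2 * (w y)\<^sup>2 * (r (y - x))\<^sup>2)"
    by (simp add: sum.cartesian_product split_def power_mult_distrib)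
  also have "(\<Sum>i\<in>F \<times> F. (C (fst i) (snd i))\<^sup>2) = (\<Sum>x\<in>F. \<Sum>y\<in>F. (C x y)\<^sup>2)"
    by (simp add: sum.cartesian_product split_def)
  \<comment> \<open>After opening the square with two base points b and c, the sums over x and y
    decouple and each equals r(c - b); the pairs with difference z supply the third factor.\<close>
  also have "\<dots> = (\<Sum>z\<in>F. (r z) ^ 3)"
  proof -
    have "(\<Sum>x\<in>F. \<Sum>y\<in>F. (C x y)\<^sup>2) = (\<Sum>x\<in>F. \<Sum>y\<in>F. \<Sum>b\<in>F. \<Sum>c\<in>F.
        \<gamma> b * \<gamma> c * (\<gamma> (b + x) * \<gamma> (c + x)) * (\<gamma> (b + y) * \<gamma> (c + y)))"
      unfolding C_def power2_eq_square sum_product by (simp only: mult_ac)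
    also have "\<dots> = (\<Sum>b\<in>F. \<Sum>c\<in>F. \<Sum>x\<in>F. \<Sum>y\<in>F.
        \<gamma> b * \<gamma> c * (\<gamma> (b + x) * \<gamma> (c + x)) * (\<gamma> (b + y) * \<gamma> (c + y)))"
      by (rule sum_swap4)
    also have "\<dots> = (\<Sum>b\<in>F. \<Sum>c\<in>F. \<gamma> b * \<gamma> c * r (c - b) * r (c - b))"
      by (simp only: sum_distrib_left[symmetric] sum_distrib_right[symmetric] corr_eq_r)
    also have "\<dots> = (\<Sum>b\<in>F. \<Sum>z\<in>F. \<gamma> b * \<gamma> (z + b) * r (z + b - b) * r (z + b - b))"
      by (rule sum.cong[OF refl], rule sum_shift[symmetric])
        (rule perI, (intro per_cong perD[OF per_rt] | assumption)+)
    also have "\<dots> = (\<Sum>z\<in>F. (\<Sum>b\<in>F. \<gamma> b * \<gamma> (z + b)) * (r z * r z))"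
      by (subst sum.swap) (simp only: sum_distrib_right mult.assoc add_diff_cancel_right')
    also have "\<dots> = (\<Sum>z\<in>F. (r z) ^ 3)"
      by (rule sum.cong[OF refl]) (simp add: rt_def power3_eq_cube)
    finally show ?thesis .
  qed
  finally have up: "TR\<^sup>2 \<le> (\<Sum>z\<in>F. (r z) ^ 3) * (\<Sum>x\<in>F. \<Sum>y\<in>F. (w x)\<^sup>2 * (w y)\<^sup>2 * (r (y - x))\<^sup>2)" .
  have "0 \<le> \<omega>\<^sup>2 * En / real t" unfolding En_def by (intro divide_nonneg_nonneg mult_nonneg_nonneg sum_nonneg) auto
  hence "(\<omega>\<^sup>2 * En / real t)\<^sup>2 \<le> TR\<^sup>2" using lo by (intro power_mono) auto
  thus ?thesis using up by linarith
qed

end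

section \<open>Level sets of representation functions\<close>

lemma harmonic_le: "K \<ge> 1 \<Longrightarrow> (\<Sum>k=1..K. 1 / real k) \<le> 1 + ln (real K)"
proof (induction K rule: nat_induct_at_least)
  case (Suc K)
  have "ln (real K / real (Suc K)) \<le> real K / real (Suc K) - 1"
    using Suc.hyps by (intro ln_le_minus_one) auto
  also have "\<dots> = - (1 / real (Suc K))" by (simp add: field_simps)
  finally have "1 / real (Suc K) \<le> ln (real (Suc K)) - ln (real K)"
    using Suc.hyps by (simp add: ln_div)
  thus ?case using Suc.IH by simp
qed simp

lemma sum_of_bool_card:
  assumes "finite S" shows "(\<Sum>x\<in>S. of_bool (P x)) = real (card {x \<in> S. P x})"
proof -
  have "{x \<in> S. P x} = S \<inter> {x. P x}" by auto
  thus ?thesis using assms by (simp add: of_bool_def sum.If_cases)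
qed

lemma sum_layers:
  fixes f :: "'a \<Rightarrow> real"
  assumes "finite S" "\<And>x. x \<in> S \<Longrightarrow> f x \<in> \<nat>" "\<And>x. x \<in> S \<Longrightarrow> f x \<le> real K"
  shows "(\<Sum>x\<in>S. f x) = (\<Sum>k=1..K. real (card {x \<in> S. real k \<le> f x}))"
proof -
  have "(\<Sum>x\<in>S. f x) = (\<Sum>x\<in>S. \<Sum>k=1..K. of_bool (real k \<le> f x))"
  proof (rule sum.cong)
    fix x assume x: "x \<in> S"
    obtain n where n: "f x = real n" using assms(2)[OF x] by (auto elim: Nats_cases)
    have "n \<le> K" using assms(3)[OF x] n by simp
    hence "{1..K} \<inter> {k. k \<le> n} = {1..n}" by auto
    thus "f x = (\<Sum>k=1..K. of_bool (real k \<le> f x))" by (simp add: n of_bool_def sum.If_cases)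
  qed simp
  also have "\<dots> = (\<Sum>k=1..K. \<Sum>x\<in>S. of_bool (real k \<le> f x))" by (rule sum.swap)
  also have "\<dots> = (\<Sum>k=1..K. real (card {x \<in> S. real k \<le> f x}))"
    by (simp only: sum_of_bool_card[OF assms(1)])
  finally show ?thesis .
qed

text \<open>An integer cube n^3 is at most the sum of 3k^2 over k <= n, so only the sizes of level
  sets matter. Above \<kappa> the bound A/k^3 leaves a harmonic sum; below \<kappa> the whole set S
  is counted.\<close>

lemma cube_sum_le:
  fixes f :: "'a \<Rightarrow> real"
  assumes S: "finite S" and nat: "\<And>x. x \<in> S \<Longrightarrow> f x \<in> \<nat>" and K: "\<And>x. x \<in> S \<Longrightarrow> f x \<le> real K" "K \<ge> 1"
    and A: "A \<ge> 0" and \<kappa>: "\<kappa> \<ge> 0"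
    and lev: "\<And>k. k \<ge> 1 \<Longrightarrow> \<kappa> < real k \<Longrightarrow> real (card {x \<in> S. real k \<le> f x}) * real k ^ 3 \<le> A"
  shows "(\<Sum>x\<in>S. f x ^ 3) \<le> 3 * A * (1 + ln (real K)) + 3 * \<kappa> ^ 3 * real (card S)"
proof -
  have cube: "real n ^ 3 \<le> (\<Sum>k=1..n. 3 * real k ^ 2)" for n
  proof (induction n)
    case (Suc n)
    have "real (Suc n) ^ 3 \<le> real n ^ 3 + 3 * real (Suc n) ^ 2"
      by (simp add: power2_eq_square power3_eq_cube algebra_simps)
    thus ?case using Suc by simp
  qed simp
  have "(\<Sum>x\<in>S. f x ^ 3) \<le> (\<Sum>x\<in>S. \<Sum>k=1..K. 3 * real k ^ 2 * of_bool (real k \<le> f x))"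
  proof (rule sum_mono)
    fix x assume x: "x \<in> S"
    obtain n where n: "f x = real n" using nat[OF x] by (auto elim: Nats_cases)
    have "n \<le> K" using K(1)[OF x] n by simp
    hence "(\<Sum>k=1..n. 3 * real k ^ 2) = (\<Sum>k=1..K. 3 * real k ^ 2 * of_bool (real k \<le> f x))"
      by (intro sum.mono_neutral_cong_left) (auto simp: n)
    thus "f x ^ 3 \<le> (\<Sum>k=1..K. 3 * real k ^ 2 * of_bool (real k \<le> f x))" using cube[of n] n by simp
  qed
  also have "\<dots> = (\<Sum>k=1..K. 3 * real k ^ 2 * real (card {x \<in> S. real k \<le> f x}))"
    by (subst sum.swap) (simp only: sum_distrib_left[symmetric] sum_of_bool_card[OF S])
  also have "\<dots> \<le> (\<Sum>k=1..K. 3 * A * (1 / real k) + 3 * (\<kappa> ^ 2 * real (card S)) * of_bool (real k \<le> \<kappa>))"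
  proof (rule sum_mono)
    fix k assume k: "k \<in> {1..K}"
    show "3 * real k ^ 2 * real (card {x \<in> S. real k \<le> f x}) \<le> 3 * A * (1 / real k) + 3 * (\<kappa> ^ 2 * real (card S)) * of_bool (real k \<le> \<kappa>)"
    proof (cases "real k \<le> \<kappa>")
      case True
      have "real k ^ 2 * real (card {x \<in> S. real k \<le> f x}) \<le> \<kappa> ^ 2 * real (card S)"
        using True S by (intro mult_mono power_mono) (auto intro: card_mono)
      moreover have "0 \<le> 3 * A * (1 / real k)" using A by simp
      ultimately show ?thesis using True by simp
    next
      case False
      thus ?thesis using lev[of k] k by (simp add: field_simps power2_eq_square power3_eq_cube)
    qed
  qed
  also have "\<dots> = 3 * A * (\<Sum>k=1..K. 1 / real k) + 3 * (\<kappa> ^ 2 * real (card S)) * (\<Sum>k=1..K. of_bool (real k \<le> \<kappa>))"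
    by (simp add: sum.distrib sum_distrib_left)
  also have "\<dots> \<le> 3 * A * (1 + ln (real K)) + 3 * (\<kappa> ^ 2 * real (card S)) * \<kappa>"
  proof (intro add_mono mult_left_mono harmonic_le K)
    have "(\<Sum>k=1..K. of_bool (real k \<le> \<kappa>)) = real (card ({1..K} \<inter> {k. real k \<le> \<kappa>}))"
      by (simp add: of_bool_def sum.If_cases)
    also have "card ({1..K} \<inter> {k. real k \<le> \<kappa>}) \<le> card {1..nat \<lfloor>\<kappa>\<rfloor>}"
      by (intro card_mono) (auto simp: le_nat_floor)
    also have "real (card {1..nat \<lfloor>\<kappa>\<rfloor>}) \<le> \<kappa>" using \<kappa> by simp
    finally show "(\<Sum>k=1..K. of_bool (real k \<le> \<kappa>)) \<le> \<kappa>" by simp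
  qed (use A in auto)
  also have "\<dots> = 3 * A * (1 + ln (real K)) + 3 * \<kappa> ^ 3 * real (card S)"
    by (simp add: power2_eq_square power3_eq_cube)
  finally show ?thesis .
qed

text \<open>The second assumption says that the threshold p^3 / (1024 t^4) admits at least one
  class.\<close>

locale stepanov_subgroup = mult_subgroup +
  assumes p_le_t2: "p \<le> t\<^sup>2" and t_small: "1024 * t ^ 4 \<le> p ^ 3"
begin

text \<open>On nonzero residues the fibres of the t-th power map are the cosets of the subgroup, so
  this labels the pair of cosets of a and b.\<close>

definition cls :: "int \<times> int \<Rightarrow> int \<times> int" where
  "cls ab = (fst ab ^ t mod int p, snd ab ^ t mod int p)"

lemma power_fiber:
  assumes x0: "x0 \<in> U" shows "card {x \<in> U. x ^ t mod int p = x0 ^ t mod int p} = t"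
proof -
  have nd: "\<not> int p dvd x0" using x0 U_iff by blast
  obtain d where d: "d \<in> U" "[x0 * d = 1] (mod int p)" using inverse_exists[OF nd] .
  have d': "[d * x0 = 1] (mod int p)" using d by (simp add: mult.commute)
  have d1: "[d ^ t * x0 ^ t = 1] (mod int p)" using cong_pow[OF d', of t] by (simp add: power_mult_distrib)
  have "bij_betw (\<lambda>g. (x0 * g) mod int p) {x \<in> F. [x ^ t = 1] (mod int p)} {x \<in> U. x ^ t mod int p = x0 ^ t mod int p}"
  proof (rule bij_betw_byWitness[where f' = "\<lambda>x. (d * x) mod int p"])
    show "\<forall>a\<in>{x \<in> F. [x ^ t = 1] (mod int p)}. d * (x0 * a mod int p) mod int p = a"
      using cong_inverse_cancel[OF d(2)] by auto
    show "\<forall>a\<in>{x \<in> U. x ^ t mod int p = x0 ^ t mod int p}. x0 * (d * a mod int p) mod int p = a"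
      using cong_inverse_cancel[OF d'] by auto
    show "(\<lambda>g. (x0 * g) mod int p) ` {x \<in> F. [x ^ t = 1] (mod int p)} \<subseteq> {x \<in> U. x ^ t mod int p = x0 ^ t mod int p}"
    proof safe
      fix g assume g: "g \<in> F" "[g ^ t = 1] (mod int p)"
      have "\<not> int p dvd g" using g \<gamma>_not_dvd \<gamma>_eq_1 by blast
      thus "x0 * g mod int p \<in> U" using nd by (intro mod_in_U) (simp add: dvd_mult_p)
      have "[x0 ^ t * g ^ t = x0 ^ t * 1] (mod int p)" using g by (intro cong_mult cong_refl)
      thus "(x0 * g mod int p) ^ t mod int p = x0 ^ t mod int p"
        by (simp add: unique_euclidean_semiring_class.cong_def power_mod power_mult_distrib)
    qed
    show "(\<lambda>x. (d * x) mod int p) ` {x \<in> U. x ^ t mod int p = x0 ^ t mod int p} \<subseteq> {x \<in> F. [x ^ t = 1] (mod int p)}"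
    proof safe
      fix x assume x: "x \<in> U" "x ^ t mod int p = x0 ^ t mod int p"
      show "d * x mod int p \<in> F" by (rule mod_in_F)
      have "[d ^ t * x ^ t = d ^ t * x0 ^ t] (mod int p)" using x
        by (intro cong_mult cong_refl) (simp add: unique_euclidean_semiring_class.cong_def)
      hence "[d ^ t * x ^ t = 1] (mod int p)" using d1 cong_trans by blast
      thus "[(d * x mod int p) ^ t = 1] (mod int p)"
        by (simp add: unique_euclidean_semiring_class.cong_def power_mod power_mult_distrib)
    qed
  qed
  from bij_betw_same_card[OF this] card_G show ?thesis by simp
qed

lemma card_saturated:
  assumes A: "A \<subseteq> U \<times> U"
    and sat: "\<And>ab ab'. ab \<in> A \<Longrightarrow> ab' \<in> U \<times> U \<Longrightarrow> cls ab' = cls ab \<Longrightarrow> ab' \<in> A"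
  shows "card A = card (cls ` A) * t\<^sup>2"
proof -
  have fin: "finite A" using A by (rule finite_subset) simp
  have "card A = (\<Sum>x\<in>A. 1)" by simp
  also have "\<dots> = (\<Sum>uv\<in>cls ` A. \<Sum>x\<in>{x \<in> A. cls x = uv}. 1)" by (rule sum.image_gen[OF fin])
  also have "\<dots> = (\<Sum>uv\<in>cls ` A. t\<^sup>2)"
  proof (rule sum.cong)
    fix uv assume "uv \<in> cls ` A"
    then obtain a b where ab: "(a, b) \<in> A" "uv = cls (a, b)" by auto
    have U: "a \<in> U" "b \<in> U" using ab A by auto
    have "{x \<in> A. cls x = uv} = {x \<in> U. x ^ t mod int p = a ^ t mod int p} \<times> {x \<in> U. x ^ t mod int p = b ^ t mod int p}"
    proof (rule Set.set_eqI, rule iffI)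
      fix x assume "x \<in> {x \<in> A. cls x = uv}"
      thus "x \<in> {x \<in> U. x ^ t mod int p = a ^ t mod int p} \<times> {x \<in> U. x ^ t mod int p = b ^ t mod int p}"
        using A ab(2) by (auto simp: cls_def mem_Times_iff)
    next
      fix x assume x: "x \<in> {x \<in> U. x ^ t mod int p = a ^ t mod int p} \<times> {x \<in> U. x ^ t mod int p = b ^ t mod int p}"
      hence "cls x = uv" "x \<in> U \<times> U" using ab(2) by (auto simp: cls_def mem_Times_iff)
      thus "x \<in> {x \<in> A. cls x = uv}" using sat[OF ab(1)] ab(2) by auto
    qed
    thus "(\<Sum>x\<in>{x \<in> A. cls x = uv}. 1) = t\<^sup>2"
      using power_fiber[OF U(1)] power_fiber[OF U(2)] by (simp add: card_cartesian_product power2_eq_square)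
  qed simp
  finally show ?thesis by simp
qed

lemma card_stepanov_points_sum:
  assumes "finite UV"
  shows "card (stepanov_points p t UV) = (\<Sum>uv\<in>UV. card (stepanov_points p t {uv}))"
proof -
  have "stepanov_points p t UV = (\<Union>uv\<in>UV. stepanov_points p t {uv})"
    by (auto simp: stepanov_points_def)
  also have "card \<dots> = (\<Sum>uv\<in>UV. card (stepanov_points p t {uv}))"
    by (intro card_UN_disjoint assms ballI finite_stepanov_points) (auto simp: stepanov_points_def)
  finally show ?thesis .
qed

text \<open>If n classes carry at least k points each, then nk points lie in n classes. The lower
  bound on k excludes the linear alternative of Stepanov's bound, and the cubic one reads (nk)^3 <=
  C n^2 t^2. Each class consists of t^2 pairs.\<close>

lemma card_rich_classes:
  fixes k :: real
  assumes k: "k > 0" "k > 1936 * real t ^ 2 / real p"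
  shows "real (card {ab \<in> U \<times> U. k \<le> real (card (stepanov_points p t {cls ab}))}) * k ^ 3 \<le> 442368 * real t ^ 4"
proof -
  define A where "A = {ab \<in> U \<times> U. k \<le> real (card (stepanov_points p t {cls ab}))}"
  define UV where "UV = cls ` A"
  have finA: "finite A" unfolding A_def by (rule finite_subset[of _ "U \<times> U"]) auto
  hence fin: "finite UV" by (simp add: UV_def)
  have cA: "card A = card UV * t\<^sup>2" unfolding UV_def by (rule card_saturated) (auto simp: A_def)
  have t0: "real t > 0" using t_pos by simp
  have p0: "real p > 0" using p_gt_1 by simp
  define n where "n = real (card UV)"
  have "n * k = (\<Sum>uv\<in>UV. k)" by (simp add: n_def)
  also have "\<dots> \<le> (\<Sum>uv\<in>UV. real (card (stepanov_points p t {uv})))"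
    by (intro sum_mono) (auto simp: UV_def A_def)
  also have "\<dots> = real (card (stepanov_points p t UV))" by (simp add: card_stepanov_points_sum[OF fin])
  finally have nk: "n * k \<le> real (card (stepanov_points p t UV))" .
  have "n * k ^ 3 \<le> 442368 * real t ^ 2"
  proof (cases "n = 0")
    case False
    hence n0: "n > 0" by (simp add: n_def)
    have "\<not> real (card (stepanov_points p t UV)) \<le> 1936 * real (card UV) * real t ^ 2 / real p"
    proof
      assume "real (card (stepanov_points p t UV)) \<le> 1936 * real (card UV) * real t ^ 2 / real p"
      hence "n * k \<le> n * (1936 * real t ^ 2 / real p)" using nk by (simp add: n_def algebra_simps)
      thus False using n0 k(2) by (subst (asm) mult_le_cancel_left_pos) auto
    qed
    hence "real (card (stepanov_points p t UV)) ^ 3 \<le> 442368 * n ^ 2 * real t ^ 2"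
      using card_stepanov_points[OF prime_p t_pos p_le_t2 t_small fin] by (auto simp: n_def)
    moreover have "(n * k) ^ 3 \<le> real (card (stepanov_points p t UV)) ^ 3"
      using nk n0 k by (intro power_mono) auto
    ultimately have "n ^ 2 * (n * k ^ 3) \<le> n ^ 2 * (442368 * real t ^ 2)"
      by (simp add: power_mult_distrib power2_eq_square power3_eq_cube algebra_simps)
    thus ?thesis using n0 by (subst (asm) mult_le_cancel_left_pos) auto
  qed simp
  hence "n * k ^ 3 * real t ^ 2 \<le> 442368 * real t ^ 2 * real t ^ 2" by (intro mult_right_mono) auto
  thus ?thesis unfolding A_def[symmetric] cA n_def by (simp add: algebra_simps flip: power_add)
qed

section \<open>Representation counts as points on coset classes\<close>

definition iv :: "int \<Rightarrow> int" where "iv c = (SOME d. d \<in> U \<and> [c * d = 1] (mod int p))"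

lemma iv: assumes "c \<in> U" shows "iv c \<in> U" "[c * iv c = 1] (mod int p)"
proof -
  have "\<exists>d. d \<in> U \<and> [c * d = 1] (mod int p)" using inverse_exists assms U_iff by metis
  from someI_ex[OF this] show "iv c \<in> U" "[c * iv c = 1] (mod int p)" unfolding iv_def by auto
qed

lemma rt_eq_card: "rt \<theta> w = real (card {c \<in> F. \<gamma> c = 1 \<and> \<gamma> (w + \<theta> * c) = 1})"
proof -
  have "rt \<theta> w = (\<Sum>c\<in>F. of_bool (\<gamma> c = 1 \<and> \<gamma> (w + \<theta> * c) = 1))"
    unfolding rt_def by (intro sum.cong refl) (auto simp: \<gamma>_def)
  also have "\<dots> = real (card (F \<inter> {c. \<gamma> c = 1 \<and> \<gamma> (w + \<theta> * c) = 1}))" by (simp add: of_bool_def sum.If_cases)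
  also have "F \<inter> {c. \<gamma> c = 1 \<and> \<gamma> (w + \<theta> * c) = 1} = {c \<in> F. \<gamma> c = 1 \<and> \<gamma> (w + \<theta> * c) = 1}" by auto
  finally show ?thesis .
qed

lemma rt_Nats: "rt \<theta> w \<in> \<nat>" unfolding rt_eq_card by simp

text \<open>Divide a - \<theta>c = w by w: the point x = a/w satisfies 1 - x = -\<theta>c/w. As a
  and c range over the subgroup, x and 1 - x stay in the fixed cosets of 1/w and -\<theta>/w, and c
  can be recovered from x.\<close>

lemma rt_le_stepanov:
  assumes \<theta>: "\<theta> \<in> U" and w: "w \<in> U"
  shows "rt \<theta> w \<le> real (card (stepanov_points p t {cls (iv w, (- \<theta> * iv w) mod int p)}))"
proof -
  define S where "S = {c \<in> F. \<gamma> c = 1 \<and> \<gamma> (w + \<theta> * c) = 1}"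
  define X where "X c = ((w + \<theta> * c) * iv w) mod int p" for c
  note ivw = iv[OF w]
  have nd: "\<not> int p dvd iv w" "\<not> int p dvd \<theta>" using ivw \<theta> U_iff by auto
  have X1: "[1 - X c = (- \<theta> * iv w) * c] (mod int p)" for c
  proof -
    have "[1 - X c = w * iv w - (w + \<theta> * c) * iv w] (mod int p)"
      unfolding X_def by (intro cong_diff cong_sym[OF ivw(2)] mod_cong_self)
    also have "w * iv w - (w + \<theta> * c) * iv w = (- \<theta> * iv w) * c" by (simp add: algebra_simps)
    finally show ?thesis .
  qed
  have inj: "inj_on X S"
  proof (rule inj_onI)
    fix c c' assume cc: "c \<in> S" "c' \<in> S" "X c = X c'"
    have "[(- \<theta> * iv w) * c = (- \<theta> * iv w) * c'] (mod int p)"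
      using X1[of c] X1[of c'] cc(3) by (metis cong_sym cong_trans)
    hence "int p dvd (- \<theta> * iv w) * (c - c')" by (simp add: cong_iff_dvd_diff right_diff_distrib)
    hence "int p dvd c - c'" using nd by (auto simp: dvd_mult_p)
    thus "c = c'" using F_eq_iff[of c c'] cc by (simp add: S_def cong_iff_dvd_diff)
  qed
  have "X ` S \<subseteq> stepanov_points p t {cls (iv w, (- \<theta> * iv w) mod int p)}"
  proof
    fix x assume "x \<in> X ` S"
    then obtain c where c: "c \<in> F" "\<gamma> c = 1" "\<gamma> (w + \<theta> * c) = 1" and x: "x = X c" unfolding S_def by auto
    have a: "x ^ t mod int p = iv w ^ t mod int p"
    proof -
      have "[x ^ t = ((w + \<theta> * c) * iv w) ^ t] (mod int p)" unfolding x X_def by (intro cong_pow mod_cong_self)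
      also have "((w + \<theta> * c) * iv w) ^ t = (w + \<theta> * c) ^ t * iv w ^ t" by (simp add: power_mult_distrib)
      also have "[\<dots> = 1 * iv w ^ t] (mod int p)" using c(3) by (intro cong_mult cong_refl) (simp add: \<gamma>_eq_1)
      finally show ?thesis by (simp add: unique_euclidean_semiring_class.cong_def)
    qed
    have b: "(1 - x) ^ t mod int p = ((- \<theta> * iv w) mod int p) ^ t mod int p"
    proof -
      have "[(1 - x) ^ t = ((- \<theta> * iv w) * c) ^ t] (mod int p)" unfolding x by (intro cong_pow X1)
      also have "((- \<theta> * iv w) * c) ^ t = (- \<theta> * iv w) ^ t * c ^ t" by (simp only: power_mult_distrib)
      also have "[\<dots> = (- \<theta> * iv w) ^ t * 1] (mod int p)" using c(2) by (intro cong_mult cong_refl) (simp add: \<gamma>_eq_1)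
      finally have "(1 - x) ^ t mod int p = (- \<theta> * iv w) ^ t mod int p" unfolding unique_euclidean_semiring_class.cong_def by (simp only: mult_1_right)
      thus ?thesis by (simp only: power_mod)
    qed
    have "x \<in> F" unfolding x X_def by (rule mod_in_F)
    moreover have "\<not> int p dvd x"
      unfolding x X_def using nd(1) \<gamma>_not_dvd[OF c(3)] by (simp add: dvd_mod_iff dvd_mult_p)
    hence "x \<noteq> 0" by auto
    moreover have "x \<noteq> 1"
    proof
      assume "x = 1"
      hence "[0 = (- \<theta> * iv w) * c] (mod int p)" using X1[of c] x by simp
      hence "int p dvd (- \<theta> * iv w) * c" by (simp add: cong_iff_dvd_diff)
      thus False using nd \<gamma>_not_dvd[OF c(2)] by (auto simp: dvd_mult_p)
    qed
    ultimately have "x \<in> {2..<int p}" by auto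
    thus "x \<in> stepanov_points p t {cls (iv w, (- \<theta> * iv w) mod int p)}"
      using a b by (simp add: stepanov_points_def cls_def)
  qed
  hence "card S \<le> card (stepanov_points p t {cls (iv w, (- \<theta> * iv w) mod int p)})"
    using card_inj_on_le[OF inj] by simp
  thus ?thesis unfolding rt_eq_card S_def by simp
qed

text \<open>The map sending (\<theta>, w) to (1/w, -\<theta>/w) is injective and carries rich pairs
  to rich classes.\<close>

lemma card_rich_rt:
  fixes k :: real
  assumes k: "k > 0" "k > 1936 * real t ^ 2 / real p"
  shows "real (card {i \<in> U \<times> U. k \<le> rt (fst i) (snd i)}) * k ^ 3 \<le> 442368 * real t ^ 4"
proof -
  define f where "f i = (iv (snd i), (- fst i * iv (snd i)) mod int p)" for i
  define A where "A = {ab \<in> U \<times> U. k \<le> real (card (stepanov_points p t {cls ab}))}"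
  define B where "B = {i \<in> U \<times> U. k \<le> rt (fst i) (snd i)}"
  have "inj_on f B"
  proof (rule inj_onI)
    fix i j assume ij: "i \<in> B" "j \<in> B" "f i = f j"
    have U: "fst i \<in> U" "snd i \<in> U" "fst j \<in> U" "snd j \<in> U" using ij by (auto simp: B_def mem_Times_iff)
    have e: "iv (snd i) = iv (snd j)" "(- fst i * iv (snd i)) mod int p = (- fst j * iv (snd j)) mod int p"
      using ij(3) by (auto simp: f_def)
    have nd: "\<not> int p dvd iv (snd i)" using iv(1)[OF U(2)] U_iff by blast
    have "[snd i * iv (snd i) = snd j * iv (snd i)] (mod int p)"
      using iv(2)[OF U(2)] iv(2)[OF U(4)] e(1) by (metis cong_sym cong_trans)
    hence "int p dvd (snd i - snd j) * iv (snd i)" by (simp add: cong_iff_dvd_diff left_diff_distrib)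
    hence "int p dvd snd i - snd j" using nd by (auto simp: dvd_mult_p)
    hence s: "snd i = snd j" using F_eq_iff[of "snd i" "snd j"] U by (simp add: cong_iff_dvd_diff)
    have "int p dvd (- fst i * iv (snd i)) - (- fst j * iv (snd i))"
      using e by (simp add: mod_eq_dvd_iff)
    hence "int p dvd (fst j - fst i) * iv (snd i)" by (simp add: algebra_simps)
    hence "int p dvd fst j - fst i" using nd by (auto simp: dvd_mult_p)
    hence "fst j = fst i" using F_eq_iff[of "fst j" "fst i"] U by (simp add: cong_iff_dvd_diff)
    thus "i = j" using s by (simp add: prod_eq_iff)
  qed
  moreover have "f ` B \<subseteq> A"
  proof
    fix x assume "x \<in> f ` B"
    then obtain i where i: "i \<in> B" "x = f i" by auto
    have U: "fst i \<in> U" "snd i \<in> U" using i by (auto simp: B_def mem_Times_iff)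
    have "\<not> int p dvd - fst i * iv (snd i)" using iv(1)[OF U(2)] U U_iff by (auto simp: dvd_mult_p)
    hence "f i \<in> U \<times> U" unfolding f_def using iv(1)[OF U(2)] mod_in_U by blast
    moreover have "k \<le> rt (fst i) (snd i)" using i by (simp add: B_def)
    ultimately show "x \<in> A" unfolding A_def i(2) using rt_le_stepanov[OF U] by (auto simp: f_def)
  qed
  moreover have "finite A" unfolding A_def by (rule finite_subset[of _ "U \<times> U"]) auto
  ultimately have "card B \<le> card A" by (rule card_inj_on_le)
  hence "real (card B) * k ^ 3 \<le> real (card A) * k ^ 3" using k by (intro mult_right_mono) auto
  thus ?thesis using card_rich_classes[OF k] unfolding A_def B_def by linarith
qed

text \<open>A factor t is gained because \<open>rt \<theta> w\<close> equals \<open>r w\<close> for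
  each of the t values of \<theta> in the subgroup.\<close>

lemma card_rich_r:
  fixes k :: real
  assumes k: "k > 0" "k > 1936 * real t ^ 2 / real p"
  shows "real (card {z \<in> U. k \<le> r z}) * k ^ 3 \<le> 442368 * real t ^ 3"
proof -
  define Gs where "Gs = {x \<in> F. [x ^ t = 1] (mod int p)}"
  have g: "\<gamma> g = 1" "g \<in> U" if "g \<in> Gs" for g
    using that \<gamma>_not_dvd[of g] U_iff by (auto simp: Gs_def \<gamma>_eq_1)
  have "Gs \<times> {z \<in> U. k \<le> r z} \<subseteq> {i \<in> U \<times> U. k \<le> rt (fst i) (snd i)}"
  proof
    fix i assume i: "i \<in> Gs \<times> {z \<in> U. k \<le> r z}"
    have "rt (fst i) (snd i) = r (snd i)" using rt_mult_left[OF g(1), of "fst i" 1] i by auto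
    thus "i \<in> {i \<in> U \<times> U. k \<le> rt (fst i) (snd i)}" using i g(2) by (simp add: mem_Times_iff)
  qed
  hence "card (Gs \<times> {z \<in> U. k \<le> r z}) \<le> card {i \<in> U \<times> U. k \<le> rt (fst i) (snd i)}"
    by (rule card_mono[rotated]) (rule finite_subset[of _ "U \<times> U"], auto)
  hence "t * card {z \<in> U. k \<le> r z} \<le> card {i \<in> U \<times> U. k \<le> rt (fst i) (snd i)}"
    using card_G by (simp add: card_cartesian_product Gs_def)
  hence "real t * real (card {z \<in> U. k \<le> r z}) \<le> real (card {i \<in> U \<times> U. k \<le> rt (fst i) (snd i)})"
    unfolding of_nat_le_iff[where 'a = real, symmetric] by simp
  hence "real t * real (card {z \<in> U. k \<le> r z}) * k ^ 3 \<le> real (card {i \<in> U \<times> U. k \<le> rt (fst i) (snd i)}) * k ^ 3"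
    using k by (intro mult_right_mono) auto
  also have "\<dots> \<le> 442368 * real t ^ 4" by (rule card_rich_rt[OF k])
  finally have "real t * (real (card {z \<in> U. k \<le> r z}) * k ^ 3) \<le> real t * (442368 * real t ^ 3)"
    by (simp add: eval_nat_numeral algebra_simps)
  thus ?thesis using t_pos by (subst (asm) mult_le_cancel_left_pos) auto
qed

definition L :: real where "L = 1 + ln (real p)"

lemma t_le_p: "t \<le> p"
proof -
  have "card {x \<in> F. [x ^ t = 1] (mod int p)} \<le> card F" by (rule card_mono) auto
  thus ?thesis using card_G by simp
qed

lemma rt_le_p: "rt \<theta> w \<le> real p" using rt_le_t[of \<theta> w] t_le_p by (meson of_nat_mono order_trans)

lemma L_ge_1: "L \<ge> 1" unfolding L_def using p_gt_1 by simp

text \<open>\<open>E3b\<close> and \<open>R3b\<close> bound the third moments of \<open>r\<close>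
  and \<open>rt\<close>. In each the first summand comes from the values above 1936 t^2/p, where
  Stepanov's cubic bound holds, and the second from the values up to that cutoff, a constant times
  the mean t^2/p.\<close>

definition E3b :: real where "E3b = 3 * (442368 * real t ^ 3) * L + 3 * (1936 * real t ^ 2 / real p) ^ 3 * real p"
definition R3b :: real where "R3b = 3 * (442368 * real t ^ 4) * L + 3 * (1936 * real t ^ 2 / real p) ^ 3 * (real p) ^ 2"

lemma sum_r_cubed: "(\<Sum>z\<in>U. r z ^ 3) \<le> E3b"
proof -
  have "(\<Sum>z\<in>U. r z ^ 3) \<le> 3 * (442368 * real t ^ 3) * (1 + ln (real p)) + 3 * (1936 * real t ^ 2 / real p) ^ 3 * real (card U)"
  proof (rule cube_sum_le)
    fix k :: nat assume "k \<ge> 1" "1936 * real t ^ 2 / real p < real k"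
    thus "real (card {x \<in> U. real k \<le> r x}) * real k ^ 3 \<le> 442368 * real t ^ 3"
      using card_rich_r[of "real k"] by simp
  qed (use p_gt_1 in \<open>auto simp: L_def intro: rt_le_p rt_Nats\<close>)
  also have "\<dots> \<le> E3b" unfolding E3b_def L_def using p_gt_1 by (intro add_mono mult_left_mono) auto
  finally show ?thesis .
qed

lemma sum_rt_cubed: "(\<Sum>\<theta>\<in>U. \<Sum>w\<in>U. rt \<theta> w ^ 3) \<le> R3b"
proof -
  have "(\<Sum>\<theta>\<in>U. \<Sum>w\<in>U. rt \<theta> w ^ 3) = (\<Sum>i\<in>U \<times> U. rt (fst i) (snd i) ^ 3)"
    by (simp add: sum.cartesian_product split_def)
  also have "\<dots> \<le> 3 * (442368 * real t ^ 4) * (1 + ln (real p)) + 3 * (1936 * real t ^ 2 / real p) ^ 3 * real (card (U \<times> U))"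
  proof (rule cube_sum_le)
    fix k :: nat assume "k \<ge> 1" "1936 * real t ^ 2 / real p < real k"
    thus "real (card {i \<in> U \<times> U. real k \<le> rt (fst i) (snd i)}) * real k ^ 3 \<le> 442368 * real t ^ 4"
      using card_rich_rt[of "real k"] by simp
  qed (use p_gt_1 in \<open>auto simp: L_def intro: rt_le_p rt_Nats\<close>)
  also have "\<dots> \<le> R3b"
  proof -
    have "real (card (U \<times> U)) \<le> (real p)\<^sup>2" using p_gt_1
      by (simp add: card_cartesian_product power2_eq_square mult_mono)
    thus ?thesis unfolding R3b_def L_def by (intro add_mono mult_left_mono) auto
  qed
  finally show ?thesis .
qed

text \<open>Both sides count solutions of a - b = \<theta>(c - d) in the subgroup, grouped by c - d
  on the left and by a - \<theta>c on the right.\<close>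

lemma sum_rt_squares: assumes "\<theta> \<in> U" shows "(\<Sum>x\<in>F. r x * r (\<theta> * x)) = (\<Sum>w\<in>F. (rt \<theta> w)\<^sup>2)"
proof -
  have "(\<Sum>w\<in>F. (rt \<theta> w)\<^sup>2) = (\<Sum>w\<in>F. \<Sum>c\<in>F. \<Sum>d\<in>F. \<gamma> c * \<gamma> d * (\<gamma> (\<theta> * c + w) * \<gamma> (\<theta> * d + w)))"
    unfolding rt_def power2_eq_square sum_product by (simp add: mult_ac add.commute)
  also have "\<dots> = (\<Sum>c\<in>F. \<Sum>d\<in>F. \<Sum>w\<in>F. \<gamma> c * \<gamma> d * (\<gamma> (\<theta> * c + w) * \<gamma> (\<theta> * d + w)))"
    by (subst sum.swap, rule sum.cong[OF refl], rule sum.swap)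
  also have "\<dots> = (\<Sum>c\<in>F. \<Sum>d\<in>F. \<gamma> c * \<gamma> d * r (\<theta> * d - \<theta> * c))"
    by (simp only: sum_distrib_left[symmetric] corr_eq_r)
  also have "\<dots> = (\<Sum>c\<in>F. \<Sum>x\<in>F. \<gamma> c * \<gamma> (x + c) * r (\<theta> * (x + c) - \<theta> * c))"
    by (rule sum.cong[OF refl], rule sum_shift[symmetric])
      (rule perI, (intro per_cong perD[OF per_rt] | assumption)+)
  also have "\<dots> = (\<Sum>x\<in>F. (\<Sum>c\<in>F. \<gamma> c * \<gamma> (x + c)) * r (\<theta> * x))"
    by (subst sum.swap) (simp add: sum_distrib_right distrib_left)
  finally show ?thesis by (simp add: rt_def)
qed

text \<open>The mass of \<open>rt \<theta>\<close> is t^2, so Cauchy-Schwarz bounds the squared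
  second moment by t^2 times the third. At w = 0 the count is t for \<theta> in the subgroup and 0
  otherwise, which accounts for t^4.\<close>

lemma sum_q_squares:
  "(\<Sum>\<theta>\<in>U. (\<Sum>w\<in>F. (rt \<theta> w)\<^sup>2)\<^sup>2) \<le> real t ^ 2 * (R3b + real t ^ 4)"
proof -
  have "(\<Sum>w\<in>F. (rt \<theta> w)\<^sup>2)\<^sup>2 \<le> real t ^ 2 * (\<Sum>w\<in>F. rt \<theta> w ^ 3)" for \<theta>
  proof -
    have "(\<Sum>w\<in>F. (rt \<theta> w)\<^sup>2) = (\<Sum>w\<in>F. sqrt (rt \<theta> w) * (sqrt (rt \<theta> w) * rt \<theta> w))"
      by (intro sum.cong refl) (simp add: power2_eq_square flip: mult.assoc)
    hence "(\<Sum>w\<in>F. (rt \<theta> w)\<^sup>2)\<^sup>2 \<le> (\<Sum>w\<in>F. (sqrt (rt \<theta> w))\<^sup>2) * (\<Sum>w\<in>F. (sqrt (rt \<theta> w) * rt \<theta> w)\<^sup>2)"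
      using Cauchy_Schwarz_ineq_sum by metis
    also have "\<dots> = real t ^ 2 * (\<Sum>w\<in>F. rt \<theta> w ^ 3)"
      by (simp add: power_mult_distrib sum_rt power3_eq_cube power2_eq_square[of "rt _ _"] mult.assoc)
    finally show ?thesis .
  qed
  hence "(\<Sum>\<theta>\<in>U. (\<Sum>w\<in>F. (rt \<theta> w)\<^sup>2)\<^sup>2) \<le> (\<Sum>\<theta>\<in>U. real t ^ 2 * (\<Sum>w\<in>F. rt \<theta> w ^ 3))" by (rule sum_mono)
  also have "\<dots> = real t ^ 2 * ((\<Sum>\<theta>\<in>U. rt \<theta> 0 ^ 3) + (\<Sum>\<theta>\<in>U. \<Sum>w\<in>U. rt \<theta> w ^ 3))"
    unfolding F_split by (simp add: sum.distrib flip: sum_distrib_left)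
  also have "\<dots> \<le> real t ^ 2 * (real t ^ 4 + R3b)"
  proof (intro mult_left_mono add_mono sum_rt_cubed)
    have "rt \<theta> 0 ^ 3 \<le> real t ^ 3 * \<gamma> \<theta>" for \<theta>
    proof -
      have "rt \<theta> 0 = (\<Sum>c\<in>F. \<gamma> c * \<gamma> \<theta>)" unfolding rt_def
      proof (rule sum.cong)
        fix c show "\<gamma> c * \<gamma> (0 + \<theta> * c) = \<gamma> c * \<gamma> \<theta>" using \<gamma>_cases[of c] \<gamma>_mult'[of c \<theta>] by auto
      qed simp
      also have "\<dots> = real t * \<gamma> \<theta>" by (simp add: sum_\<gamma> flip: sum_distrib_right)
      finally show ?thesis using \<gamma>_cases[of \<theta>] by auto
    qed
    hence "(\<Sum>\<theta>\<in>U. rt \<theta> 0 ^ 3) \<le> (\<Sum>\<theta>\<in>U. real t ^ 3 * \<gamma> \<theta>)" by (rule sum_mono)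
    also have "\<dots> = real t ^ 3 * (\<Sum>\<theta>\<in>F. \<gamma> \<theta>)" unfolding F_split by (simp add: sum_distrib_left)
    also have "\<dots> = real t ^ 4" by (simp add: sum_\<gamma> eval_nat_numeral)
    finally show "(\<Sum>\<theta>\<in>U. rt \<theta> 0 ^ 3) \<le> real t ^ 4" .
  qed auto
  finally show ?thesis by (simp add: add.commute)
qed

end

section \<open>Additive triples in unions of cosets\<close>

lemma sum_in_Nats: "(\<And>i. i \<in> I \<Longrightarrow> f i \<in> \<nat>) \<Longrightarrow> sum f I \<in> \<nat>"
  by (induction I rule: infinite_finite_induct) auto

context stepanov_subgroup
begin

text \<open>Indicator functions of sets of nonzero residues that are invariant under the subgroup.\<close>

definition chi :: "(int \<Rightarrow> real) \<Rightarrow> bool" where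
  "chi f \<longleftrightarrow> per f \<and> (\<forall>x. f x = 0 \<or> f x = 1) \<and> f 0 = 0 \<and> (\<forall>g x. \<gamma> g = 1 \<longrightarrow> f (g * x) = f x)"

lemma chiD:
  assumes "chi f"
  shows "per f" "f x = 0 \<or> f x = 1" "f 0 = 0" "\<gamma> g = 1 \<Longrightarrow> f (g * x) = f x" "f x \<ge> 0" "f x \<le> 1" "f x \<in> \<nat>" "f x * f x = f x"
proof -
  show "per f" "f x = 0 \<or> f x = 1" "f 0 = 0" "\<gamma> g = 1 \<Longrightarrow> f (g * x) = f x"
    using assms unfolding chi_def by blast+
  hence "f x = 0 \<or> f x = 1" by blast
  thus "f x \<ge> 0" "f x \<le> 1" "f x \<in> \<nat>" "f x * f x = f x" by auto
qed

definition wt :: "(int \<Rightarrow> real) \<Rightarrow> real" where "wt f = (\<Sum>x\<in>F. f x)"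

lemma wt_nonneg: "chi f \<Longrightarrow> wt f \<ge> 0" unfolding wt_def by (intro sum_nonneg) (simp add: chiD)

lemma wt_le_p: assumes "chi f" shows "wt f \<le> real p"
proof -
  have "wt f \<le> (\<Sum>x\<in>F. 1)" unfolding wt_def by (intro sum_mono) (simp add: chiD[OF assms])
  thus ?thesis by simp
qed

text \<open>The multiplicative energy of the set with indicator function \<open>f\<close>.\<close>

definition Xi :: "(int \<Rightarrow> real) \<Rightarrow> real" where
  "Xi f = (\<Sum>\<theta>\<in>U. (\<Sum>x\<in>F. f x * f (\<theta> * x))\<^sup>2)"

definition rho :: "(int \<Rightarrow> real) \<Rightarrow> int \<Rightarrow> real" where
  "rho f z = (\<Sum>x\<in>F. f x * f (x - z))"

lemma Xi_nonneg: "Xi f \<ge> 0" unfolding Xi_def by (intro sum_nonneg) auto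

text \<open>On the support of f the function r is at least \<Delta>, so \<Delta>^2 times a
  multiplicative correlation of f is at most the corresponding correlation of r. The latter is a
  twisted additive energy: a set of popular differences therefore has small multiplicative
  energy.\<close>

lemma Xi_le:
  assumes f: "chi f" and D: "\<Delta> > 0" and lev: "\<And>x. f x = 1 \<Longrightarrow> \<Delta> \<le> r x"
  shows "Xi f * \<Delta> ^ 4 \<le> real t ^ 2 * (R3b + real t ^ 4)"
proof -
  have f1: "f x * \<Delta> \<le> r x" for x using chiD(2)[OF f, of x] lev[of x] by auto
  have "(\<Sum>x\<in>F. f x * f (\<theta> * x)) * \<Delta>\<^sup>2 \<le> (\<Sum>w\<in>F. (rt \<theta> w)\<^sup>2)" if "\<theta> \<in> U" for \<theta>
  proof -
    have "(\<Sum>x\<in>F. f x * f (\<theta> * x)) * \<Delta>\<^sup>2 = (\<Sum>x\<in>F. (f x * \<Delta>) * (f (\<theta> * x) * \<Delta>))"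
      unfolding sum_distrib_right by (rule sum.cong[OF refl]) (simp add: power2_eq_square)
    also have "\<dots> \<le> (\<Sum>x\<in>F. r x * r (\<theta> * x))"
      using D by (intro sum_mono mult_mono f1) (auto simp: chiD[OF f])
    finally show ?thesis using sum_rt_squares[OF that] by simp
  qed
  hence "((\<Sum>x\<in>F. f x * f (\<theta> * x)) * \<Delta>\<^sup>2)\<^sup>2 \<le> (\<Sum>w\<in>F. (rt \<theta> w)\<^sup>2)\<^sup>2" if "\<theta> \<in> U" for \<theta>
    using that D by (intro power_mono) (auto intro!: mult_nonneg_nonneg sum_nonneg simp: chiD[OF f])
  hence "(\<Sum>\<theta>\<in>U. ((\<Sum>x\<in>F. f x * f (\<theta> * x)) * \<Delta>\<^sup>2)\<^sup>2) \<le> (\<Sum>\<theta>\<in>U. (\<Sum>w\<in>F. (rt \<theta> w)\<^sup>2)\<^sup>2)"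
    by (rule sum_mono)
  also have "(\<Sum>\<theta>\<in>U. ((\<Sum>x\<in>F. f x * f (\<theta> * x)) * \<Delta>\<^sup>2)\<^sup>2) = Xi f * \<Delta> ^ 4"
    unfolding Xi_def power_mult_distrib sum_distrib_right[symmetric] by (simp flip: power_mult)
  finally show ?thesis using sum_q_squares by linarith
qed

lemma sum_F_eq_U: "f 0 = (0::real) \<Longrightarrow> (\<Sum>x\<in>F. f x) = (\<Sum>x\<in>U. f x)"
  unfolding F_split by simp

lemma wt_scale: assumes "chi f" "\<not> int p dvd z" shows "(\<Sum>x\<in>F. f (x * z)) = wt f" "(\<Sum>x\<in>F. f (- x * z)) = wt f"
  using sum_scale[OF chiD(1)[OF assms(1)] assms(2)]
    sum_scale[OF chiD(1)[OF assms(1)], of "- z"] assms(2) unfolding wt_def by (simp_all add: mult.commute)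

lemma corr_scale:
  assumes f: "chi f" and z: "\<not> int p dvd z" and d: "[z * d = 1] (mod int p)"
  shows "(\<Sum>x\<in>F. f (x * z) * f (x * z')) = (\<Sum>x\<in>F. f x * f (d * z' * x))"
    and "(\<Sum>x\<in>F. f (- x * z) * f (- x * z')) = (\<Sum>x\<in>F. f x * f (d * z' * x))"
proof -
  note per = chiD(1)[OF f]
  have e: "f (s * x * z') = f (d * z' * (s * z * x))" for s x
  proof (rule perD[OF per])
    have "[s * x * z' * 1 = s * x * z' * (z * d)] (mod int p)" by (intro cong_mult cong_refl cong_sym[OF d])
    thus "[s * x * z' = d * z' * (s * z * x)] (mod int p)" by (simp add: mult_ac)
  qed
  have perh: "per (\<lambda>x. f x * f (d * z' * x))"
    by (rule perI, (intro per_cong perD[OF per] | assumption)+)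
  have "(\<Sum>x\<in>F. f (x * z) * f (x * z')) = (\<Sum>x\<in>F. f (z * x) * f (d * z' * (z * x)))"
    using e[of 1] by (simp add: mult.commute)
  also have "\<dots> = (\<Sum>x\<in>F. f x * f (d * z' * x))" by (rule sum_scale[OF perh z])
  finally show "(\<Sum>x\<in>F. f (x * z) * f (x * z')) = (\<Sum>x\<in>F. f x * f (d * z' * x))" .
  have "(\<Sum>x\<in>F. f (- x * z) * f (- x * z')) = (\<Sum>x\<in>F. f ((- z) * x) * f (d * z' * ((- z) * x)))"
    using e[of "-1"] by (simp add: mult.commute)
  also have "\<dots> = (\<Sum>x\<in>F. f x * f (d * z' * x))" by (rule sum_scale[OF perh]) (simp add: z)
  finally show "(\<Sum>x\<in>F. f (- x * z) * f (- x * z')) = (\<Sum>x\<in>F. f x * f (d * z' * x))" .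
qed

text \<open>Counts the z in the set h for which az and -bz lie in the set f. When a + b = 1, these
  two elements have difference z.\<close>

definition W :: "(int \<Rightarrow> real) \<Rightarrow> (int \<Rightarrow> real) \<Rightarrow> int \<Rightarrow> int \<Rightarrow> real" where
  "W f h a b = (\<Sum>z\<in>F. h z * (f (a * z) * f (- b * z)))"

context
  fixes f h :: "int \<Rightarrow> real"
  assumes f: "chi f" and h: "chi h"
begin

lemma W_nonneg: "W f h a b \<ge> 0"
  unfolding W_def by (intro sum_nonneg mult_nonneg_nonneg chiD(5)[OF f] chiD(5)[OF h])

lemma W_Nats: "W f h a b \<in> \<nat>"
  unfolding W_def by (intro sum_in_Nats Nats_mult chiD(7)[OF f] chiD(7)[OF h])

lemma W_le_p: "W f h a b \<le> real p"
proof -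
  have "W f h a b \<le> (\<Sum>z\<in>F. 1)"
    unfolding W_def by (intro sum_mono mult_le_one mult_nonneg_nonneg chiD(5,6)[OF f] chiD(5,6)[OF h])
  thus ?thesis by simp
qed

lemma W_cong: "[a = a'] (mod int p) \<Longrightarrow> [b = b'] (mod int p) \<Longrightarrow> W f h a b = W f h a' b'"
  unfolding W_def
  by (intro sum.cong refl arg_cong2[where f = "(*)"] perD[OF chiD(1)[OF f]] cong_mult cong_refl
      cong_minus_minus_iff[THEN iffD2] | assumption)+

lemma W_mult: assumes "\<gamma> g = 1" "\<gamma> g' = 1" shows "W f h (g * a) (g' * b) = W f h a b"
proof -
  have "f (g * a * z) = f (a * z)" "f (- (g' * b) * z) = f (- b * z)" for z
    using chiD(4)[OF f assms(1), of "a * z"] chiD(4)[OF f assms(2), of "- b * z"] by (simp_all add: mult.assoc)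
  thus ?thesis unfolding W_def by simp
qed

lemma same_power_coset:
  assumes "a \<in> U" "a' \<in> U" "a' ^ t mod int p = a ^ t mod int p"
  obtains g where "\<gamma> g = 1" "[a' = g * a] (mod int p)"
proof -
  obtain d where d: "d \<in> U" "[a * d = 1] (mod int p)" using inverse_exists assms(1) U_iff by blast
  have "[(a' * d) ^ t = (a * d) ^ t] (mod int p)"
    unfolding power_mult_distrib using assms(3)
    by (intro cong_mult cong_refl) (simp add: unique_euclidean_semiring_class.cong_def)
  hence "[(a' * d) ^ t = 1] (mod int p)" using cong_pow[OF d(2), of t] cong_trans by fastforce
  hence "\<gamma> (a' * d) = 1" by (simp add: \<gamma>_eq_1)
  moreover have "[a' * 1 = a' * (a * d)] (mod int p)" by (intro cong_mult cong_refl cong_sym[OF d(2)])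
  hence "[a' = (a' * d) * a] (mod int p)" by (simp add: mult_ac)
  ultimately show ?thesis using that by blast
qed

lemma sum_W: "(\<Sum>a\<in>F. \<Sum>b\<in>F. W f h a b) = wt f ^ 2 * wt h"
proof -
  have "(\<Sum>a\<in>F. \<Sum>b\<in>F. W f h a b) = (\<Sum>a\<in>F. \<Sum>z\<in>F. \<Sum>b\<in>F. h z * (f (a * z) * f (- b * z)))"
    unfolding W_def by (rule sum.cong[OF refl], rule sum.swap)
  also have "\<dots> = (\<Sum>z\<in>F. \<Sum>a\<in>F. \<Sum>b\<in>F. h z * (f (a * z) * f (- b * z)))" by (rule sum.swap)
  also have "\<dots> = (\<Sum>z\<in>F. h z * ((\<Sum>a\<in>F. f (a * z)) * (\<Sum>b\<in>F. f (- b * z))))"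
    unfolding sum_product by (simp only: sum_distrib_left)
  also have "\<dots> = (\<Sum>z\<in>F. h z * (wt f * wt f))"
  proof (rule sum.cong[OF refl])
    fix z assume "z \<in> F"
    hence "z = 0 \<or> \<not> int p dvd z" using U_iff F_split by blast
    thus "h z * ((\<Sum>a\<in>F. f (a * z)) * (\<Sum>b\<in>F. f (- b * z))) = h z * (wt f * wt f)"
      using wt_scale[OF f] chiD(3)[OF h] by auto
  qed
  finally show ?thesis by (simp add: wt_def[of h] sum_distrib_right power2_eq_square mult.commute)
qed

text \<open>For fixed z and z' the sums over a and b are both the correlation of f at the ratio
  z'/z. Discarding the factor h(z') and letting z' range over all residues produces the
  multiplicative energy for each z.\<close>

lemma sum_W_squared: "(\<Sum>a\<in>F. \<Sum>b\<in>F. (W f h a b)\<^sup>2) \<le> wt h * Xi f"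
proof -
  have "(\<Sum>a\<in>F. \<Sum>b\<in>F. (W f h a b)\<^sup>2) = (\<Sum>a\<in>F. \<Sum>b\<in>F. \<Sum>z\<in>F. \<Sum>z'\<in>F.
      h z * h z' * ((f (a * z) * f (a * z')) * (f (- b * z) * f (- b * z'))))"
    unfolding W_def power2_eq_square sum_product by (simp only: mult_ac)
  also have "\<dots> = (\<Sum>z\<in>F. \<Sum>z'\<in>F. \<Sum>a\<in>F. \<Sum>b\<in>F.
      h z * h z' * ((f (a * z) * f (a * z')) * (f (- b * z) * f (- b * z'))))"
    by (rule sum_swap4)
  also have "\<dots> = (\<Sum>z\<in>F. \<Sum>z'\<in>F. h z * h z' * ((\<Sum>a\<in>F. f (a * z) * f (a * z')) * (\<Sum>b\<in>F. f (- b * z) * f (- b * z'))))"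
    unfolding sum_product by (simp only: sum_distrib_left)
  also have "\<dots> \<le> (\<Sum>z\<in>F. h z * Xi f)"
  proof (rule sum_mono)
    fix z assume z: "z \<in> F"
    show "(\<Sum>z'\<in>F. h z * h z' * ((\<Sum>a\<in>F. f (a * z) * f (a * z')) * (\<Sum>b\<in>F. f (- b * z) * f (- b * z')))) \<le> h z * Xi f"
    proof (cases "z = 0")
      case True
      thus ?thesis using chiD(3)[OF h] by simp
    next
      case False
      hence nd: "\<not> int p dvd z" using z U_iff F_split by blast
      obtain d where d: "d \<in> U" "[z * d = 1] (mod int p)" using inverse_exists[OF nd] .
      define k where "k \<theta> = (\<Sum>x\<in>F. f x * f (\<theta> * x))\<^sup>2" for \<theta>
      have perk: "per k" unfolding k_def
        by (rule perI, rule arg_cong[where f = "\<lambda>x. x\<^sup>2"]) (intro per_cong perD[OF chiD(1)[OF f]] | assumption)+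
      have k0: "k 0 = 0" by (simp add: k_def chiD(3)[OF f])
      have "(\<Sum>z'\<in>F. h z * h z' * ((\<Sum>a\<in>F. f (a * z) * f (a * z')) * (\<Sum>b\<in>F. f (- b * z) * f (- b * z'))))
         = (\<Sum>z'\<in>F. h z * h z' * k (d * z'))"
        by (simp only: corr_scale[OF f nd d(2)] k_def power2_eq_square)
      also have "\<dots> \<le> (\<Sum>z'\<in>F. h z * 1 * k (d * z'))"
        by (intro sum_mono mult_right_mono mult_left_mono chiD(5,6)[OF h]) (simp add: k_def)
      also have "\<dots> = h z * (\<Sum>z'\<in>F. k (d * z'))" by (simp add: sum_distrib_left)
      also have "(\<Sum>z'\<in>F. k (d * z')) = (\<Sum>z'\<in>F. k z')" using sum_scale[OF perk] d(1) U_iff by blast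
      also have "\<dots> = (\<Sum>z'\<in>U. k z')" by (rule sum_F_eq_U[of k, OF k0])
      finally show ?thesis unfolding k_def Xi_def .
    qed
  qed
  also have "\<dots> = wt h * Xi f" by (simp add: wt_def sum_distrib_right)
  finally show ?thesis .
qed

lemma triple_sum_eq: "(\<Sum>z\<in>F. h z * rho f z) = (\<Sum>X\<in>{2..<int p}. W f h X (1 - X))"
proof -
  have "h z * rho f z = h z * (\<Sum>X\<in>F. f (X * z) * f (- (1 - X) * z))" if z: "z \<in> F" for z
  proof (cases "z = 0")
    case True
    thus ?thesis using chiD(3)[OF h] by simp
  next
    case False
    hence nd: "\<not> int p dvd z" using z U_iff F_split by blast
    have "rho f z = (\<Sum>x\<in>F. f (z * x) * f (z * x - z))" unfolding rho_def
      by (rule sum_scale[symmetric, OF _ nd]) (rule perI, (intro per_cong perD[OF chiD(1)[OF f]] | assumption)+)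
    thus ?thesis by (simp add: algebra_simps)
  qed
  hence "(\<Sum>z\<in>F. h z * rho f z) = (\<Sum>z\<in>F. h z * (\<Sum>X\<in>F. f (X * z) * f (- (1 - X) * z)))"
    by (rule sum.cong[OF refl])
  also have "\<dots> = (\<Sum>X\<in>F. W f h X (1 - X))"
    unfolding W_def sum_distrib_left by (rule sum.swap)
  also have "\<dots> = (\<Sum>X\<in>{2..<int p}. W f h X (1 - X))"
  proof (rule sum.mono_neutral_right)
    show "\<forall>i\<in>F - {2..<int p}. W f h i (1 - i) = 0"
    proof
      fix i assume "i \<in> F - {2..<int p}"
      hence "i = 0 \<or> i = 1" by auto
      thus "W f h i (1 - i) = 0" using chiD(3)[OF f] by (auto simp: W_def)
    qed
  qed auto
  finally show ?thesis .
qed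

text \<open>The substitution \<open>x = Xz\<close> turns \<open>x - y = z\<close> into \<open>y = (X-1)z\<close>. The multiplicity \<open>W f h X (1-X)\<close>
  depends only on the cosets of \<open>X\<close> and \<open>1-X\<close>, and its second moment over all pairs of cosets is
  bounded by \<open>Xi f\<close>.\<close>

lemma triple_sum_le:
  "(\<Sum>z\<in>F. h z * rho f z) \<le> root 3 (442368 * wt f ^ 2 * wt h ^ 2 * Xi f / real t ^ 2) * L
      + 1936 / real p * (wt f ^ 2 * wt h)"
proof -
  define V where "V = root 3 (442368 * wt f ^ 2 * wt h ^ 2 * Xi f / real t ^ 2)"
  define A where "A k = {ab \<in> U \<times> U. real k \<le> W f h (fst ab) (snd ab)}" for k :: nat
  have V0: "V \<ge> 0" unfolding V_def by (simp add: Xi_nonneg)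
  have t0: "real t > 0" using t_pos by simp
  have p0: "real p > 0" using p_gt_1 by simp
  have finA: "finite (A k)" for k unfolding A_def by (rule finite_subset[of _ "U \<times> U"]) auto
  have cA: "card (A k) = card (cls ` A k) * t\<^sup>2" for k
  proof (rule card_saturated)
    show "A k \<subseteq> U \<times> U" by (auto simp: A_def)
    fix ab ab' assume ab: "ab \<in> A k" "ab' \<in> U \<times> U" "cls ab' = cls ab"
    obtain a b where 1: "ab = (a, b)" by (cases ab)
    obtain a' b' where 2: "ab' = (a', b')" by (cases ab')
    have UU: "a \<in> U" "b \<in> U" "a' \<in> U" "b' \<in> U" using ab 1 2 by (auto simp: A_def)
    obtain g where g: "\<gamma> g = 1" "[a' = g * a] (mod int p)"
      using same_power_coset[OF UU(1,3)] ab(3) 1 2 by (auto simp: cls_def)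
    obtain g' where g': "\<gamma> g' = 1" "[b' = g' * b] (mod int p)"
      using same_power_coset[OF UU(2,4)] ab(3) 1 2 by (auto simp: cls_def)
    have "W f h a' b' = W f h a b" using W_cong[OF g(2) g'(2)] W_mult[OF g(1) g'(1)] by simp
    thus "ab' \<in> A k" using ab 1 2 by (simp add: A_def)
  qed
  have sumU: "(\<Sum>ab\<in>U \<times> U. k (fst ab) (snd ab)) \<le> (\<Sum>a\<in>F. \<Sum>b\<in>F. k a b)"
    if "\<And>a b. k a b \<ge> (0::real)" for k
  proof -
    have "(\<Sum>ab\<in>U \<times> U. k (fst ab) (snd ab)) \<le> (\<Sum>ab\<in>F \<times> F. k (fst ab) (snd ab))"
      by (rule sum_mono2) (auto simp: that)
    thus ?thesis by (simp add: sum.cartesian_product split_def)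
  qed
  have lev: "real (card {X \<in> {2..<int p}. real k \<le> W f h X (1 - X)}) \<le> V * (1 / real k) + 1936 / real p * real (card (A k))"
    if k: "k \<ge> 1" for k
  proof -
    define UV where "UV = cls ` A k"
    define n where "n = real (card UV)"
    have fin: "finite UV" unfolding UV_def using finA by simp
    have sub: "{X \<in> {2..<int p}. real k \<le> W f h X (1 - X)} \<subseteq> stepanov_points p t UV"
    proof
      fix X assume X: "X \<in> {X \<in> {2..<int p}. real k \<le> W f h X (1 - X)}"
      have XU: "X \<in> U" using X by auto
      have "\<not> int p dvd 1 - X" using X by (auto dest!: zdvd_imp_le simp: dvd_diff_commute[of _ 1])
      hence "(1 - X) mod int p \<in> U" by (rule mod_in_U)
      moreover have "W f h X ((1 - X) mod int p) = W f h X (1 - X)" by (rule W_cong[OF cong_refl mod_cong_self])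
      ultimately have "(X, (1 - X) mod int p) \<in> A k" using X XU by (simp add: A_def)
      hence "cls (X, (1 - X) mod int p) \<in> UV" unfolding UV_def by blast
      thus "X \<in> stepanov_points p t UV" using X by (simp add: stepanov_points_def cls_def power_mod)
    qed
    have c: "real (card {X \<in> {2..<int p}. real k \<le> W f h X (1 - X)}) \<le> real (card (stepanov_points p t UV))"
      using card_mono[OF finite_stepanov_points sub] by simp
    have an: "real (card (A k)) = n * real t ^ 2" using cA[of k] by (simp add: n_def UV_def)
    have k1: "real k * real (card (A k)) \<le> wt f ^ 2 * wt h"
    proof -
      have "real k * real (card (A k)) = (\<Sum>ab\<in>A k. real k)" by simp
      also have "\<dots> \<le> (\<Sum>ab\<in>A k. W f h (fst ab) (snd ab))" by (rule sum_mono) (auto simp: A_def)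
      also have "\<dots> \<le> (\<Sum>ab\<in>U \<times> U. W f h (fst ab) (snd ab))"
        by (rule sum_mono2) (auto simp: A_def W_nonneg)
      also have "\<dots> \<le> wt f ^ 2 * wt h" using sumU[of "W f h"] W_nonneg sum_W by simp
      finally show ?thesis .
    qed
    have k2: "real k ^ 2 * real (card (A k)) \<le> wt h * Xi f"
    proof -
      have "real k ^ 2 * real (card (A k)) = (\<Sum>ab\<in>A k. real k ^ 2)" by simp
      also have "\<dots> \<le> (\<Sum>ab\<in>A k. (W f h (fst ab) (snd ab))\<^sup>2)" by (rule sum_mono) (auto simp: A_def intro: power_mono)
      also have "\<dots> \<le> (\<Sum>ab\<in>U \<times> U. (W f h (fst ab) (snd ab))\<^sup>2)"
        by (rule sum_mono2) (auto simp: A_def)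
      also have "\<dots> \<le> wt h * Xi f" using sumU[of "\<lambda>a b. (W f h a b)\<^sup>2"] sum_W_squared by simp
      finally show ?thesis .
    qed
    from card_stepanov_points[OF prime_p t_pos p_le_t2 t_small fin]
    show ?thesis
    proof
      assume "real (card (stepanov_points p t UV)) \<le> 1936 * real (card UV) * real t ^ 2 / real p"
      hence "real (card (stepanov_points p t UV)) \<le> 1936 / real p * real (card (A k))" unfolding an n_def by simp
      moreover have "0 \<le> V * (1 / real k)" using V0 by simp
      ultimately show ?thesis using c by linarith
    next
      assume "real (card (stepanov_points p t UV)) ^ 3 \<le> 442368 * real (card UV) ^ 2 * real t ^ 2"
      also have "\<dots> = 442368 * real (card (A k)) ^ 2 / real t ^ 2" unfolding an n_def using t0
        by (simp add: power_mult_distrib field_simps power2_eq_square)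
      also have "\<dots> \<le> (V * (1 / real k)) ^ 3"
      proof -
        \<comment> \<open>The product of the first and second moment bounds involves k^3 times the
          squared size of the level set, the combination that Stepanov's cubic bound requires. Its
          cube root decays like 1/k, so summing over k costs only L.\<close>
        have "(real k * real (card (A k))) * (real k ^ 2 * real (card (A k))) \<le> (wt f ^ 2 * wt h) * (wt h * Xi f)"
          by (rule mult_mono[OF k1 k2]) (use wt_nonneg[OF h] in auto)
        hence "real (card (A k)) ^ 2 * real k ^ 3 \<le> wt f ^ 2 * wt h ^ 2 * Xi f"
          by (simp add: power2_eq_square power3_eq_cube mult_ac)
        hence "442368 * (real (card (A k)) ^ 2 * real k ^ 3) / real t ^ 2 \<le> 442368 * (wt f ^ 2 * wt h ^ 2 * Xi f) / real t ^ 2"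
          by (intro divide_right_mono mult_left_mono) auto
        also have "\<dots> = V ^ 3" unfolding V_def by (subst real_root_pow_pos2) (auto simp: Xi_nonneg mult.assoc)
        finally show ?thesis using k by (simp add: power_divide field_simps)
      qed
      finally have "real (card (stepanov_points p t UV)) \<le> V * (1 / real k)"
        by (rule power_le_imp_le_base[of _ 2, simplified]) (use V0 in auto)
      moreover have "0 \<le> 1936 / real p * real (card (A k))" by simp
      ultimately show ?thesis using c by linarith
    qed
  qed
  have "(\<Sum>z\<in>F. h z * rho f z) = (\<Sum>k=1..p. real (card {X \<in> {2..<int p}. real k \<le> W f h X (1 - X)}))"
    unfolding triple_sum_eq by (rule sum_layers) (auto intro: W_Nats W_le_p)
  also have "\<dots> \<le> (\<Sum>k=1..p. V * (1 / real k) + 1936 / real p * real (card (A k)))"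
    by (intro sum_mono lev) auto
  also have "\<dots> = V * (\<Sum>k=1..p. 1 / real k) + 1936 / real p * (\<Sum>k=1..p. real (card (A k)))"
    by (simp add: sum.distrib sum_distrib_left)
  \<comment> \<open>In the linear alternative the level sets add up to the full first moment of
    W.\<close>
  also have "(\<Sum>k=1..p. real (card (A k))) = (\<Sum>ab\<in>U \<times> U. W f h (fst ab) (snd ab))"
    unfolding A_def by (rule sum_layers[symmetric]) (auto intro: W_Nats W_le_p)
  also have "V * (\<Sum>k=1..p. 1 / real k) + 1936 / real p * (\<Sum>ab\<in>U \<times> U. W f h (fst ab) (snd ab))
      \<le> V * L + 1936 / real p * (wt f ^ 2 * wt h)"
    unfolding L_def using sumU[of "W f h"] W_nonneg sum_W V0 p_gt_1
    by (intro add_mono mult_left_mono harmonic_le) auto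
  finally show ?thesis unfolding V_def .
qed

end

section \<open>Third moment of the difference counts of a level set\<close>

lemma rho_Nats: "chi f \<Longrightarrow> rho f z \<in> \<nat>"
  unfolding rho_def by (intro sum_in_Nats Nats_mult chiD(7))

lemma rho_le_p: assumes "chi f" shows "rho f z \<le> real p"
proof -
  have "rho f z \<le> (\<Sum>x\<in>F. 1)"
    unfolding rho_def by (intro sum_mono mult_le_one chiD(5,6)[OF assms])
  thus ?thesis by simp
qed

lemma per_rho: assumes "chi f" shows "per (rho f)"
  unfolding rho_def[abs_def] by (rule perI, (intro per_cong perD[OF chiD(1)[OF assms]] | assumption)+)

lemma rho_mult: assumes f: "chi f" and g: "\<gamma> g = 1" shows "rho f (g * z) = rho f z"
proof -
  have "rho f (g * z) = (\<Sum>x\<in>F. f (g * x) * f (g * x - g * z))" unfolding rho_def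
    by (rule sum_scale[symmetric, OF _ \<gamma>_not_dvd[OF g]]) (rule perI, (intro per_cong perD[OF chiD(1)[OF f]] | assumption)+)
  also have "\<dots> = (\<Sum>x\<in>F. f (g * x) * f (g * (x - z)))" by (simp add: right_diff_distrib)
  also have "\<dots> = rho f z" by (simp add: chiD(4)[OF f g] rho_def)
  finally show ?thesis .
qed

definition Rb :: "(int \<Rightarrow> real) \<Rightarrow> real" where
  "Rb f = 3 * (8 * 442368 * L ^ 3 * wt f ^ 2 * Xi f / real t ^ 2) * L + 3 * (3872 * wt f ^ 2 / real p) ^ 3 * real p"

text \<open>The set of z with rho >= k is again a union of cosets, so its indicator h may be
  inserted into \<open>triple_sum_le\<close>, whose left side is at least k * wt h. The cutoff 3872
  = 2 * 1936 makes the linear term at most half of that; the rest is solved for wt h.\<close>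

lemma sum_rho_cubed: assumes f: "chi f" shows "(\<Sum>z\<in>U. rho f z ^ 3) \<le> Rb f"
proof -
  have p0: "real p > 0" using p_gt_1 by simp
  have t0: "real t > 0" using t_pos by simp
  have "(\<Sum>z\<in>U. rho f z ^ 3) \<le> 3 * (8 * 442368 * L ^ 3 * wt f ^ 2 * Xi f / real t ^ 2) * (1 + ln (real p))
     + 3 * (3872 * wt f ^ 2 / real p) ^ 3 * real (card U)"
  proof (rule cube_sum_le)
    fix k :: nat assume k: "k \<ge> 1" "3872 * wt f ^ 2 / real p < real k"
    define h :: "int \<Rightarrow> real" where "h z = of_bool (\<not> int p dvd z \<and> real k \<le> rho f z)" for z
    have h: "chi h"
      unfolding chi_def
    proof (intro conjI allI impI)
      show "per h"
      proof (rule perI)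
        fix x y :: int assume "[x = y] (mod int p)"
        thus "h x = h y" unfolding h_def using perD[OF per_rho[OF f]] by (simp add: cong_dvd_iff)
      qed
      fix g x assume "\<gamma> g = 1"
      thus "h (g * x) = h x" unfolding h_def using \<gamma>_not_dvd by (simp add: rho_mult[OF f] dvd_mult_p)
    qed (auto simp: h_def)
    have "wt h = (\<Sum>z\<in>U. h z)" unfolding wt_def by (rule sum_F_eq_U) (simp add: h_def)
    also have "\<dots> = (\<Sum>z\<in>U. of_bool (real k \<le> rho f z))"
      by (rule sum.cong[OF refl]) (use U_iff in \<open>auto simp: h_def\<close>)
    also have "\<dots> = real (card {z \<in> U. real k \<le> rho f z})" by (rule sum_of_bool_card) simp
    finally have wth: "wt h = real (card {z \<in> U. real k \<le> rho f z})" .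
    define B where "B = 442368 * wt f ^ 2 * Xi f / real t ^ 2"
    have B0: "B \<ge> 0" unfolding B_def by (simp add: Xi_nonneg)
    have "real k * wt h = (\<Sum>z\<in>F. h z * real k)" by (simp add: wt_def sum_distrib_left mult.commute)
    also have "\<dots> \<le> (\<Sum>z\<in>F. h z * rho f z)" by (rule sum_mono) (auto simp: h_def)
    also have "\<dots> \<le> root 3 (442368 * wt f ^ 2 * wt h ^ 2 * Xi f / real t ^ 2) * L + 1936 / real p * (wt f ^ 2 * wt h)"
      by (rule triple_sum_le[OF f h])
    also have "1936 / real p * (wt f ^ 2 * wt h) = (3872 * wt f ^ 2 / real p) * wt h / 2" by simp
    also have "\<dots> \<le> real k * wt h / 2" using k(2) wt_nonneg[OF h] by (intro divide_right_mono mult_right_mono) auto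
    finally have "real k * wt h \<le> 2 * (root 3 (B * wt h ^ 2) * L)" unfolding B_def by (simp add: mult_ac)
    hence "(real k * wt h) ^ 3 \<le> (2 * (root 3 (B * wt h ^ 2) * L)) ^ 3"
      using wt_nonneg[OF h] by (intro power_mono) auto
    also have "\<dots> = 8 * (B * wt h ^ 2) * L ^ 3"
      using B0 by (simp add: power_mult_distrib real_root_pow_pos2)
    finally have *: "wt h ^ 2 * (wt h * real k ^ 3) \<le> wt h ^ 2 * (8 * B * L ^ 3)"
      by (simp add: power_mult_distrib power2_eq_square power3_eq_cube mult_ac)
    have "wt h * real k ^ 3 \<le> 8 * B * L ^ 3"
    proof (cases "wt h = 0")
      case True
      thus ?thesis using B0 L_ge_1 by simp
    next
      case False
      hence "wt h ^ 2 > 0" by simp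
      thus ?thesis using * by (subst (asm) mult_le_cancel_left_pos) auto
    qed
    thus "real (card {z \<in> U. real k \<le> rho f z}) * real k ^ 3 \<le> 8 * 442368 * L ^ 3 * wt f ^ 2 * Xi f / real t ^ 2"
      unfolding wth B_def by (simp add: mult_ac)
  qed (use p_gt_1 L_ge_1 Xi_nonneg rho_Nats[OF f] rho_le_p[OF f] in auto)
  also have "\<dots> \<le> Rb f" unfolding Rb_def L_def[symmetric] using p_gt_1
    by (intro add_mono order_refl mult_left_mono) auto
  finally show ?thesis .
qed

text \<open>The spectral inequality is applied with w = f; its eigenvalue is the mean of f r, at
  least \<Delta> wt f / t. On the right remains the sum of rho r^2. Its term at 0 is wt f * t^2;
  elsewhere, comparing rho with \<mu> r pointwise gives rho r^2 <= rho^3/\<mu>^2 + \<mu> r^3, which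
  reduces it to third moments.\<close>

lemma energy_level_inequality:
  assumes f: "chi f" and D: "\<Delta> > 0" and lev: "\<And>x. f x = 1 \<Longrightarrow> \<Delta> \<le> r x" and lam: "\<mu> > 0"
  shows "((\<Delta> * wt f / real t)\<^sup>2 * En / real t)\<^sup>2 \<le>
     (real t ^ 3 + E3b) * (wt f * real t ^ 2 + Rb f / \<mu>\<^sup>2 + \<mu> * E3b)"
proof -
  have t0: "real t > 0" using t_pos by simp
  define \<omega> where "\<omega> = (\<Sum>b\<in>F. \<gamma> b * f (1 - b))"
  note per = chiD(1)[OF f]
  have E0: "En \<ge> 0" unfolding En_def by (intro sum_nonneg) auto
  have om: "(\<Sum>b\<in>F. \<gamma> b * f (a - b)) = \<omega>" if "\<gamma> a = 1" for a
  proof -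
    have "(\<Sum>b\<in>F. \<gamma> b * f (a - b)) = (\<Sum>b\<in>F. \<gamma> (a * b) * f (a - a * b))"
      by (rule sum_scale[symmetric, OF _ \<gamma>_not_dvd[OF that]])
        (rule perI, (intro per_cong perD[OF per] | assumption)+)
    also have "\<dots> = (\<Sum>b\<in>F. \<gamma> b * f (a * (1 - b)))" by (simp add: \<gamma>_mult[OF that] right_diff_distrib)
    also have "\<dots> = \<omega>" unfolding \<omega>_def chiD(4)[OF f that] ..
    finally show ?thesis .
  qed
  have "real t * \<omega> = (\<Sum>a\<in>F. \<gamma> a * \<omega>)" by (simp add: sum_\<gamma> flip: sum_distrib_right)
  also have "\<dots> = (\<Sum>a\<in>F. \<gamma> a * (\<Sum>b\<in>F. \<gamma> b * f (a - b)))"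
  proof (rule sum.cong[OF refl])
    fix a show "\<gamma> a * \<omega> = \<gamma> a * (\<Sum>b\<in>F. \<gamma> b * f (a - b))" using \<gamma>_cases[of a] om[of a] by auto
  qed
  also have "\<dots> = (\<Sum>b\<in>F. \<Sum>a\<in>F. \<gamma> a * (\<gamma> b * f (a - b)))"
    by (simp only: sum_distrib_left) (rule sum.swap)
  also have "\<dots> = (\<Sum>b\<in>F. \<Sum>x\<in>F. \<gamma> (x + b) * (\<gamma> b * f (x + b - b)))"
    by (rule sum.cong[OF refl], rule sum_shift[symmetric])
      (rule perI, (intro per_cong perD[OF per] | assumption)+)
  also have "\<dots> = (\<Sum>x\<in>F. \<Sum>b\<in>F. f x * (\<gamma> b * \<gamma> (x + b)))"
    by (subst sum.swap) (simp add: mult_ac)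
  also have "\<dots> = (\<Sum>x\<in>F. f x * r x)" by (simp add: rt_def sum_distrib_left)
  finally have tom: "real t * \<omega> = (\<Sum>x\<in>F. f x * r x)" .
  have "\<Delta> * wt f = (\<Sum>x\<in>F. f x * \<Delta>)" by (simp add: wt_def sum_distrib_left mult.commute)
  also have "\<dots> \<le> (\<Sum>x\<in>F. f x * r x)"
  proof (rule sum_mono)
    fix x show "f x * \<Delta> \<le> f x * r x" using chiD(2)[OF f, of x] lev[of x] by auto
  qed
  finally have om_ge: "\<Delta> * wt f / real t \<le> \<omega>" using tom t0 by (simp add: field_simps)
  have "0 \<le> \<Delta> * wt f / real t" using D wt_nonneg[OF f] by simp
  hence "((\<Delta> * wt f / real t)\<^sup>2 * En / real t)\<^sup>2 \<le> (\<omega>\<^sup>2 * En / real t)\<^sup>2"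
    using om_ge E0 t0 by (intro power_mono divide_right_mono mult_right_mono) auto
  also have "\<dots> \<le> (\<Sum>z\<in>F. (r z) ^ 3) * (\<Sum>x\<in>F. \<Sum>y\<in>F. (f x)\<^sup>2 * (f y)\<^sup>2 * (r (y - x))\<^sup>2)"
    by (rule spectral_inequality[OF per chiD(4)[OF f] \<omega>_def])
  also have "\<dots> \<le> (real t ^ 3 + E3b) * (wt f * real t ^ 2 + Rb f / \<mu>\<^sup>2 + \<mu> * E3b)"
  proof (rule mult_mono)
    show "(\<Sum>z\<in>F. (r z) ^ 3) \<le> real t ^ 3 + E3b" unfolding F_split using sum_r_cubed by (simp add: r_0)
    have "(\<Sum>x\<in>F. \<Sum>y\<in>F. (f x)\<^sup>2 * (f y)\<^sup>2 * (r (y - x))\<^sup>2) = (\<Sum>x\<in>F. \<Sum>y\<in>F. f x * f y * (r (y - x))\<^sup>2)"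
      by (simp add: power2_eq_square[of "f _"] chiD(8)[OF f])
    also have "\<dots> = (\<Sum>x\<in>F. \<Sum>z\<in>F. f x * f (z + x) * (r (z + x - x))\<^sup>2)"
      unfolding power2_eq_square
      by (rule sum.cong[OF refl], rule sum_shift[symmetric])
        (rule perI, (intro per_cong perD[OF per] perD[OF per_rt] | assumption)+)
    also have "\<dots> = (\<Sum>z\<in>F. (\<Sum>x\<in>F. f x * f (z + x)) * (r z)\<^sup>2)"
      by (subst sum.swap) (simp add: sum_distrib_right)
    also have "\<dots> = (\<Sum>z\<in>F. rho f z * (r z)\<^sup>2)"
    proof (rule sum.cong[OF refl])
      fix z
      have "rho f z = (\<Sum>x\<in>F. f (x + z) * f (x + z - z))" unfolding rho_def
        by (rule sum_shift[symmetric]) (rule perI, (intro per_cong perD[OF per] | assumption)+)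
      thus "(\<Sum>x\<in>F. f x * f (z + x)) * (r z)\<^sup>2 = rho f z * (r z)\<^sup>2" by (simp add: mult_ac add.commute)
    qed
    also have "\<dots> = rho f 0 * (r 0)\<^sup>2 + (\<Sum>z\<in>U. rho f z * (r z)\<^sup>2)" unfolding F_split by simp
    also have "rho f 0 * (r 0)\<^sup>2 = wt f * real t ^ 2"
      by (simp add: r_0 rho_def wt_def chiD(8)[OF f])
    also have "(\<Sum>z\<in>U. rho f z * (r z)\<^sup>2) \<le> (\<Sum>z\<in>U. rho f z ^ 3 / \<mu>\<^sup>2 + \<mu> * r z ^ 3)"
    proof (rule sum_mono)
      fix z
      have rh: "rho f z \<ge> 0" using rho_Nats[OF f, of z] by (auto elim: Nats_cases)
      show "rho f z * (r z)\<^sup>2 \<le> rho f z ^ 3 / \<mu>\<^sup>2 + \<mu> * r z ^ 3"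
      proof (cases "rho f z \<le> \<mu> * r z")
        case True
        have "rho f z * (r z)\<^sup>2 \<le> (\<mu> * r z) * (r z)\<^sup>2" using True by (intro mult_right_mono) auto
        also have "\<dots> = \<mu> * r z ^ 3" by (simp add: power2_eq_square power3_eq_cube)
        finally show ?thesis using rh by (simp add: add_increasing)
      next
        case False
        hence "r z \<le> rho f z / \<mu>" using lam by (simp add: field_simps)
        hence "(r z)\<^sup>2 \<le> (rho f z / \<mu>)\<^sup>2" by (intro power_mono) auto
        hence "rho f z * (r z)\<^sup>2 \<le> rho f z * (rho f z / \<mu>)\<^sup>2" using rh by (intro mult_left_mono)
        also have "\<dots> = rho f z ^ 3 / \<mu>\<^sup>2" by (simp add: power_divide power2_eq_square power3_eq_cube)
        finally show ?thesis using lam by (simp add: add_increasing2)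
      qed
    qed
    also have "\<dots> = (\<Sum>z\<in>U. rho f z ^ 3) / \<mu>\<^sup>2 + \<mu> * (\<Sum>z\<in>U. r z ^ 3)"
      by (simp add: sum.distrib sum_distrib_left sum_divide_distrib)
    also have "\<dots> \<le> Rb f / \<mu>\<^sup>2 + \<mu> * E3b"
      using lam by (intro add_mono divide_right_mono mult_left_mono sum_rho_cubed[OF f] sum_r_cubed) auto
    finally show "(\<Sum>x\<in>F. \<Sum>y\<in>F. (f x)\<^sup>2 * (f y)\<^sup>2 * (r (y - x))\<^sup>2) \<le> wt f * real t ^ 2 + Rb f / \<mu>\<^sup>2 + \<mu> * E3b"
      by simp
  next
    have "0 \<le> (\<Sum>z\<in>U. r z ^ 3)" by (intro sum_nonneg) auto
    thus "0 \<le> real t ^ 3 + E3b" using sum_r_cubed zero_le_power[of "real t" 3] by linarith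
  qed (intro sum_nonneg, auto)
  finally show ?thesis .
qed

end

section \<open>Exponential sums\<close>

text \<open>A weak form of Jordan's inequality. Up to 1 it follows from the Taylor polynomial;
  beyond 1, sin x >= sin 1 >= 5/6 suffices because x < 2.\<close>

lemma two_fifths_le_sin:
  fixes x :: real
  assumes "0 \<le> x" "x \<le> pi / 2" shows "2 / 5 * x \<le> sin x"
proof -
  have small: "5 / 6 * y \<le> sin y" if "0 \<le> y" "y \<le> 1" for y :: real
  proof -
    have "\<bar>sin y - (\<Sum>m<3. sin_coeff m * y ^ m)\<bar> \<le> inverse (fact 3) * \<bar>y\<bar> ^ 3"
      by (rule Maclaurin_sin_bound)
    hence "\<bar>sin y - y\<bar> \<le> y ^ 3 / 6"
      using that by (simp add: eval_nat_numeral sin_coeff_def)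
    moreover have "y ^ 3 \<le> y ^ 1" using that by (intro power_decreasing) auto
    ultimately show ?thesis unfolding power_one_right by linarith
  qed
  show ?thesis
  proof (cases "x \<le> 1")
    case True
    thus ?thesis using small[of x] assms by simp
  next
    case False
    have "5 / 6 \<le> sin (1::real)" using small[of 1] by simp
    also have "\<dots> \<le> sin x" using False assms by (intro sin_monotone_2pi_le) auto
    finally show ?thesis using assms pi_less_4 pi_half_less_two by linarith
  qed
qed

context mult_subgroup
begin

section \<open>Additive characters and moments of subgroup sums\<close>

definition e :: "int \<Rightarrow> complex" where "e x = cis (2 * pi * real_of_int x / real p)"

lemma e_add: "e (x + y) = e x * e y"
  unfolding e_def by (simp add: cis_mult add_divide_distrib distrib_left)

lemma e_0 [simp]: "e 0 = 1" by (simp add: e_def)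
lemma norm_e [simp]: "norm (e x) = 1" by (simp add: e_def)
lemma cnj_e: "cnj (e x) = e (- x)" by (simp add: e_def cis_cnj)

lemma e_eq_1_iff: "e x = 1 \<longleftrightarrow> int p dvd x"
proof
  have p0: "real p > 0" using p_gt_1 by simp
  assume "e x = 1"
  hence "cos (2 * pi * real_of_int x / real p) = 1" by (simp add: e_def complex_eq_iff)
  then obtain n :: int where "2 * pi * real_of_int x / real p = of_int n * 2 * pi"
    using cos_one_2pi_int by blast
  hence "real_of_int x = real_of_int n * real p" using p0 by (simp add: field_simps)
  hence "real_of_int x = real_of_int (n * int p)" by simp
  hence "x = n * int p" unfolding of_int_eq_iff .
  thus "int p dvd x" by simp
next
  have p0: "real p > 0" using p_gt_1 by simp
  assume "int p dvd x"
  then obtain k where "x = int p * k" by blast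
  hence "2 * pi * real_of_int x / real p = 2 * pi * real_of_int k" using p0 by simp
  thus "e x = 1" unfolding e_def by (simp only: cis_multiple_2pi Ints_of_int)
qed

lemma per_e: "per e"
proof (rule perI)
  fix x y :: int assume "[x = y] (mod int p)"
  hence "e (x - y) = 1" by (simp add: e_eq_1_iff cong_iff_dvd_diff)
  thus "e x = e y" using e_add[of "x - y" y] by simp
qed

lemma sum_e: "(\<Sum>c\<in>F. e (c * x)) = (if int p dvd x then of_nat p else 0)"
proof (cases "int p dvd x")
  case True
  hence "e (c * x) = 1" for c by (simp add: e_eq_1_iff)
  thus ?thesis using True by simp
next
  case False
  have "(\<Sum>c\<in>F. e (c * x)) = (\<Sum>c\<in>F. e ((c + 1) * x))"
    by (rule sum_shift[symmetric]) (rule perI, rule perD[OF per_e], intro cong_mult cong_refl)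
  also have "\<dots> = (\<Sum>c\<in>F. e (c * x)) * e x"
    by (simp add: distrib_right e_add sum_distrib_right)
  finally have "(\<Sum>c\<in>F. e (c * x)) * (1 - e x) = 0" by (simp add: right_diff_distrib)
  thus ?thesis using False e_eq_1_iff[of x] by simp
qed

lemma parseval:
  fixes w :: "int \<Rightarrow> real"
  shows "(\<Sum>x\<in>F. (norm (\<Sum>z\<in>F. of_real (w z) * e (x * z)))\<^sup>2) = real p * (\<Sum>z\<in>F. (w z)\<^sup>2)"
proof -
  have "complex_of_real (\<Sum>x\<in>F. (norm (\<Sum>z\<in>F. of_real (w z) * e (x * z)))\<^sup>2) =
     (\<Sum>x\<in>F. \<Sum>z\<in>F. \<Sum>z'\<in>F. of_real (w z * w z') * e (x * (z - z')))"
    unfolding of_real_sum complex_norm_square cnj_sum sum_product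
  proof (intro sum.cong refl)
    fix x z z'
    have "e (x * (z - z')) = e (x * z) * e (- (x * z'))" by (simp add: right_diff_distrib flip: e_add)
    thus "complex_of_real (w z) * e (x * z) * cnj (complex_of_real (w z') * e (x * z')) =
       complex_of_real (w z * w z') * e (x * (z - z'))" by (simp add: cnj_e)
  qed
  also have "\<dots> = (\<Sum>z\<in>F. \<Sum>z'\<in>F. \<Sum>x\<in>F. of_real (w z * w z') * e (x * (z - z')))"
    by (subst sum.swap, rule sum.cong[OF refl], rule sum.swap)
  also have "\<dots> = (\<Sum>z\<in>F. \<Sum>z'\<in>F. of_real (w z * w z') * (if z = z' then of_nat p else 0))"
  proof (intro sum.cong refl)
    fix z z' assume "z \<in> F" "z' \<in> F"
    hence "int p dvd z - z' \<longleftrightarrow> z = z'" using F_eq_iff[of z z'] by (simp add: cong_iff_dvd_diff)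
    thus "(\<Sum>x\<in>F. of_real (w z * w z') * e (x * (z - z'))) = of_real (w z * w z') * (if z = z' then of_nat p else 0)"
      by (simp only: sum_distrib_left[symmetric] sum_e)
  qed
  also have "\<dots> = (\<Sum>z\<in>F. of_real (w z * w z) * of_nat p)"
    by (rule sum.cong[OF refl]) (simp add: if_distrib[of "\<lambda>x. _ * x"] cong: if_cong)
  also have "\<dots> = complex_of_real (real p * (\<Sum>z\<in>F. (w z)\<^sup>2))"
    by (simp add: sum_distrib_left power2_eq_square mult.commute)
  finally show ?thesis unfolding of_real_eq_iff .
qed

definition S :: "int \<Rightarrow> complex" where "S c = (\<Sum>g\<in>F. of_real (\<gamma> g) * e (c * g))"

lemma per_S: "per S"
  unfolding S_def[abs_def] by (rule perI, (intro per_cong perD[OF per_e] | assumption)+)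

lemma norm_S_le: "norm (S c) \<le> real t"
proof -
  have "norm (S c) \<le> (\<Sum>g\<in>F. norm (of_real (\<gamma> g) * e (c * g)))" unfolding S_def by (rule norm_sum)
  also have "\<dots> = (\<Sum>g\<in>F. \<gamma> g)" by (simp add: norm_mult)
  finally show ?thesis by (simp add: sum_\<gamma>)
qed

lemma S_mult: assumes "\<gamma> g = 1" shows "S (c * g) = S c"
proof -
  have "S c = (\<Sum>x\<in>F. of_real (\<gamma> (g * x)) * e (c * (g * x)))" unfolding S_def
    by (rule sum_scale[symmetric, OF _ \<gamma>_not_dvd[OF assms]])
      (rule perI, (intro per_cong arg_cong[where f = complex_of_real] perD[OF per_e] | assumption)+)
  thus ?thesis by (simp add: S_def \<gamma>_mult[OF assms] mult.assoc)
qed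

lemma norm_S_minus: "norm (S (- c)) = norm (S c)"
proof -
  have "cnj (S c) = S (- c)" unfolding S_def by (simp add: cnj_sum cnj_e)
  thus ?thesis by (metis complex_mod_cnj)
qed

lemma S_abs_squared: "complex_of_real ((norm (S x))\<^sup>2) = (\<Sum>z\<in>F. of_real (r z) * e (x * z))"
proof -
  have "complex_of_real ((norm (S x))\<^sup>2) = (\<Sum>a\<in>F. \<Sum>b\<in>F. of_real (\<gamma> a * \<gamma> b) * e (x * (a - b)))"
    unfolding complex_norm_square S_def cnj_sum sum_product
  proof (intro sum.cong refl)
    fix a b
    have "e (x * (a - b)) = e (x * a) * e (- (x * b))" by (simp add: right_diff_distrib flip: e_add)
    thus "complex_of_real (\<gamma> a) * e (x * a) * cnj (complex_of_real (\<gamma> b) * e (x * b)) =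
       complex_of_real (\<gamma> a * \<gamma> b) * e (x * (a - b))" by (simp add: cnj_e)
  qed
  also have "\<dots> = (\<Sum>b\<in>F. \<Sum>a\<in>F. of_real (\<gamma> a * \<gamma> b) * e (x * (a - b)))" by (rule sum.swap)
  also have "\<dots> = (\<Sum>b\<in>F. \<Sum>z\<in>F. of_real (\<gamma> (z + b) * \<gamma> b) * e (x * (z + b - b)))"
    by (rule sum.cong[OF refl], rule sum_shift[symmetric])
      (rule perI, (intro per_cong arg_cong[where f = complex_of_real] perD[OF per_e] | assumption)+)
  also have "\<dots> = (\<Sum>z\<in>F. \<Sum>b\<in>F. of_real (\<gamma> b * \<gamma> (z + b)) * e (x * z))"
    by (subst sum.swap) (simp add: mult.commute)
  also have "\<dots> = (\<Sum>z\<in>F. of_real (r z) * e (x * z))"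
    by (simp add: rt_def sum_distrib_right)
  finally show ?thesis .
qed

lemma sum_S_squared: "(\<Sum>x\<in>F. (norm (S x))\<^sup>2) = real p * real t"
  using parseval[of \<gamma>] unfolding S_def by (simp add: power2_eq_square[of "\<gamma> _"] sum_\<gamma>)

lemma sum_S_fourth: "(\<Sum>x\<in>F. (norm (S x)) ^ 4) = real p * En"
proof -
  have "(norm (S x)) ^ 4 = (norm (\<Sum>z\<in>F. of_real (r z) * e (x * z)))\<^sup>2" for x
  proof -
    have "norm (\<Sum>z\<in>F. of_real (r z) * e (x * z)) = (norm (S x))\<^sup>2"
      unfolding S_abs_squared[symmetric] norm_of_real by simp
    thus ?thesis by (simp flip: power_mult)
  qed
  thus ?thesis using parseval[of r] by (simp add: En_def)
qed

text \<open>The substitution y = xg turns an average over the coset of x into a sum over all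
  residues, weighted by the indicator of that coset.\<close>

lemma coset_average:
  assumes k: "per k" and x: "\<not> int p dvd x" and d: "[x * d = 1] (mod int p)"
  shows "(\<Sum>g\<in>F. \<gamma> g * k (x * g)) = (\<Sum>y\<in>F. \<gamma> (d * y) * (k y :: real))"
proof -
  have "(\<Sum>y\<in>F. \<gamma> (d * y) * k y) = (\<Sum>g\<in>F. \<gamma> (d * (x * g)) * k (x * g))"
    by (rule sum_scale[symmetric, OF _ x]) (rule perI, (intro per_cong perD[OF k] | assumption)+)
  also have "\<dots> = (\<Sum>g\<in>F. \<gamma> g * k (x * g))"
  proof (intro sum.cong refl arg_cong2[where f = "(*)"] perD[OF per_\<gamma>])
    fix g
    have "[(x * d) * g = 1 * g] (mod int p)" by (intro cong_mult cong_refl d)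
    thus "[d * (x * g) = g] (mod int p)" by (simp add: mult_ac)
  qed
  finally show ?thesis by simp
qed

text \<open>S is constant on the coset of x, so its squared modulus there occurs t times in the
  total pt given by Parseval.\<close>

lemma norm_S_le_sqrt: assumes "\<not> int p dvd x" shows "norm (S x) \<le> sqrt (real p)"
proof -
  obtain d where d: "d \<in> U" "[x * d = 1] (mod int p)" using inverse_exists[OF assms] .
  have perk: "per (\<lambda>y. (norm (S y))\<^sup>2)"
    by (rule perI, rule arg_cong[where f = "\<lambda>z. (norm z)\<^sup>2"], rule perD[OF per_S])
  have "real t * (norm (S x))\<^sup>2 = (\<Sum>g\<in>F. \<gamma> g * (norm (S x))\<^sup>2)" by (simp add: sum_\<gamma> flip: sum_distrib_right)
  also have "\<dots> = (\<Sum>g\<in>F. \<gamma> g * (norm (S (x * g)))\<^sup>2)"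
  proof (rule sum.cong[OF refl])
    fix g show "\<gamma> g * (norm (S x))\<^sup>2 = \<gamma> g * (norm (S (x * g)))\<^sup>2" using \<gamma>_cases[of g] S_mult[of g x] by auto
  qed
  also have "\<dots> = (\<Sum>y\<in>F. \<gamma> (d * y) * (norm (S y))\<^sup>2)" by (rule coset_average[OF perk assms d(2)])
  also have "\<dots> \<le> (\<Sum>y\<in>F. (norm (S y))\<^sup>2)" by (intro sum_mono mult_left_le_one_le) auto
  also have "\<dots> = real t * real p" by (simp add: sum_S_squared)
  finally have "(norm (S x))\<^sup>2 \<le> real p" using t_pos by (subst (asm) mult_le_cancel_left_pos) auto
  thus ?thesis by (simp add: real_le_rsqrt)
qed

definition Nr :: "nat \<Rightarrow> nat" where
  "Nr h = card {i \<in> {1..int h} \<times> {1..int h}. [fst i ^ t = snd i ^ t] (mod int p)}"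

text \<open>Averaging over cosets replaces the frequencies up to \<open>h\<close> by all residues, weighted by the number
  of frequencies in their coset.\<close>

lemma short_sum_fourth_power:
  assumes a: "a \<in> U" and h: "h < p"
  shows "(\<Sum>c\<in>{1..int h}. norm (S (a * c))) ^ 4 * real t \<le> real h ^ 2 * (real (Nr h) * (real p * En))"
proof -
  define I where "I = {1..int h}"
  have IU: "c \<in> U" if "c \<in> I" for c using that h by (auto simp: I_def)
  have nd: "\<not> int p dvd c" if "c \<in> I" for c using IU[OF that] U_iff by blast
  have and': "\<not> int p dvd a" using a U_iff by blast
  have "\<exists>d. [c * d = 1] (mod int p)" if "c \<in> I" for c using inverse_exists[OF nd[OF that]] by metis
  then obtain d where d: "\<And>c. c \<in> I \<Longrightarrow> [c * d c = 1] (mod int p)" by metis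
  define k where "k y = (norm (S (a * y)))\<^sup>2" for y
  have perk: "per k" unfolding k_def
    by (rule perI, rule arg_cong[where f = "\<lambda>z. (norm z)\<^sup>2"], rule perD[OF per_S], intro cong_mult cong_refl)
  \<comment> \<open>The number of frequencies c whose coset contains y.\<close>
  define n where "n y = (\<Sum>c\<in>I. \<gamma> (d c * y))" for y
  define A1 A2 where "A1 = (\<Sum>c\<in>I. norm (S (a * c)))" and "A2 = (\<Sum>c\<in>I. k c)"
  have t0: "real t > 0" using t_pos by simp
  have fin: "finite I" by (simp add: I_def)
  have "A1\<^sup>2 \<le> (\<Sum>c\<in>I. 1\<^sup>2) * (\<Sum>c\<in>I. (norm (S (a * c)))\<^sup>2)"
    unfolding A1_def using Cauchy_Schwarz_ineq_sum[of "\<lambda>c. 1" "\<lambda>c. norm (S (a * c))" I] by simp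
  hence A12: "A1\<^sup>2 \<le> real h * A2" by (simp add: A2_def k_def I_def)
  have "real t * A2 = (\<Sum>c\<in>I. \<Sum>g\<in>F. \<gamma> g * k c)" by (simp add: A2_def sum_\<gamma> sum_distrib_left flip: sum_distrib_right)
  also have "\<dots> = (\<Sum>c\<in>I. \<Sum>g\<in>F. \<gamma> g * k (c * g))"
  proof (intro sum.cong refl)
    fix c g show "\<gamma> g * k c = \<gamma> g * k (c * g)" using \<gamma>_cases[of g] S_mult[of g "a * c"] by (auto simp: k_def mult.assoc)
  qed
  also have "\<dots> = (\<Sum>c\<in>I. \<Sum>y\<in>F. \<gamma> (d c * y) * k y)"
    by (rule sum.cong[OF refl], rule coset_average[OF perk]) (use nd d in auto)
  also have "\<dots> = (\<Sum>y\<in>F. n y * k y)" by (subst sum.swap) (simp add: n_def sum_distrib_right)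
  finally have "(real t * A2)\<^sup>2 = (\<Sum>y\<in>F. n y * k y)\<^sup>2" by simp
  also have "\<dots> \<le> (\<Sum>y\<in>F. (n y)\<^sup>2) * (\<Sum>y\<in>F. (k y)\<^sup>2)" by (rule Cauchy_Schwarz_ineq_sum)
  also have "(\<Sum>y\<in>F. (k y)\<^sup>2) = real p * En"
  proof -
    have "(\<Sum>y\<in>F. (k y)\<^sup>2) = (\<Sum>y\<in>F. (norm (S (a * y))) ^ 4)" by (simp add: k_def flip: power_mult)
    also have "\<dots> = (\<Sum>y\<in>F. (norm (S y)) ^ 4)"
      by (rule sum_scale[OF _ and']) (rule perI, rule arg_cong[where f = "\<lambda>z. (norm z) ^ 4"], rule perD[OF per_S])
    finally show ?thesis by (simp add: sum_S_fourth)
  qed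
  \<comment> \<open>Two frequencies share t residues y if they lie in the same coset, that is, if
    their t-th powers agree, and none otherwise.\<close>
  also have "(\<Sum>y\<in>F. (n y)\<^sup>2) = real t * real (Nr h)"
  proof -
    have "(\<Sum>y\<in>F. (n y)\<^sup>2) = (\<Sum>y\<in>F. \<Sum>c\<in>I. \<Sum>c'\<in>I. \<gamma> (d c * y) * \<gamma> (d c' * y))"
      unfolding n_def power2_eq_square sum_product ..
    also have "\<dots> = (\<Sum>c\<in>I. \<Sum>c'\<in>I. \<Sum>y\<in>F. \<gamma> (d c * y) * \<gamma> (d c' * y))"
      by (subst sum.swap, rule sum.cong[OF refl], rule sum.swap)
    also have "\<dots> = (\<Sum>c\<in>I. \<Sum>c'\<in>I. real t * of_bool ([c ^ t = c' ^ t] (mod int p)))"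
    proof (intro sum.cong refl)
      fix c c' assume c: "c \<in> I" "c' \<in> I"
      have "(\<Sum>y\<in>F. \<gamma> (d c * y) * \<gamma> (d c' * y)) = (\<Sum>g\<in>F. \<gamma> g * \<gamma> (d c' * (c * g)))"
        by (rule coset_average[symmetric, OF _ nd[OF c(1)] d[OF c(1)]])
          (rule perI, (intro per_cong | assumption)+)
      also have "\<dots> = (\<Sum>g\<in>F. \<gamma> g * \<gamma> (d c' * c))"
      proof (rule sum.cong[OF refl])
        fix g show "\<gamma> g * \<gamma> (d c' * (c * g)) = \<gamma> g * \<gamma> (d c' * c)"
          using \<gamma>_cases[of g] \<gamma>_mult'[of g "d c' * c"] by (auto simp: mult.assoc)
      qed
      also have "\<dots> = real t * \<gamma> (d c' * c)" by (simp add: sum_\<gamma> flip: sum_distrib_right)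
      also have "\<gamma> (d c' * c) = of_bool ([c ^ t = c' ^ t] (mod int p))"
      proof -
        have dt: "[c' ^ t * d c' ^ t = 1] (mod int p)" using cong_pow[OF d[OF c(2)], of t] by (simp add: power_mult_distrib)
        have ndd: "\<not> int p dvd d c' ^ t"
        proof
          assume "int p dvd d c' ^ t"
          hence "[c' ^ t * d c' ^ t = 0] (mod int p)" by (simp add: cong_0_iff)
          hence "[1 = 0] (mod int p)" using dt cong_sym cong_trans by blast
          thus False using p_gt_1 by (simp add: cong_0_iff)
        qed
        have "[(d c' * c) ^ t = 1] (mod int p) \<longleftrightarrow> [d c' ^ t * c ^ t = d c' ^ t * c' ^ t] (mod int p)"
          using dt by (simp add: unique_euclidean_semiring_class.cong_def power_mult_distrib mult.commute)
        also have "\<dots> \<longleftrightarrow> int p dvd d c' ^ t * (c ^ t - c' ^ t)" by (simp add: cong_iff_dvd_diff right_diff_distrib)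
        also have "\<dots> \<longleftrightarrow> [c ^ t = c' ^ t] (mod int p)" using ndd by (simp add: dvd_mult_p cong_iff_dvd_diff)
        finally show ?thesis by (simp add: \<gamma>_def)
      qed
      finally show "(\<Sum>y\<in>F. \<gamma> (d c * y) * \<gamma> (d c' * y)) = real t * of_bool ([c ^ t = c' ^ t] (mod int p))" .
    qed
    also have "\<dots> = real t * (\<Sum>i\<in>I \<times> I. of_bool ([fst i ^ t = snd i ^ t] (mod int p)))"
      by (simp add: sum.cartesian_product split_def sum_distrib_left)
    also have "(\<Sum>i\<in>I \<times> I. of_bool ([fst i ^ t = snd i ^ t] (mod int p))) = real (Nr h)"
      unfolding Nr_def I_def[symmetric] by (rule sum_of_bool_card) (simp add: fin)
    finally show ?thesis .
  qed
  finally have "real t * (real t * A2\<^sup>2) \<le> real t * (real (Nr h) * (real p * En))"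
    by (simp add: power_mult_distrib power2_eq_square mult_ac)
  hence A2: "real t * A2\<^sup>2 \<le> real (Nr h) * (real p * En)" using t0 by (subst (asm) mult_le_cancel_left_pos) auto
  have "A1 ^ 4 * real t = (A1\<^sup>2)\<^sup>2 * real t" by (simp flip: power_mult)
  also have "\<dots> \<le> (real h * A2)\<^sup>2 * real t" using A12 by (intro mult_right_mono power_mono) auto
  also have "\<dots> = real h ^ 2 * (real t * A2\<^sup>2)" by (simp add: power_mult_distrib)
  also have "\<dots> \<le> real h ^ 2 * (real (Nr h) * (real p * En))" using A2 by (intro mult_left_mono) auto
  finally show ?thesis unfolding A1_def I_def .
qed

text \<open>A Dirichlet kernel of the interval [1, M]. The coefficients of its k-th power count
  representations as a sum of k elements of the interval, hence live on [k, kM].\<close>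

definition Dk :: "nat \<Rightarrow> int \<Rightarrow> complex" where "Dk M c = (\<Sum>j=1..int M. e (- (c * j)))"

lemma norm_Dk_le: "norm (Dk M c) \<le> real M"
proof -
  have "norm (Dk M c) \<le> (\<Sum>j=1..int M. norm (e (- (c * j))))" unfolding Dk_def by (rule norm_sum)
  thus ?thesis by simp
qed

text \<open>Multiplying the geometric sum by e(-c) - 1 leaves two terms. The modulus of that factor
  is 2 sin(\<pi>c/p), at least h/p when c is at distance at least h from 0 modulo p; for c/p > 1/2
  the sine is reflected.\<close>

lemma norm_Dk_le':
  assumes c: "h < c" "c < int p - h" and h: "h > 0"
  shows "norm (Dk M c) \<le> 2 * real p / real_of_int h"
proof -
  have p0: "real p > 0" using p_gt_1 by simp
  define x where "x = pi * real_of_int c / real p"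
  have "e (- c) * Dk M c = (\<Sum>j=1..int M. e (- (c * (j + 1))))"
  proof -
    have "e (- c) * e (- (c * j)) = e (- (c * (j + 1)))" for j
      unfolding e_add[symmetric] by (simp add: algebra_simps)
    thus ?thesis unfolding Dk_def sum_distrib_left by simp
  qed
  also have "\<dots> = (\<Sum>j=2..int M + 1. e (- (c * j)))"
    by (rule sum.reindex_bij_witness[of _ "\<lambda>j. j - 1" "\<lambda>j. j + 1"]) auto
  finally have 1: "e (- c) * Dk M c = (\<Sum>j=2..int M + 1. e (- (c * j)))" .
  have "(e (- c) - 1) * Dk M c = e (- (c * (int M + 1))) - e (- c)"
  proof (cases "M = 0")
    case True
    thus ?thesis by (simp add: Dk_def)
  next
    case False
    have "{2..int M + 1} = insert (int M + 1) {2..int M}" "{1..int M} = insert 1 {2..int M}" using False by auto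
    hence "(\<Sum>j=2..int M + 1. e (- (c * j))) = e (- (c * (int M + 1))) + (\<Sum>j=2..int M. e (- (c * j)))"
      "Dk M c = e (- c) + (\<Sum>j=2..int M. e (- (c * j)))"
      unfolding Dk_def by simp_all
    thus ?thesis using 1 by (simp add: left_diff_distrib)
  qed
  hence "norm (e (- c) - 1) * norm (Dk M c) = norm (e (- (c * (int M + 1))) - e (- c))"
    by (metis norm_mult)
  also have "\<dots> \<le> 2" using norm_triangle_ineq4[of "e (- (c * (int M + 1)))" "e (- c)"] by simp
  finally have le2: "norm (e (- c) - 1) * norm (Dk M c) \<le> 2" .
  have xr: "0 \<le> x" "x \<le> pi" using c h p0 unfolding x_def by (auto simp: field_simps)
  have "(norm (e (- c) - 1))\<^sup>2 = (2 * sin x)\<^sup>2"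
  proof -
    have "e (- c) = cis (- (2 * x))" by (simp add: e_def x_def mult.assoc)
    hence "(norm (e (- c) - 1))\<^sup>2 = (cos (2 * x) - 1)\<^sup>2 + (sin (2 * x))\<^sup>2" by (simp add: cmod_def)
    also have "\<dots> = 2 - 2 * cos (2 * x)" using sin_cos_squared_add[of "2 * x"] by (simp add: power2_eq_square algebra_simps)
    also have "\<dots> = (2 * sin x)\<^sup>2" by (simp add: cos_double_sin power2_eq_square)
    finally show ?thesis .
  qed
  hence n: "norm (e (- c) - 1) = 2 * sin x" by (rule power2_eq_imp_eq) (use sin_ge_zero[OF xr] in auto)
  have "real_of_int h / real p / 2 \<le> sin x"
  proof -
    have aux: "real_of_int h / real p / 2 \<le> sin (pi * y)" if "real_of_int h / real p \<le> y" "y \<le> 1 / 2" for y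
    proof -
      have "0 \<le> real_of_int h / real p" using h by simp
      hence y0: "0 \<le> y" using that by linarith
      have "real_of_int h / real p / 2 \<le> y / 2" using that(1) by (rule divide_right_mono) simp
      also have "y / 2 \<le> 2 / 5 * (pi * y)" using y0 mult_right_mono[OF pi_ge_two y0] by simp
      also have "\<dots> \<le> sin (pi * y)" using y0 that(2) by (intro two_fifths_le_sin) (auto simp: field_simps)
      finally show ?thesis .
    qed
    show ?thesis
    proof (cases "real_of_int c / real p \<le> 1 / 2")
      case True
      have "real_of_int h / real p \<le> real_of_int c / real p" using c p0 by (simp add: divide_right_mono)
      from aux[OF this True] show ?thesis by (simp add: x_def)
    next
      case False
      have "real_of_int h \<le> real p - real_of_int c" using c by linarith
      hence "real_of_int h / real p \<le> (real p - real_of_int c) / real p" using p0 by (intro divide_right_mono) auto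
      also have "\<dots> = 1 - real_of_int c / real p" using p0 by (simp add: field_simps)
      finally have "real_of_int h / real p / 2 \<le> sin (pi * (1 - real_of_int c / real p))" using False by (intro aux) auto
      also have "pi * (1 - real_of_int c / real p) = pi - x" by (simp add: x_def right_diff_distrib)
      finally show ?thesis by (simp add: sin_pi_minus)
    qed
  qed
  hence "2 * (real_of_int h / real p / 2) * norm (Dk M c) \<le> 2 * sin x * norm (Dk M c)" by (intro mult_right_mono) auto
  hence "2 * (real_of_int h / real p / 2) * norm (Dk M c) \<le> 2" using le2 n by simp
  thus ?thesis using h p0 by (simp add: field_simps)
qed

text \<open>Expanding one kernel factor at a time moves a shift j from [1, M] into v. After k steps
  orthogonality counts the g with v + s = ag for a total shift s between k and kM, and there are
  none.\<close>

lemma kernel_vanishes: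
  assumes gap: "\<And>s g. int k \<le> s \<Longrightarrow> s \<le> int (k * M) \<Longrightarrow> \<gamma> g = 1 \<Longrightarrow> \<not> [v + s = a * g] (mod int p)"
  shows "(\<Sum>c\<in>F. S (a * c) * e (- (c * v)) * Dk M c ^ k) = 0"
  using gap
proof (induction k arbitrary: v)
  case 0
  have "(\<Sum>c\<in>F. S (a * c) * e (- (c * v)) * Dk M c ^ 0) = (\<Sum>c\<in>F. \<Sum>g\<in>F. of_real (\<gamma> g) * e (c * (a * g - v)))"
    unfolding S_def sum_distrib_right
  proof (intro sum.cong refl)
    fix c g
    have "e (c * (a * g - v)) = e (a * c * g) * e (- (c * v))" by (simp add: right_diff_distrib mult_ac flip: e_add)
    thus "of_real (\<gamma> g) * e (a * c * g) * e (- (c * v)) * Dk M c ^ 0 = of_real (\<gamma> g) * e (c * (a * g - v))" by simp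
  qed
  also have "\<dots> = (\<Sum>g\<in>F. of_real (\<gamma> g) * (\<Sum>c\<in>F. e (c * (a * g - v))))"
    by (subst sum.swap) (simp add: sum_distrib_left)
  also have "\<dots> = 0"
  proof (rule sum.neutral, rule ballI)
    fix g
    show "of_real (\<gamma> g) * (\<Sum>c\<in>F. e (c * (a * g - v))) = 0"
    proof (cases "\<gamma> g = 1")
      case True
      have "\<not> [v = a * g] (mod int p)" using 0[of 0 g] True by simp
      hence "\<not> int p dvd a * g - v" by (simp add: cong_iff_dvd_diff dvd_diff_commute)
      thus ?thesis by (simp add: sum_e)
    next
      case False
      thus ?thesis using \<gamma>_cases[of g] by simp
    qed
  qed
  finally show ?case .
next
  case (Suc k)
  have "(\<Sum>c\<in>F. S (a * c) * e (- (c * v)) * Dk M c ^ Suc k) =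
     (\<Sum>c\<in>F. \<Sum>j=1..int M. S (a * c) * e (- (c * (v + j))) * Dk M c ^ k)"
  proof (rule sum.cong[OF refl])
    fix c
    have "S (a * c) * e (- (c * v)) * Dk M c ^ Suc k = (S (a * c) * e (- (c * v)) * Dk M c ^ k) * Dk M c"
      by (simp add: mult_ac)
    also have "\<dots> = (\<Sum>j=1..int M. (S (a * c) * e (- (c * v)) * Dk M c ^ k) * e (- (c * j)))"
      by (subst (2) Dk_def) (rule sum_distrib_left)
    also have "\<dots> = (\<Sum>j=1..int M. S (a * c) * e (- (c * (v + j))) * Dk M c ^ k)"
    proof (rule sum.cong[OF refl])
      fix j
      have "e (- (c * (v + j))) = e (- (c * v)) * e (- (c * j))" by (simp add: distrib_left flip: e_add)
      thus "S (a * c) * e (- (c * v)) * Dk M c ^ k * e (- (c * j)) = S (a * c) * e (- (c * (v + j))) * Dk M c ^ k"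
        by (simp add: mult_ac)
    qed
    finally show "S (a * c) * e (- (c * v)) * Dk M c ^ Suc k = (\<Sum>j=1..int M. S (a * c) * e (- (c * (v + j))) * Dk M c ^ k)" .
  qed
  also have "\<dots> = (\<Sum>j=1..int M. \<Sum>c\<in>F. S (a * c) * e (- (c * (v + j))) * Dk M c ^ k)" by (rule sum.swap)
  also have "\<dots> = 0"
  proof (rule sum.neutral, rule ballI)
    fix j assume j: "j \<in> {1..int M}"
    show "(\<Sum>c\<in>F. S (a * c) * e (- (c * (v + j))) * Dk M c ^ k) = 0"
    proof (rule Suc.IH)
      fix s g assume s: "int k \<le> s" "s \<le> int (k * M)" "\<gamma> g = 1"
      have "int (Suc k) \<le> j + s" "j + s \<le> int (Suc k * M)" using s j by auto
      from Suc.prems[OF this s(3)] show "\<not> [v + j + s = a * g] (mod int p)" by (simp add: add.assoc)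
    qed
  qed
  finally show ?case .
qed

text \<open>In the vanishing sum the frequency 0 contributes t M^k. It must be balanced by the
  frequencies c and p - c with c <= h, whence the factor 2, and by the remaining ones, where the
  kernel is at most 2p/h.\<close>

lemma gap_forces_large_sum:
  assumes a: "a \<in> U" and k: "k \<ge> 1" and M: "M \<ge> 1" and h: "h \<ge> 1" "2 * h < p"
    and gap: "\<And>j g. 1 \<le> j \<Longrightarrow> j \<le> int (k * M) \<Longrightarrow> \<gamma> g = 1 \<Longrightarrow> \<not> [u + j = a * g] (mod int p)"
  shows "real t \<le> 2 * (\<Sum>c\<in>{1..int h}. norm (S (a * c))) + real p * real t * (2 * real p / (real h * real M)) ^ k"
proof -
  have M0: "real M > 0" using M by simp
  define T where "T c = norm (S (a * c)) * norm (Dk M c) ^ k" for c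
  have "(\<Sum>c\<in>F. S (a * c) * e (- (c * u)) * Dk M c ^ k) = 0"
  proof (rule kernel_vanishes)
    fix s g assume "int k \<le> s" "s \<le> int (k * M)" "\<gamma> g = 1"
    thus "\<not> [u + s = a * g] (mod int p)" using gap[of s g] k by auto
  qed
  moreover have "S (a * 0) * e (- (0 * u)) * Dk M 0 ^ k = of_real (real t * real M ^ k)"
  proof -
    have "S 0 = of_real (real t)" by (simp add: S_def sum_\<gamma> flip: of_real_sum)
    thus ?thesis by (simp add: Dk_def)
  qed
  ultimately have "of_real (real t * real M ^ k) = - (\<Sum>c\<in>U. S (a * c) * e (- (c * u)) * Dk M c ^ k)"
    unfolding F_split by (simp add: eq_neg_iff_add_eq_0)
  hence "norm (complex_of_real (real t * real M ^ k)) = norm (\<Sum>c\<in>U. S (a * c) * e (- (c * u)) * Dk M c ^ k)"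
    by (simp only: norm_minus_cancel)
  hence "real t * real M ^ k = norm (\<Sum>c\<in>U. S (a * c) * e (- (c * u)) * Dk M c ^ k)"
    by (simp only: norm_of_real) simp
  also have "\<dots> \<le> (\<Sum>c\<in>U. norm (S (a * c) * e (- (c * u)) * Dk M c ^ k))" by (rule norm_sum)
  also have "\<dots> = (\<Sum>c\<in>U. T c)" by (simp add: T_def norm_mult norm_power)
  also have "U = {1..int h} \<union> ({int p - int h..<int p} \<union> {int h<..<int p - int h})" using h by auto
  also have "(\<Sum>c\<in>{1..int h} \<union> ({int p - int h..<int p} \<union> {int h<..<int p - int h}). T c) =
      (\<Sum>c\<in>{1..int h}. T c) + ((\<Sum>c\<in>{int p - int h..<int p}. T c) + (\<Sum>c\<in>{int h<..<int p - int h}. T c))"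
    using h by (subst sum.union_disjoint, simp, simp, force, subst sum.union_disjoint, auto)
  also have "(\<Sum>c\<in>{1..int h}. T c) \<le> (\<Sum>c\<in>{1..int h}. norm (S (a * c))) * real M ^ k"
    unfolding T_def sum_distrib_right by (intro sum_mono mult_left_mono power_mono norm_Dk_le) auto
  also have "(\<Sum>c\<in>{int p - int h..<int p}. T c) \<le> (\<Sum>c\<in>{1..int h}. norm (S (a * c))) * real M ^ k"
  proof -
    have "(\<Sum>c\<in>{int p - int h..<int p}. T c) \<le> (\<Sum>c\<in>{int p - int h..<int p}. norm (S (a * c)) * real M ^ k)"
      unfolding T_def by (intro sum_mono mult_left_mono power_mono norm_Dk_le) auto
    also have "\<dots> = (\<Sum>c\<in>{1..int h}. norm (S (a * c)) * real M ^ k)"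
    proof (rule sum.reindex_bij_witness[of _ "\<lambda>c. int p - c" "\<lambda>c. int p - c"])
      fix c assume "c \<in> {int p - int h..<int p}"
      have "S (a * (int p - c)) = S (- (a * c))"
        by (rule perD[OF per_S]) (simp add: cong_iff_dvd_diff right_diff_distrib)
      thus "norm (S (a * (int p - c))) * real M ^ k = norm (S (a * c)) * real M ^ k" by (simp add: norm_S_minus)
    qed auto
    finally show ?thesis by (simp add: sum_distrib_right)
  qed
  also have "(\<Sum>c\<in>{int h<..<int p - int h}. T c) \<le> (\<Sum>c\<in>{int h<..<int p - int h}. real t * (2 * real p / real h) ^ k)"
    unfolding T_def
  proof (intro sum_mono mult_mono power_mono norm_S_le)
    fix c assume "c \<in> {int h<..<int p - int h}"
    thus "norm (Dk M c) \<le> 2 * real p / real h" using norm_Dk_le'[of "int h" c M] h by auto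
  qed auto
  also have "\<dots> \<le> real p * (real t * (2 * real p / real h) ^ k)"
    using h by (auto intro!: mult_right_mono)
  finally have "real t * real M ^ k \<le> 2 * (\<Sum>c\<in>{1..int h}. norm (S (a * c))) * real M ^ k + real p * (real t * (2 * real p / real h) ^ k)"
    by (simp add: mult.commute mult.left_commute)
  hence "real t * real M ^ k \<le> (2 * (\<Sum>c\<in>{1..int h}. norm (S (a * c))) + real p * real t * (2 * real p / (real h * real M)) ^ k) * real M ^ k"
    using M0 by (simp add: distrib_right power_divide power_mult_distrib)
  thus ?thesis using M0 by (subst (asm) mult_le_cancel_right_pos) auto
qed

end

section \<open>Reduced fractions in the subgroup\<close>

definition tau :: "nat \<Rightarrow> nat" where "tau n = card {d. d dvd n}"

lemma tau_prime_power_mult: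
  assumes q: "prime q" and m: "m > 0"
  shows "tau (q ^ a * m) \<le> (a + 1) * tau m"
proof -
  have "{d. d dvd q ^ a * m} \<subseteq> (\<lambda>(i, d). q ^ i * d) ` ({..a} \<times> {d. d dvd m})"
  proof
    fix d assume "d \<in> {d. d dvd q ^ a * m}"
    then obtain b c where bc: "d = b * c" "b dvd q ^ a" "c dvd m" using division_decomp by blast
    then obtain i where "i \<le> a" "b = q ^ i" using divides_primepow_nat[OF q] by blast
    thus "d \<in> (\<lambda>(i, d). q ^ i * d) ` ({..a} \<times> {d. d dvd m})" using bc by force
  qed
  hence "tau (q ^ a * m) \<le> card ((\<lambda>(i, d). q ^ i * d) ` ({..a} \<times> {d. d dvd m}))"
    unfolding tau_def using m by (intro card_mono) auto
  also have "\<dots> \<le> card ({..a} \<times> {d. d dvd m})" using m by (intro card_image_le) auto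
  finally show ?thesis by (simp add: tau_def card_cartesian_product)
qed

text \<open>A prime power q^a contributes a + 1 <= 2^a divisors, which is at most q^(\<delta>a) once
  q > 2^(1/\<delta>). Each of the finitely many smaller primes costs at most one factor
  \<open>C0\<close>, so their number bounds the exponent of \<open>C0\<close>.\<close>

lemma divisor_bound:
  fixes \<delta> :: real
  assumes \<delta>: "\<delta> > 0"
  obtains C where "C \<ge> 1" "\<And>n. n \<ge> 1 \<Longrightarrow> real (tau n) \<le> C * real n powr \<delta>"
proof -
  define B where "B = nat \<lceil>2 powr (1 / \<delta>)\<rceil>"
  define C0 where "C0 = 1 + 1 / (\<delta> * ln 2)"
  have ln2: "\<delta> * ln 2 > 0" using \<delta> by simp
  have C0: "C0 \<ge> 1" unfolding C0_def using ln2 by simp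
  have gen: "real a + 1 \<le> C0 * real q powr (\<delta> * real a)" if "q \<ge> 2" for a q :: nat
  proof -
    have "1 + real a * (\<delta> * ln 2) \<le> exp (real a * (\<delta> * ln 2))" by (rule exp_ge_add_one_self)
    also have "\<dots> = 2 powr (\<delta> * real a)" by (simp add: powr_def mult_ac)
    also have "\<dots> \<le> real q powr (\<delta> * real a)" using that \<delta> by (intro powr_mono2) auto
    finally have 1: "1 + real a * (\<delta> * ln 2) \<le> real q powr (\<delta> * real a)" .
    have "real a + 1 \<le> C0 * (1 + real a * (\<delta> * ln 2))"
    proof -
      have "C0 * (1 + real a * (\<delta> * ln 2)) = 1 + real a + (1 / (\<delta> * ln 2) + real a * (\<delta> * ln 2))"
      proof -
        have "(1 + 1 / q) * (1 + real a * q) = 1 + real a + (1 / q + real a * q)" if "q > 0" for q :: real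
          using that by (simp add: field_simps)
        thus ?thesis unfolding C0_def using ln2 by blast
      qed
      moreover have "0 \<le> 1 / (\<delta> * ln 2) + real a * (\<delta> * ln 2)" using ln2 by (intro add_nonneg_nonneg) auto
      ultimately show ?thesis by linarith
    qed
    also have "\<dots> \<le> C0 * real q powr (\<delta> * real a)" using 1 C0 by (intro mult_left_mono) auto
    finally show ?thesis .
  qed
  have big: "real a + 1 \<le> real q powr (\<delta> * real a)" if "q > B" for a q :: nat
  proof -
    have "2 powr (1 / \<delta>) \<le> real q" using that unfolding B_def by linarith
    hence "(2 powr (1 / \<delta>)) powr (\<delta> * real a) \<le> real q powr (\<delta> * real a)" using \<delta> by (intro powr_mono2) auto
    hence "2 ^ a \<le> real q powr (\<delta> * real a)" using \<delta> by (simp add: powr_powr powr_realpow)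
    moreover have "real (Suc a) \<le> 2 ^ a" by (metis Suc_leI less_exp of_nat_le_iff of_nat_numeral of_nat_power)
    ultimately show ?thesis by simp
  qed
  define sm where "sm n = card {q. prime q \<and> q \<le> B \<and> q dvd n}" for n
  have fin: "finite {q. prime q \<and> q \<le> B \<and> q dvd n}" for n by (rule finite_subset[of _ "{..B}"]) auto
  have main: "real (tau n) \<le> C0 ^ sm n * real n powr \<delta>" if "n \<ge> 1" for n
    using that
  proof (induction n rule: less_induct)
    case (less n)
    show ?case
    proof (cases "n = 1")
      case True
      thus ?thesis using C0 by (simp add: tau_def)
    next
      case False
      then obtain q where q: "prime q" "q dvd n" using prime_factor_nat by blast
      obtain a m where am: "n = q ^ a * m" "\<not> q dvd m"
        using multiplicity_decompose'[of n q] less.prems q(1) by (metis not_prime_unit not_one_le_zero)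
      have a0: "a > 0" using am q by (cases a) auto
      have m0: "m \<ge> 1" using am less.prems by (cases m) auto
      have q2: "q \<ge> 2" using q prime_ge_2_nat by blast
      have "1 < q ^ a" using a0 q2 by (intro one_less_power) auto
      hence mn: "m < n" using am m0 by simp
      have cop: "(real q powr (\<delta> * real a)) * real m powr \<delta> = real n powr \<delta>"
        unfolding am using q2 m0 by (simp add: powr_mult powr_powr mult.commute flip: powr_realpow)
      have sub: "{r. prime r \<and> r \<le> B \<and> r dvd m} \<subseteq> {r. prime r \<and> r \<le> B \<and> r dvd n}" using am by auto
      have "real (tau n) \<le> real ((a + 1) * tau m)" unfolding am of_nat_le_iff
        using tau_prime_power_mult[OF q(1), of m a] m0 by simp
      hence tn: "real (tau n) \<le> (real a + 1) * real (tau m)" by (simp add: distrib_right)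
      show ?thesis
      proof (cases "q \<le> B")
        case True
        have "insert q {r. prime r \<and> r \<le> B \<and> r dvd m} \<subseteq> {r. prime r \<and> r \<le> B \<and> r dvd n}" using sub q True by auto
        hence "card (insert q {r. prime r \<and> r \<le> B \<and> r dvd m}) \<le> sm n" unfolding sm_def using fin by (intro card_mono)
        hence smn: "sm m + 1 \<le> sm n" using am(2) fin[of m] by (simp add: sm_def)
        note tn
        also have "(real a + 1) * real (tau m) \<le> (C0 * real q powr (\<delta> * real a)) * (C0 ^ sm m * real m powr \<delta>)"
          using gen[OF q2] less.IH[OF mn m0] C0 by (intro mult_mono) auto
        also have "\<dots> = C0 ^ (sm m + 1) * ((real q powr (\<delta> * real a)) * real m powr \<delta>)" by simp
        also have "\<dots> \<le> C0 ^ sm n * real n powr \<delta>" unfolding cop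
          using C0 smn by (intro mult_right_mono power_increasing) auto
        finally show ?thesis .
      next
        case False
        have smn: "sm m \<le> sm n" unfolding sm_def using sub fin by (intro card_mono)
        note tn
        also have "(real a + 1) * real (tau m) \<le> (real q powr (\<delta> * real a)) * (C0 ^ sm m * real m powr \<delta>)"
          using big[of q a] False less.IH[OF mn m0] C0 by (intro mult_mono) auto
        also have "\<dots> = C0 ^ sm m * ((real q powr (\<delta> * real a)) * real m powr \<delta>)" by simp
        also have "\<dots> \<le> C0 ^ sm n * real n powr \<delta>" unfolding cop
          using C0 smn by (intro mult_right_mono power_increasing) auto
        finally show ?thesis .
      qed
    qed
  qed
  show thesis
  proof (rule that[of "C0 ^ (B + 1)"])
    show "C0 ^ (B + 1) \<ge> 1" using C0 by (rule one_le_power)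
    fix n :: nat assume n: "n \<ge> 1"
    have "card {q. prime q \<and> q \<le> B \<and> q dvd n} \<le> card {..B}" by (rule card_mono) auto
    hence "C0 ^ sm n \<le> C0 ^ (B + 1)" using C0 unfolding sm_def by (intro power_increasing) auto
    hence "C0 ^ sm n * real n powr \<delta> \<le> C0 ^ (B + 1) * real n powr \<delta>" by (intro mult_right_mono) auto
    thus "real (tau n) \<le> C0 ^ (B + 1) * real n powr \<delta>" using main[OF n] by linarith
  qed
qed

context mult_subgroup
begin

definition Fr :: "nat \<Rightarrow> (nat \<times> nat) set" where
  "Fr X = {(r, s). r \<in> {1..X} \<and> s \<in> {1..X} \<and> coprime r s \<and> \<not> p dvd r \<and> \<not> p dvd s \<and> [r ^ t = s ^ t] (mod p)}"

lemma finite_Fr: "finite (Fr X)" unfolding Fr_def by (rule finite_subset[of _ "{1..X} \<times> {1..X}"]) auto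

lemma cancel_common_factor_pow:
  assumes "[(k * n) ^ t = (k * m) ^ t] (mod p)" "\<not> p dvd k"
  shows "[n ^ t = m ^ t] (mod p)"
proof -
  have "coprime (k ^ t) p" using prime_imp_coprime[OF prime_p assms(2)] by (simp add: coprime_commute)
  thus ?thesis using assms(1) unfolding power_mult_distrib by (simp add: cong_mult_lcancel_nat)
qed

text \<open>A pair of fractions is labelled by the two greatest common divisors that cancel in the product.
  Within one label the product determines the factors up to divisors of its numerator and
  denominator, and a single fraction takes part in few labels; Cauchy-Schwarz over the labels
  then bounds the number of all pairs.\<close>

lemma card_Fr_mult:
  fixes T :: real
  assumes T: "\<And>n. 1 \<le> n \<Longrightarrow> n \<le> R * X \<Longrightarrow> real (tau n) \<le> T" and R: "R \<ge> 1" and X: "X \<ge> 1"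
  shows "real (card (Fr R)) * real (card (Fr X)) \<le> T ^ 6 * real (card (Fr (R * X)))"
proof -
  define lab where "lab i = (gcd (fst (fst i)) (snd (snd i)), gcd (fst (snd i)) (snd (fst i)))" for i :: "(nat \<times> nat) \<times> nat \<times> nat"
  define K where "K l = {i \<in> Fr R \<times> Fr X. lab i = l}" for l
  define Ad where "Ad l = {a \<in> Fr R. fst l dvd fst a \<and> snd l dvd snd a}" for l
  define Bd where "Bd l = {b \<in> Fr X. fst l dvd snd b \<and> snd l dvd fst b}" for l
  define Ls where "Ls = {1..R} \<times> {1..R}"
  define f where "f = real (card (Fr (R * X)))"
  have RX: "R \<le> R * X" "X \<le> R * X" "1 \<le> R * X" using R X by (auto simp: Suc_le_eq)
  have T1: "T \<ge> 1" using T[of 1] RX by (simp add: tau_def)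
  have finK: "finite (K l)" for l unfolding K_def by (rule finite_subset[of _ "Fr R \<times> Fr X"]) (auto simp: finite_Fr)
  have KF: "real (card (K l)) \<le> T ^ 2 * f" for l
  proof -
    obtain d e where l: "l = (d, e)" by (cases l)
    \<comment> \<open>For l = (d, e) the fractions are d u1/(e v1) and e u2/(d v2). Their product u1
      u2/(v1 v2) is already reduced, and recording u1 and v1 with it recovers both
      fractions.\<close>
    define P where "P i = (((fst (fst i) div d) * (fst (snd i) div e), (snd (fst i) div e) * (snd (snd i) div d)),
        (fst (fst i) div d, snd (fst i) div e))" for i :: "(nat \<times> nat) \<times> nat \<times> nat"
    define Tg where "Tg = Sigma (Fr (R * X)) (\<lambda>nm. {x. x dvd fst nm} \<times> {x. x dvd snd nm})"
    have facts: "\<exists>u1 v1 u2 v2. r1 = d * u1 \<and> s1 = e * v1 \<and> r2 = e * u2 \<and> s2 = d * v2 \<and> d > 0 \<and> e > 0 \<and>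
        u1 > 0 \<and> v1 > 0 \<and> u2 > 0 \<and> v2 > 0 \<and> coprime u1 v1 \<and> coprime u1 v2 \<and> coprime u2 v1 \<and> coprime u2 v2"
      if "((r1, s1), (r2, s2)) \<in> K l" for r1 s1 r2 s2
    proof -
      have dd: "d = gcd r1 s2" "e = gcd r2 s1" and pos: "r1 > 0" "s1 > 0" "r2 > 0" "s2 > 0"
        and cop: "coprime r1 s1" "coprime r2 s2"
        using that by (auto simp: K_def lab_def l Fr_def)
      have d0: "d > 0" "e > 0" using dd pos by auto
      obtain u1 v2 where 1: "r1 = d * u1" "s2 = d * v2" using dd by (meson dvdE gcd_dvd1 gcd_dvd2)
      obtain u2 v1 where 2: "r2 = e * u2" "s1 = e * v1" using dd by (meson dvdE gcd_dvd1 gcd_dvd2)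
      have "coprime (r1 div d) (s2 div d)" using dd pos by (simp add: div_gcd_coprime)
      hence c1: "coprime u1 v2" using 1 d0 by simp
      have "coprime (r2 div e) (s1 div e)" using dd pos by (simp add: div_gcd_coprime)
      hence c2: "coprime u2 v1" using 2 d0 by simp
      have c3: "coprime u1 v1" using cop(1) 1 2 by simp
      have c4: "coprime u2 v2" using cop(2) 1 2 by simp
      have "u1 > 0" "v1 > 0" "u2 > 0" "v2 > 0" using pos 1 2 by auto
      thus ?thesis using 1 2 d0 c1 c2 c3 c4 by blast
    qed
    have "inj_on P (K l)"
    proof (rule inj_onI)
      fix i j assume ij: "i \<in> K l" "j \<in> K l" "P i = P j"
      obtain r1 s1 r2 s2 where i: "i = ((r1, s1), (r2, s2))" by (metis surj_pair)
      obtain r1' s1' r2' s2' where j: "j = ((r1', s1'), (r2', s2'))" by (metis surj_pair)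
      obtain u1 v1 u2 v2 where u: "r1 = d * u1" "s1 = e * v1" "r2 = e * u2" "s2 = d * v2" "d > 0" "e > 0" "u1 > 0" "v1 > 0"
        using facts ij(1) i by blast
      obtain u1' v1' u2' v2' where u': "r1' = d * u1'" "s1' = e * v1'" "r2' = e * u2'" "s2' = d * v2'"
        using facts ij(2) j by blast
      have "u1 = u1'" "v1 = v1'" "u1 * u2 = u1' * u2'" "v1 * v2 = v1' * v2'"
        using ij(3) u u' by (auto simp: P_def i j)
      hence "u1 = u1'" "v1 = v1'" "u2 = u2'" "v2 = v2'" using u by auto
      thus "i = j" using u u' i j by simp
    qed
    moreover have "P ` K l \<subseteq> Tg"
    proof
      fix x assume "x \<in> P ` K l"
      then obtain i where i: "i \<in> K l" "x = P i" by blast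
      obtain r1 s1 r2 s2 where i': "i = ((r1, s1), (r2, s2))" by (metis surj_pair)
      obtain u1 v1 u2 v2 where u: "r1 = d * u1" "s1 = e * v1" "r2 = e * u2" "s2 = d * v2" "d > 0" "e > 0"
          "u1 > 0" "v1 > 0" "u2 > 0" "v2 > 0" "coprime u1 v1" "coprime u1 v2" "coprime u2 v1" "coprime u2 v2"
        using facts i(1) i' by blast
      have mem: "r1 \<le> R" "s1 \<le> R" "r2 \<le> X" "s2 \<le> X" "\<not> p dvd r1" "\<not> p dvd s1" "\<not> p dvd r2" "\<not> p dvd s2"
         "[r1 ^ t = s1 ^ t] (mod p)" "[r2 ^ t = s2 ^ t] (mod p)"
        using i(1) i' by (auto simp: K_def Fr_def)
      have Px: "P i = ((u1 * u2, v1 * v2), (u1, v1))" using u by (simp add: P_def i')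
      have nd: "\<not> p dvd d * e" "\<not> p dvd u1 * u2" "\<not> p dvd v1 * v2" using mem u prime_p by (auto simp: prime_dvd_mult_iff)
      have "[r1 ^ t * r2 ^ t = s1 ^ t * s2 ^ t] (mod p)" using mem by (intro cong_mult)
      hence "[(d * e * (u1 * u2)) ^ t = (d * e * (v1 * v2)) ^ t] (mod p)"
        unfolding u by (simp add: power_mult_distrib mult_ac)
      hence pw: "[(u1 * u2) ^ t = (v1 * v2) ^ t] (mod p)" by (rule cancel_common_factor_pow) (rule nd)
      have "u1 \<le> R" "v1 \<le> R" "u2 \<le> X" "v2 \<le> X"
        using mem u by (metis dvd_imp_le dvd_triv_right le_trans mult_pos_pos)+
      hence "u1 * u2 \<le> R * X" "v1 * v2 \<le> R * X" by (auto intro: mult_le_mono)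
      hence "(u1 * u2, v1 * v2) \<in> Fr (R * X)" using u nd pw by (simp add: Fr_def Suc_le_eq)
      thus "x \<in> Tg" unfolding i(2) Px Tg_def by simp
    qed
    moreover have finTg: "finite Tg" unfolding Tg_def
      by (rule finite_SigmaI[OF finite_Fr]) (auto simp: Fr_def)
    ultimately have "card (K l) \<le> card Tg" by (rule card_inj_on_le)
    also have "card Tg = (\<Sum>nm\<in>Fr (R * X). tau (fst nm) * tau (snd nm))"
      unfolding Tg_def by (subst card_SigmaI[OF finite_Fr]) (auto simp: Fr_def tau_def card_cartesian_product)
    finally have "real (card (K l)) \<le> (\<Sum>nm\<in>Fr (R * X). real (tau (fst nm)) * real (tau (snd nm)))"
      by (metis (mono_tags, lifting) of_nat_le_iff of_nat_mult of_nat_sum sum.cong)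
    also have "\<dots> \<le> (\<Sum>nm\<in>Fr (R * X). T * T)"
      using T1 by (intro sum_mono mult_mono T) (auto simp: Fr_def)
    finally show ?thesis by (simp add: f_def power2_eq_square mult_ac)
  qed
  have KAB: "card (K l) \<le> card (Ad l) * card (Bd l)" for l
  proof -
    have "K l \<subseteq> Ad l \<times> Bd l" unfolding K_def Ad_def Bd_def lab_def by auto
    moreover have "finite (Ad l)" "finite (Bd l)" unfolding Ad_def Bd_def
      by (rule finite_subset[OF _ finite_Fr], blast)+
    ultimately show ?thesis using card_mono[of "Ad l \<times> Bd l" "K l"] by (simp add: card_cartesian_product)
  qed
  have swapsum: "(\<Sum>l\<in>Ls. real (card {a \<in> Fr Y. fst l dvd g a \<and> snd l dvd g' a})) \<le> T ^ 2 * real (card (Fr Y))"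
    if Y: "Y \<le> R * X" and g: "\<And>a. a \<in> Fr Y \<Longrightarrow> 1 \<le> g a \<and> g a \<le> Y \<and> 1 \<le> g' a \<and> g' a \<le> Y" for Y g g'
  proof -
    have finLs: "finite Ls" by (simp add: Ls_def)
    have "(\<Sum>l\<in>Ls. real (card {a \<in> Fr Y. fst l dvd g a \<and> snd l dvd g' a})) =
        (\<Sum>l\<in>Ls. \<Sum>a\<in>Fr Y. of_bool (fst l dvd g a \<and> snd l dvd g' a))"
      by (simp only: sum_of_bool_card[OF finite_Fr])
    also have "\<dots> = (\<Sum>a\<in>Fr Y. \<Sum>l\<in>Ls. of_bool (fst l dvd g a \<and> snd l dvd g' a))" by (rule sum.swap)
    also have "\<dots> \<le> (\<Sum>a\<in>Fr Y. T * T)"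
    proof (rule sum_mono)
      fix a assume a: "a \<in> Fr Y"
      have "(\<Sum>l\<in>Ls. of_bool (fst l dvd g a \<and> snd l dvd g' a)) = real (card {l \<in> Ls. fst l dvd g a \<and> snd l dvd g' a})"
        by (rule sum_of_bool_card[OF finLs])
      also have "card {l \<in> Ls. fst l dvd g a \<and> snd l dvd g' a} \<le> card ({d. d dvd g a} \<times> {d. d dvd g' a})"
        using g[OF a] by (intro card_mono) auto
      also have "real (card ({d. d dvd g a} \<times> {d. d dvd g' a})) = real (tau (g a)) * real (tau (g' a))"
        by (simp add: tau_def card_cartesian_product)
      also have "\<dots> \<le> T * T" using g[OF a] Y T1 by (intro mult_mono T) auto
      finally show "(\<Sum>l\<in>Ls. of_bool (fst l dvd g a \<and> snd l dvd g' a)) \<le> T * T" by simp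
    qed
    finally show ?thesis by (simp add: power2_eq_square mult_ac)
  qed
  have SA: "(\<Sum>l\<in>Ls. real (card (Ad l))) \<le> T ^ 2 * real (card (Fr R))"
    unfolding Ad_def by (rule swapsum[OF RX(1)]) (auto simp: Fr_def)
  have SB: "(\<Sum>l\<in>Ls. real (card (Bd l))) \<le> T ^ 2 * real (card (Fr X))"
    unfolding Bd_def by (rule swapsum[OF RX(2)]) (auto simp: Fr_def)
  define AB where "AB = real (card (Fr R)) * real (card (Fr X))"
  have "AB = real (card (Fr R \<times> Fr X))" by (simp add: AB_def card_cartesian_product)
  also have "Fr R \<times> Fr X = (\<Union>l\<in>Ls. K l)"
  proof (rule Set.set_eqI, rule iffI)
    fix i assume i: "i \<in> Fr R \<times> Fr X"
    obtain r1 s1 r2 s2 where i': "i = ((r1, s1), (r2, s2))" by (metis surj_pair)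
    have pos: "r1 \<ge> 1" "s1 \<ge> 1" "r1 \<le> R" "s1 \<le> R" using i i' by (auto simp: Fr_def)
    have "gcd r1 s2 \<le> r1" "gcd r2 s1 \<le> s1" using pos by (auto intro: dvd_imp_le)
    hence "gcd r1 s2 \<le> R" "gcd r2 s1 \<le> R" using pos by linarith+
    moreover have "gcd r1 s2 \<ge> 1" "gcd r2 s1 \<ge> 1" using pos by (auto simp: Suc_le_eq)
    ultimately have "lab i \<in> Ls" by (simp add: lab_def Ls_def i')
    thus "i \<in> (\<Union>l\<in>Ls. K l)" using i by (auto simp: K_def)
  qed (auto simp: K_def)
  also have "card (\<Union>l\<in>Ls. K l) = (\<Sum>l\<in>Ls. card (K l))"
    by (rule card_UN_disjoint) (auto simp: Ls_def finK, auto simp: K_def)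
  finally have "AB = (\<Sum>l\<in>Ls. real (card (K l)))" by simp
  \<comment> \<open>The geometric mean of the two bounds for a label class: \<open>KF\<close> is
    uniform in l but cannot be summed over all labels, while \<open>KAB\<close> is summable after
    Cauchy-Schwarz.\<close>
  also have "\<dots> \<le> (\<Sum>l\<in>Ls. sqrt (T ^ 2 * f) * (sqrt (real (card (Ad l))) * sqrt (real (card (Bd l)))))"
  proof (rule sum_mono)
    fix l
    have "real (card (K l)) ^ 2 \<le> (T ^ 2 * f) * (real (card (Ad l)) * real (card (Bd l)))"
      unfolding power2_eq_square[of "real (card (K l))"] using KF[of l] KAB[of l] T1
      by (intro mult_mono) (auto simp: f_def simp flip: of_nat_mult)
    hence "real (card (K l)) \<le> sqrt ((T ^ 2 * f) * (real (card (Ad l)) * real (card (Bd l))))" by (rule real_le_rsqrt)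
    thus "real (card (K l)) \<le> sqrt (T ^ 2 * f) * (sqrt (real (card (Ad l))) * sqrt (real (card (Bd l))))"
      by (simp only: real_sqrt_mult)
  qed
  also have "\<dots> = sqrt (T ^ 2 * f) * (\<Sum>l\<in>Ls. sqrt (real (card (Ad l))) * sqrt (real (card (Bd l))))"
    by (simp only: sum_distrib_left)
  finally have le: "AB \<le> sqrt (T ^ 2 * f) * (\<Sum>l\<in>Ls. sqrt (real (card (Ad l))) * sqrt (real (card (Bd l))))" .
  have AB0: "AB \<ge> 0" by (simp add: AB_def)
  have "AB ^ 2 \<le> (sqrt (T ^ 2 * f) * (\<Sum>l\<in>Ls. sqrt (real (card (Ad l))) * sqrt (real (card (Bd l))))) ^ 2"
    using le AB0 by (rule power_mono)
  also have "\<dots> = (T ^ 2 * f) * (\<Sum>l\<in>Ls. sqrt (real (card (Ad l))) * sqrt (real (card (Bd l)))) ^ 2"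
    by (simp add: power_mult_distrib f_def)
  also have "\<dots> \<le> (T ^ 2 * f) * ((\<Sum>l\<in>Ls. (sqrt (real (card (Ad l))))\<^sup>2) * (\<Sum>l\<in>Ls. (sqrt (real (card (Bd l))))\<^sup>2))"
    by (intro mult_left_mono Cauchy_Schwarz_ineq_sum) (simp add: f_def)
  also have "\<dots> \<le> (T ^ 2 * f) * ((T ^ 2 * real (card (Fr R))) * (T ^ 2 * real (card (Fr X))))"
    using SA SB by (intro mult_left_mono mult_mono) (auto simp: f_def intro!: sum_nonneg)
  \<comment> \<open>The sixth power collects T^2 from \<open>KF\<close>, \<open>SA\<close> and
    \<open>SB\<close> each. The quantity AB occurs on both sides and is cancelled.\<close>
  also have "\<dots> = (T ^ 6 * f) * AB" by (simp add: AB_def eval_nat_numeral)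
  finally have "AB * AB \<le> (T ^ 6 * f) * AB" by (simp add: power2_eq_square)
  hence "AB \<le> T ^ 6 * f"
  proof (cases "AB = 0")
    case True
    thus ?thesis using T1 by (simp add: f_def)
  next
    case False
    thus ?thesis using \<open>AB * AB \<le> (T ^ 6 * f) * AB\<close> AB0 by (subst (asm) mult_le_cancel_right_pos) auto
  qed
  thus ?thesis by (simp add: AB_def f_def)
qed

lemma card_Fr_power:
  fixes T :: real
  assumes T: "\<And>n. 1 \<le> n \<Longrightarrow> n \<le> R ^ Suc k \<Longrightarrow> real (tau n) \<le> T" and R: "R \<ge> 1"
  shows "real (card (Fr R)) ^ Suc k \<le> (T ^ 6) ^ k * real (card (Fr (R ^ Suc k)))"
  using T
proof (induction k)
  case 0
  show ?case by simp
next
  case (Suc k)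
  have "R ^ Suc k \<le> R ^ Suc (Suc k)" using R by (intro power_increasing) auto
  hence IH: "real (card (Fr R)) ^ Suc k \<le> (T ^ 6) ^ k * real (card (Fr (R ^ Suc k)))"
    using Suc.prems le_trans by (intro Suc.IH) blast
  have "T \<ge> 1" using Suc.prems[of 1] R by (simp add: tau_def)
  hence T0: "(T ^ 6) ^ k \<ge> 0" by simp
  have "real (card (Fr R)) ^ Suc (Suc k) \<le> real (card (Fr R)) * ((T ^ 6) ^ k * real (card (Fr (R ^ Suc k))))"
    unfolding power_Suc[of _ "Suc k"] using IH by (intro mult_left_mono) auto
  also have "\<dots> = (T ^ 6) ^ k * (real (card (Fr R)) * real (card (Fr (R ^ Suc k))))" by simp
  also have "\<dots> \<le> (T ^ 6) ^ k * (T ^ 6 * real (card (Fr (R * R ^ Suc k))))"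
    using T0 R Suc.prems by (intro mult_left_mono card_Fr_mult) auto
  finally show ?case by (simp add: mult_ac)
qed

text \<open>Reduced fractions in \<open>[0,1]\<close> of height at most \<open>X\<close> that represent the same residue are at least
  \<open>p/X\<^sup>2\<close> apart.\<close>

lemma card_Fr_le:
  assumes X: "X \<ge> 1"
  shows "real (card (Fr X)) \<le> 2 * real t * (1 + real X ^ 2 / real p)"
proof -
  have p0: "real p > 0" using p_gt_1 by simp
  \<comment> \<open>The inverse of a fraction in the subgroup is again one, so it suffices to count
    fractions at most 1, at the cost of a factor 2.\<close>
  define Lo where "Lo = {i \<in> Fr X. fst i \<le> snd i}"
  define Gs where "Gs = {x \<in> F. [x ^ t = 1] (mod int p)}"
  have finLo: "finite Lo" unfolding Lo_def by (rule finite_subset[OF _ finite_Fr]) auto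
  have "Fr X \<subseteq> Lo \<union> prod.swap ` Lo"
  proof
    fix i assume i: "i \<in> Fr X"
    obtain a b where ab: "i = (a, b)" by (cases i)
    have "(b, a) \<in> Fr X" using i ab by (auto simp: Fr_def coprime_commute cong_sym)
    thus "i \<in> Lo \<union> prod.swap ` Lo" using i ab by (cases "a \<le> b") (auto simp: Lo_def image_iff)
  qed
  hence "card (Fr X) \<le> card (Lo \<union> prod.swap ` Lo)" by (rule card_mono[rotated]) (simp add: finLo)
  also have "\<dots> \<le> card Lo + card (prod.swap ` Lo)" by (rule card_Un_le)
  also have "\<dots> \<le> 2 * card Lo" using card_image_le[OF finLo, of prod.swap] by simp
  finally have F2: "card (Fr X) \<le> 2 * card Lo" .
  have "\<exists>d. [int s * d = 1] (mod int p)" if "\<not> p dvd s" for s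
  proof -
    have "\<not> int p dvd int s" using that by simp
    thus ?thesis using inverse_exists by metis
  qed
  then obtain iv where iv: "\<And>s. \<not> p dvd s \<Longrightarrow> [int s * iv s = 1] (mod int p)" by metis
  \<comment> \<open>The number of the cell of length p/X^2 that contains the fraction. Distinct
    fractions a/b and c/d of the same residue have |ad - bc| >= p and therefore lie in different
    cells.\<close>
  define fl where "fl i = \<lfloor>real (fst i) * real X ^ 2 / (real (snd i) * real p)\<rfloor>" for i :: "nat \<times> nat"
  define \<phi> where "\<phi> i = ((int (fst i) * iv (snd i)) mod int p, fl i)" for i :: "nat \<times> nat"
  have "inj_on \<phi> Lo"
  proof (rule inj_onI)
    fix i j assume ij: "i \<in> Lo" "j \<in> Lo" "\<phi> i = \<phi> j"
    obtain a b where i: "i = (a, b)" by (cases i)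
    obtain c d where j: "j = (c, d)" by (cases j)
    have ab: "a \<ge> 1" "b \<ge> 1" "b \<le> X" "coprime a b" "\<not> p dvd b" using ij(1) i by (auto simp: Lo_def Fr_def)
    have cd: "c \<ge> 1" "d \<ge> 1" "d \<le> X" "coprime c d" "\<not> p dvd d" using ij(2) j by (auto simp: Lo_def Fr_def)
    have e1: "(int a * iv b) mod int p = (int c * iv d) mod int p" and e2: "fl i = fl j"
      using ij(3) by (auto simp: \<phi>_def i j)
    have "[int a * int d = int c * int b] (mod int p)"
    proof -
      have "[int a * int d * 1 = int a * int d * (int b * iv b)] (mod int p)" by (intro cong_mult cong_refl cong_sym[OF iv[OF ab(5)]])
      also have "int a * int d * (int b * iv b) = (int a * iv b) * (int b * int d)" by simp
      also have "[\<dots> = (int c * iv d) * (int b * int d)] (mod int p)"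
        using e1 by (intro cong_mult[OF _ cong_refl]) (simp only: unique_euclidean_semiring_class.cong_def)
      also have "(int c * iv d) * (int b * int d) = int c * int b * (int d * iv d)" by simp
      also have "[\<dots> = int c * int b * 1] (mod int p)" by (intro cong_mult cong_refl iv[OF cd(5)])
      finally show ?thesis by simp
    qed
    hence dv: "int p dvd int a * int d - int c * int b" by (simp add: cong_iff_dvd_diff)
    have "int a * int d - int c * int b = 0"
    proof (rule ccontr)
      assume ne: "int a * int d - int c * int b \<noteq> 0"
      hence "int p \<le> \<bar>int a * int d - int c * int b\<bar>" using dvd_imp_le_int[OF ne dv] by simp
      hence "real_of_int (int p) \<le> real_of_int \<bar>int a * int d - int c * int b\<bar>" unfolding of_int_le_iff .
      hence ge: "real p \<le> \<bar>real a * real d - real c * real b\<bar>" by simp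
      define x y where "x = real a * real X ^ 2 / (real b * real p)" and "y = real c * real X ^ 2 / (real d * real p)"
      have bd0: "real b > 0" "real d > 0" using ab cd by auto
      have "x - y = (real a * real d - real c * real b) * (real X ^ 2 / (real b * real d * real p))"
        unfolding x_def y_def using bd0 p0 by (simp add: field_simps)
      hence "\<bar>x - y\<bar> = \<bar>real a * real d - real c * real b\<bar> * (real X ^ 2 / (real b * real d * real p))"
        using bd0 p0 by (simp add: abs_mult)
      also have "\<dots> \<ge> real p * (real X ^ 2 / (real b * real d * real p))"
        using ge bd0 p0 by (intro mult_right_mono) auto
      also have "real p * (real X ^ 2 / (real b * real d * real p)) = real X ^ 2 / (real b * real d)" using p0 by simp
      also have "real X ^ 2 / (real b * real d) \<ge> 1"
      proof -
        have "real b * real d \<le> real X * real X" using ab cd by (intro mult_mono) auto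
        thus ?thesis using bd0 by (simp add: power2_eq_square)
      qed
      finally have "\<bar>x - y\<bar> \<ge> 1" by simp
      moreover have "\<lfloor>x\<rfloor> = \<lfloor>y\<rfloor>" using e2 by (simp add: fl_def i j x_def y_def)
      ultimately show False by linarith
    qed
    hence "int (a * d) = int (c * b)" by simp
    hence "a * d = c * b" unfolding of_nat_eq_iff .
    hence "a = c \<and> b = d" using ab cd coprime_crossproduct_nat[of a b c d] by simp
    thus "i = j" by (simp add: i j)
  qed
  moreover have "\<phi> ` Lo \<subseteq> Gs \<times> {0..\<lfloor>real X ^ 2 / real p\<rfloor>}"
  proof
    fix x assume "x \<in> \<phi> ` Lo"
    then obtain i where i: "i \<in> Lo" "x = \<phi> i" by blast
    obtain a b where ab: "i = (a, b)" by (cases i)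
    have m: "a \<ge> 1" "a \<le> b" "b \<ge> 1" "\<not> p dvd b" "[a ^ t = b ^ t] (mod p)" using i ab by (auto simp: Lo_def Fr_def)
    have "[int a ^ t = int b ^ t] (mod int p)" using m(5) by (metis cong_int_iff of_nat_power)
    hence "[int a ^ t * iv b ^ t = int b ^ t * iv b ^ t] (mod int p)" by (rule cong_mult) simp
    also have "int b ^ t * iv b ^ t = (int b * iv b) ^ t" by (simp add: power_mult_distrib)
    also have "[\<dots> = 1 ^ t] (mod int p)" by (rule cong_pow[OF iv[OF m(4)]])
    finally have "[((int a * iv b) mod int p) ^ t = 1] (mod int p)"
      by (simp add: unique_euclidean_semiring_class.cong_def power_mod power_mult_distrib)
    hence "(int a * iv b) mod int p \<in> Gs" using mod_in_F by (simp add: Gs_def)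
    moreover have "real a * real X ^ 2 / (real b * real p) \<le> real X ^ 2 / real p"
    proof -
      have "real a * real X ^ 2 \<le> real b * real X ^ 2" using m by (intro mult_right_mono) auto
      thus ?thesis using m p0 by (simp add: field_simps)
    qed
    hence "fl i \<in> {0..\<lfloor>real X ^ 2 / real p\<rfloor>}" by (simp add: fl_def ab floor_mono)
    ultimately show "x \<in> Gs \<times> {0..\<lfloor>real X ^ 2 / real p\<rfloor>}" by (simp add: i(2) \<phi>_def ab)
  qed
  moreover have "finite (Gs \<times> {0..\<lfloor>real X ^ 2 / real p\<rfloor>})"
    unfolding Gs_def by (rule finite_cartesian_product, rule finite_subset[of _ F]) auto
  ultimately have "card Lo \<le> card (Gs \<times> {0..\<lfloor>real X ^ 2 / real p\<rfloor>})" by (rule card_inj_on_le)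
  also have "\<dots> = t * nat (\<lfloor>real X ^ 2 / real p\<rfloor> + 1)" using card_G by (simp add: card_cartesian_product Gs_def)
  finally have "real (card Lo) \<le> real t * real (nat (\<lfloor>real X ^ 2 / real p\<rfloor> + 1))"
    by (metis of_nat_le_iff of_nat_mult)
  also have "\<dots> \<le> real t * (1 + real X ^ 2 / real p)"
  proof (intro mult_left_mono)
    have "0 \<le> real X ^ 2 / real p" by simp
    hence "0 \<le> \<lfloor>real X ^ 2 / real p\<rfloor>" by linarith
    thus "real (nat (\<lfloor>real X ^ 2 / real p\<rfloor> + 1)) \<le> 1 + real X ^ 2 / real p" by linarith
  qed simp
  finally show ?thesis using F2 by linarith
qed

section \<open>Pairs of frequencies in a common coset\<close>

lemma sum_inverse_telescope:
  assumes "n \<ge> 1" "n \<le> h" shows "1 / real n = (\<Sum>m=n..h. 1 / (real m * real (m + 1))) + 1 / real (h + 1)"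
proof -
  have step: "1 / real m = 1 / (real m * real (m + 1)) + 1 / real (m + 1)" if "m \<ge> 1" for m
  proof -
    have "1 / x = 1 / (x * (x + 1)) + 1 / (x + 1)" if "x > 0" for x :: real
      using that by (simp add: divide_simps)
    from this[of "real m"] that show ?thesis by (simp add: add.commute)
  qed
  show ?thesis using assms(2)
  proof (induction h rule: nat_induct_at_least)
    case base
    show ?case using step[OF assms(1)] by simp
  next
    case (Suc h)
    show ?case using step[of "Suc h"] Suc by simp
  qed
qed

text \<open>A pair is g times a reduced pair, and for a reduced pair of height m at most h/m values
  of g are possible. Partial summation against \<open>card (Fr R) <= K R\<close> leaves a harmonic
  sum over the heights.\<close>

lemma Nr_le:
  assumes h: "h \<ge> 1" "h < p" and K: "K \<ge> 0" and FK: "\<And>R. 1 \<le> R \<Longrightarrow> R \<le> h \<Longrightarrow> real (card (Fr R)) \<le> K * real R"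
  shows "real (Nr h) \<le> real h * K * (2 + ln (real h))"
proof -
  define mx where "mx i = max (fst i) (snd i)" for i :: "nat \<times> nat"
  define Pr where "Pr = {i \<in> {1..int h} \<times> {1..int h}. [fst i ^ t = snd i ^ t] (mod int p)}"
  define Tg where "Tg = Sigma (Fr h) (\<lambda>i. {m. 1 \<le> m \<and> m * mx i \<le> h})"
  define \<phi> where "\<phi> i = (let a = nat (fst i); b = nat (snd i) in ((a div gcd a b, b div gcd a b), gcd a b))" for i :: "int \<times> int"
  have mx1: "mx i \<ge> 1" "mx i \<le> h" if "i \<in> Fr h" for i using that by (auto simp: mx_def Fr_def)
  have sub: "{m. 1 \<le> m \<and> m * mx i \<le> h} \<subseteq> {1..h div mx i}" if "i \<in> Fr h" for i
    using mx1[OF that] by (auto simp: less_eq_div_iff_mult_less_eq)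
  have finS: "finite {m. 1 \<le> m \<and> m * mx i \<le> h}" if "i \<in> Fr h" for i
    using sub[OF that] finite_subset by blast
  have "inj_on \<phi> Pr"
  proof (rule inj_onI)
    fix i j assume ij: "i \<in> Pr" "j \<in> Pr" "\<phi> i = \<phi> j"
    have pos: "1 \<le> fst i" "1 \<le> snd i" "1 \<le> fst j" "1 \<le> snd j" using ij by (auto simp: Pr_def mem_Times_iff)
    have e: "nat (fst i) div gcd (nat (fst i)) (nat (snd i)) = nat (fst j) div gcd (nat (fst j)) (nat (snd j))"
       "nat (snd i) div gcd (nat (fst i)) (nat (snd i)) = nat (snd j) div gcd (nat (fst j)) (nat (snd j))"
       "gcd (nat (fst i)) (nat (snd i)) = gcd (nat (fst j)) (nat (snd j))"
      using ij(3) by (auto simp: \<phi>_def Let_def)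
    have "nat (fst i) = nat (fst j)" using e(1,3) by (metis dvd_div_mult_self gcd_dvd1)
    moreover have "nat (snd i) = nat (snd j)" using e(2,3) by (metis dvd_div_mult_self gcd_dvd2)
    ultimately show "i = j" using pos by (simp add: prod_eq_iff eq_nat_nat_iff)
  qed
  moreover have "\<phi> ` Pr \<subseteq> Tg"
  proof
    fix x assume "x \<in> \<phi> ` Pr"
    then obtain i where i: "i \<in> Pr" "x = \<phi> i" by blast
    define a b g where "a = nat (fst i)" and "b = nat (snd i)" and "g = gcd a b"
    have ia: "fst i = int a" "snd i = int b" using i by (auto simp: a_def b_def Pr_def mem_Times_iff)
    have ab: "1 \<le> a" "a \<le> h" "1 \<le> b" "b \<le> h" "[int a ^ t = int b ^ t] (mod int p)"
      using i ia by (auto simp: Pr_def mem_Times_iff)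
    have g0: "g > 0" using ab by (simp add: g_def)
    obtain u where u: "a = g * u" using g_def by (meson dvdE gcd_dvd1)
    obtain v where v: "b = g * v" using g_def by (meson dvdE gcd_dvd2)
    have cop: "coprime u v" using div_gcd_coprime[of a b] ab u v g0 unfolding g_def[symmetric] by simp
    have uv0: "u \<ge> 1" "v \<ge> 1" using ab u v by (auto simp: Suc_le_eq)
    have ugh: "g * u \<le> h" "g * v \<le> h" using ab u v by auto
    have uvh: "u \<le> h" "v \<le> h" "g \<le> h" using ugh g0 uv0
      by (metis dvd_imp_le dvd_triv_left dvd_triv_right le_trans mult_pos_pos less_le_trans zero_less_one)+
    have nd: "\<not> p dvd n" if "1 \<le> n" "n \<le> h" for n using that h by (auto dest!: dvd_imp_le)
    have "[a ^ t = b ^ t] (mod p)" using ab(5) by (metis cong_int_iff of_nat_power)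
    hence "[u ^ t = v ^ t] (mod p)" unfolding u v by (rule cancel_common_factor_pow) (use nd[of g] g0 uvh in auto)
    hence "(u, v) \<in> Fr h" using cop uv0 uvh nd by (simp add: Fr_def)
    moreover have "\<phi> i = ((u, v), g)"
    proof -
      have "a div g = u" "b div g = v" using u v g0 by auto
      thus ?thesis by (simp add: \<phi>_def Let_def flip: a_def b_def g_def)
    qed
    moreover have "g * max u v \<le> h" using ugh by (simp add: max_def)
    ultimately show "x \<in> Tg" using g0 by (simp add: i(2) Tg_def mx_def Suc_le_eq)
  qed
  moreover have "finite Tg" unfolding Tg_def using finite_Fr finS by (rule finite_SigmaI)
  ultimately have "card Pr \<le> card Tg" by (rule card_inj_on_le)
  also have "card Tg = (\<Sum>i\<in>Fr h. card {m. 1 \<le> m \<and> m * mx i \<le> h})"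
    unfolding Tg_def using finite_Fr finS by (intro card_SigmaI) auto
  also have "\<dots> \<le> (\<Sum>i\<in>Fr h. h div mx i)"
  proof (rule sum_mono)
    fix i assume "i \<in> Fr h"
    from card_mono[OF _ sub[OF this]] show "card {m. 1 \<le> m \<and> m * mx i \<le> h} \<le> h div mx i" by simp
  qed
  finally have "real (Nr h) \<le> real (\<Sum>i\<in>Fr h. h div mx i)"
    unfolding Nr_def Pr_def[symmetric] by (rule of_nat_mono)
  also have "\<dots> \<le> (\<Sum>i\<in>Fr h. real h * (1 / real (mx i)))"
    unfolding of_nat_sum
  proof (rule sum_mono)
    fix i assume "i \<in> Fr h"
    hence m: "real (mx i) > 0" using mx1 by fastforce
    have "real (h div mx i * mx i) \<le> real h" unfolding of_nat_le_iff by simp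
    thus "real (h div mx i) \<le> real h * (1 / real (mx i))" using m by (simp add: pos_le_divide_eq)
  qed
  also have "\<dots> = real h * (\<Sum>i\<in>Fr h. 1 / real (mx i))" by (simp only: sum_distrib_left)
  also have "(\<Sum>i\<in>Fr h. 1 / real (mx i)) \<le> K * (2 + ln (real h))"
  proof -
    have "(\<Sum>i\<in>Fr h. 1 / real (mx i)) = (\<Sum>i\<in>Fr h. (\<Sum>m=1..h. of_bool (mx i \<le> m) * (1 / (real m * real (m + 1)))) + 1 / real (h + 1))"
    proof (rule sum.cong[OF refl])
      fix i assume i: "i \<in> Fr h"
      have "(\<Sum>m=mx i..h. 1 / (real m * real (m + 1))) = (\<Sum>m=1..h. of_bool (mx i \<le> m) * (1 / (real m * real (m + 1))))"
        using mx1[OF i] by (intro sum.mono_neutral_cong_left) auto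
      thus "1 / real (mx i) = (\<Sum>m=1..h. of_bool (mx i \<le> m) * (1 / (real m * real (m + 1)))) + 1 / real (h + 1)"
        using sum_inverse_telescope[OF mx1[OF i]] by simp
    qed
    also have "\<dots> = (\<Sum>m=1..h. \<Sum>i\<in>Fr h. of_bool (mx i \<le> m) * (1 / (real m * real (m + 1)))) + real (card (Fr h)) * (1 / real (h + 1))"
      unfolding sum.distrib by (subst sum.swap) simp
    also have "\<dots> = (\<Sum>m=1..h. real (card (Fr m)) * (1 / (real m * real (m + 1)))) + real (card (Fr h)) * (1 / real (h + 1))"
    proof -
      have "(\<Sum>i\<in>Fr h. of_bool (mx i \<le> m) * (1 / (real m * real (m + 1)))) = real (card (Fr m)) * (1 / (real m * real (m + 1)))"
        if m: "m \<in> {1..h}" for m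
      proof -
        have "{i \<in> Fr h. mx i \<le> m} = Fr m" using m by (auto simp: Fr_def mx_def)
        thus ?thesis using sum_of_bool_card[OF finite_Fr[of h], of "\<lambda>i. mx i \<le> m"] by (simp only: sum_distrib_right[symmetric])
      qed
      thus ?thesis by simp
    qed
    also have "\<dots> \<le> (\<Sum>m=1..h. K * (1 / real m)) + K"
    proof (rule add_mono[OF sum_mono])
      fix m assume m: "m \<in> {1..h}"
      have "real (card (Fr m)) * (1 / (real m * real (m + 1))) \<le> (K * real m) * (1 / (real m * real (m + 1)))"
        using FK[of m] m by (intro mult_right_mono) auto
      also have "\<dots> = K * (1 / real (m + 1))" using m by simp
      also have "\<dots> \<le> K * (1 / real m)" using m K by (intro mult_left_mono frac_le) auto
      finally show "real (card (Fr m)) * (1 / (real m * real (m + 1))) \<le> K * (1 / real m)" .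
    next
      have "real (card (Fr h)) * (1 / real (h + 1)) \<le> (K * real h) * (1 / real (h + 1))"
        using FK[of h] h by (intro mult_right_mono) auto
      also have "\<dots> = K * (real h / real (h + 1))" by simp
      also have "\<dots> \<le> K * 1" using K by (intro mult_left_mono) auto
      finally show "real (card (Fr h)) * (1 / real (h + 1)) \<le> K" by simp
    qed
    also have "(\<Sum>m=1..h. K * (1 / real m)) \<le> K * (1 + ln (real h))"
      unfolding sum_distrib_left[symmetric] using K by (intro mult_left_mono harmonic_le h)
    finally show ?thesis by (simp add: algebra_simps)
  qed
  finally show ?thesis by (simp add: mult_left_mono mult.assoc)
qed

end

section \<open>The additive energy\<close>

lemma add_le_twice_max:
  fixes a b c :: real
  assumes "c \<le> a + b" obtains "c \<le> 2 * a" | "c \<le> 2 * b"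
  using assms by linarith

context stepanov_subgroup
begin

text \<open>Among at most 2L dyadic ranges of r the one carrying most of the second moment is kept.
  On it r^2 < 4\<Delta>^2, so the total loss is 8L.\<close>

lemma dyadic_level:
  obtains \<Delta> f where "\<Delta> \<ge> 1" "chi f" "\<And>x. f x = 1 \<Longrightarrow> \<Delta> \<le> r x"
    "(\<Sum>z\<in>U. (r z)\<^sup>2) \<le> 8 * L * \<Delta>\<^sup>2 * wt f"
proof -
  have p0: "real p > 1" using p_gt_1 by simp
  define n where "n = nat \<lfloor>log 2 (real p)\<rfloor> + 1"
  have lg0: "log 2 (real p) \<ge> 0" using p0 by simp
  have n2: "real n \<le> 2 * L"
  proof -
    have "real n \<le> log 2 (real p) + 1" unfolding n_def using lg0 by simp
    also have "log 2 (real p) \<le> 2 * ln (real p)"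
    proof -
      have ln2: "1 \<le> 2 * ln (2::real)" using ln_le_minus_one[of "1 / 2 :: real"] by (simp add: ln_div)
      have "1 * ln (real p) \<le> (2 * ln 2) * ln (real p)" using ln2 p0 by (intro mult_right_mono) auto
      thus ?thesis by (simp add: log_def pos_divide_le_eq mult_ac)
    qed
    finally show ?thesis unfolding L_def by simp
  qed
  have pn: "real p < 2 ^ n"
  proof -
    have "log 2 (real p) < real n" unfolding n_def using lg0 by linarith
    hence "real p < 2 powr real n" using p0 by (simp add: log_less_iff)
    thus ?thesis by (simp add: powr_realpow)
  qed
  define f :: "nat \<Rightarrow> int \<Rightarrow> real" where "f i x = of_bool (\<not> int p dvd x \<and> 2 ^ i \<le> r x \<and> r x < 2 ^ Suc i)" for i x
  have chi_f: "chi (f i)" for i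
    unfolding chi_def
  proof (intro conjI allI impI)
    show "per (f i)"
    proof (rule perI)
      fix x y :: int assume xy: "[x = y] (mod int p)"
      have "int p dvd x \<longleftrightarrow> int p dvd y" using xy by (rule cong_dvd_iff)
      thus "f i x = f i y" unfolding f_def using perD[OF per_rt xy] by simp
    qed
    fix g x assume g: "\<gamma> g = 1"
    thus "f i (g * x) = f i x" unfolding f_def using \<gamma>_not_dvd[OF g] by (simp add: rt_mult_right[OF g] dvd_mult_p)
  qed (auto simp: f_def)
  have "(\<Sum>z\<in>U. (r z)\<^sup>2) \<le> (\<Sum>z\<in>U. \<Sum>i<n. 4 * (2 ^ i)\<^sup>2 * f i z)"
  proof (rule sum_mono)
    fix z assume z: "z \<in> U"
    have nn: "0 \<le> 4 * (2 ^ i)\<^sup>2 * f i z" for i by (simp add: f_def)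
    show "(r z)\<^sup>2 \<le> (\<Sum>i<n. 4 * (2 ^ i)\<^sup>2 * f i z)"
    proof (cases "r z = 0")
      case True
      thus ?thesis using nn by (simp add: sum_nonneg)
    next
      case False
      obtain m where m: "r z = real m" using rt_Nats[of 1 z] by (auto elim: Nats_cases)
      have m1: "m \<ge> 1" using False m by (cases m) auto
      obtain i where i: "2 ^ i \<le> m" "m < 2 ^ Suc i" using ex_power_ivl1[of 2 m] m1 by auto
      have ir: "2 ^ i \<le> r z" "r z < 2 ^ Suc i"
        using i unfolding m by (metis of_nat_le_iff of_nat_less_iff of_nat_numeral of_nat_power)+
      have "(2::real) ^ i < 2 ^ n" using ir(1) rt_le_p[of 1 z] pn by linarith
      hence "i < n" by simp
      have "(r z)\<^sup>2 \<le> (2 ^ Suc i)\<^sup>2" using ir by (intro power_mono) auto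
      also have "\<dots> = 4 * (2 ^ i)\<^sup>2 * f i z" using ir z U_iff by (simp add: f_def power2_eq_square)
      also have "\<dots> \<le> (\<Sum>i<n. 4 * (2 ^ i)\<^sup>2 * f i z)"
        using \<open>i < n\<close> nn by (intro member_le_sum) auto
      finally show ?thesis .
    qed
  qed
  also have "\<dots> = (\<Sum>i<n. 4 * (2 ^ i)\<^sup>2 * wt (f i))"
  proof -
    have "wt (f i) = (\<Sum>z\<in>U. f i z)" for i unfolding wt_def by (rule sum_F_eq_U) (simp add: f_def)
    thus ?thesis by (subst sum.swap) (simp add: sum_distrib_left)
  qed
  finally have le: "(\<Sum>z\<in>U. (r z)\<^sup>2) \<le> (\<Sum>i<n. 4 * (2 ^ i)\<^sup>2 * wt (f i))" .
  have n0: "n > 0" by (simp add: n_def)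
  obtain i where i: "i < n" "\<And>j. j < n \<Longrightarrow> 4 * (2 ^ j)\<^sup>2 * wt (f j) \<le> 4 * (2 ^ i)\<^sup>2 * wt (f i)"
  proof -
    define g where "g i = 4 * (2 ^ i)\<^sup>2 * wt (f i)" for i :: nat
    have "Max (g ` {..<n}) \<in> g ` {..<n}" using n0 by (intro Max_in) auto
    then obtain i where "i < n" "g i = Max (g ` {..<n})" by auto
    moreover from this have "g j \<le> g i" if "j < n" for j using that by simp
    ultimately show ?thesis using that unfolding g_def by blast
  qed
  have "(\<Sum>i<n. 4 * (2 ^ i)\<^sup>2 * wt (f i)) \<le> (\<Sum>j<n. 4 * (2 ^ i)\<^sup>2 * wt (f i))" using i(2) by (intro sum_mono) auto
  also have "\<dots> = real n * (4 * (2 ^ i)\<^sup>2 * wt (f i))" by simp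
  also have "\<dots> \<le> (2 * L) * (4 * (2 ^ i)\<^sup>2 * wt (f i))" using n2 wt_nonneg[OF chi_f] by (intro mult_right_mono) auto
  finally have "(\<Sum>z\<in>U. (r z)\<^sup>2) \<le> 8 * L * (2 ^ i)\<^sup>2 * wt (f i)" using le by simp
  thus ?thesis using that[of "2 ^ i" "f i"] chi_f by (auto simp: f_def)
qed

lemma wt_eq_card:
  assumes "chi f" shows "wt f = real (card {x \<in> U. f x = 1})"
proof -
  have "wt f = (\<Sum>x\<in>U. f x)" unfolding wt_def by (rule sum_F_eq_U) (rule chiD(3)[OF assms])
  also have "\<dots> = (\<Sum>x\<in>U. of_bool (f x = 1))"
    by (rule sum.cong[OF refl]) (use chiD(2)[OF assms] in auto)
  also have "\<dots> = real (card {x \<in> U. f x = 1})" by (rule sum_of_bool_card) simp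
  finally show ?thesis .
qed

text \<open>Here t^3 <= p^2 makes the low values, which contribute about t^6/p^2, no larger than the
  Stepanov range.\<close>

lemma E3b_le: assumes t3: "real t ^ 3 \<le> real p ^ 2" shows "E3b \<le> 10 ^ 11 * L * real t ^ 3"
proof -
  have L1: "L \<ge> 1" by (rule L_ge_1)
  have p0: "real p > 0" using p_gt_1 by simp
  have "(1936 * real t ^ 2 / real p) ^ 3 * real p = 1936 ^ 3 * (real t ^ 3 * (real t ^ 3 / real p ^ 2))"
    using p0 by (simp add: power_mult_distrib power_divide power2_eq_square eval_nat_numeral)
  also have "\<dots> \<le> 1936 ^ 3 * (real t ^ 3 * 1)" using t3 p0 by (intro mult_left_mono) auto
  finally have "3 * ((1936 * real t ^ 2 / real p) ^ 3 * real p) \<le> 3 * (1936 ^ 3 * (real t ^ 3 * 1))" by (rule mult_left_mono) simp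
  also have "\<dots> \<le> 3 * (1936 ^ 3 * (real t ^ 3 * L))" using L1 by (intro mult_left_mono) auto
  finally have "E3b \<le> 3 * (442368 * real t ^ 3) * L + 3 * (1936 ^ 3 * (real t ^ 3 * L))"
    unfolding E3b_def mult.assoc[of 3] by linarith
  also have "\<dots> = (3 * 442368 + 3 * 1936 ^ 3) * (real t ^ 3 * L)" by (simp add: mult.assoc)
  also have "\<dots> \<le> 10 ^ 11 * (real t ^ 3 * L)" using L1 by (intro mult_right_mono) auto
  finally show ?thesis by (simp add: mult_ac)
qed

lemma E3b_nonneg: "E3b \<ge> 0"
proof -
  have "0 \<le> (\<Sum>z\<in>U. r z ^ 3)" by (intro sum_nonneg) auto
  thus ?thesis using sum_r_cubed by linarith
qed

text \<open>In contrast to \<open>E3b\<close>, the low values dominate: p <= t^2 gives t^4 <=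
  t^6/p.\<close>

lemma R3b_le: "R3b + real t ^ 4 \<le> 10 ^ 11 * L * (real t ^ 6 / real p)"
proof -
  have L1: "L \<ge> 1" by (rule L_ge_1)
  have p0: "real p > 0" using p_gt_1 by simp
  have pt: "real p \<le> real t ^ 2" using p_le_t2 by (metis of_nat_le_iff of_nat_power)
  define B where "B = real t ^ 6 / real p"
  have t4: "real t ^ 4 \<le> B"
    using mult_left_mono[OF pt, of "real t ^ 4"] p0 by (simp add: B_def field_simps flip: power_add)
  have B0: "B \<ge> 0" by (simp add: B_def)
  have "(1936 * real t ^ 2 / real p) ^ 3 * (real p)\<^sup>2 = 1936 ^ 3 * B"
    unfolding B_def using p0 by (simp add: power_mult_distrib power_divide power2_eq_square eval_nat_numeral)
  hence "R3b + real t ^ 4 = 3 * (442368 * real t ^ 4) * L + 3 * (1936 ^ 3 * B) + real t ^ 4"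
    unfolding R3b_def mult.assoc[of 3] by simp
  also have "\<dots> \<le> 3 * (442368 * B) * L + 3 * (1936 ^ 3 * B) + B"
    using t4 L1 by (intro add_mono mult_right_mono mult_left_mono) auto
  also have "\<dots> = (3 * 442368) * (B * L) + (3 * 1936 ^ 3 + 1) * (B * 1)" by simp
  also have "\<dots> \<le> (3 * 442368) * (B * L) + (3 * 1936 ^ 3 + 1) * (B * L)"
    using L1 B0 by (intro add_mono mult_left_mono order_refl) auto
  also have "\<dots> = (3 * 442368 + (3 * 1936 ^ 3 + 1)) * (B * L)" by (simp only: distrib_right)
  also have "\<dots> \<le> 10 ^ 11 * (B * L)" using L1 B0 by (intro mult_right_mono) auto
  finally show ?thesis by (simp add: B_def mult_ac)
qed

lemma Rb_le:
  assumes f: "chi f" and D0: "\<Delta> > 0" and lev: "\<And>x. f x = 1 \<Longrightarrow> \<Delta> \<le> r x" and w: "w = wt f"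
  shows "Rb f \<le> 10 ^ 19 * (L ^ 5 * (w\<^sup>2 * real t ^ 6 / (real p * \<Delta> ^ 4)) + w ^ 6 / real p ^ 2)"
proof -
  have L1: "L \<ge> 1" by (rule L_ge_1)
  have p0: "real p > 0" using p_gt_1 by simp
  have t0: "real t > 0" using t_pos by simp
  have "Xi f * \<Delta> ^ 4 \<le> real t ^ 2 * (R3b + real t ^ 4)" by (rule Xi_le[OF f D0 lev])
  also have "\<dots> \<le> real t ^ 2 * (10 ^ 11 * L * (real t ^ 6 / real p))" by (intro mult_left_mono R3b_le) auto
  finally have Xi: "Xi f \<le> real t ^ 2 * (10 ^ 11 * L * (real t ^ 6 / real p)) / \<Delta> ^ 4"
    using D0 by (simp only: pos_le_divide_eq zero_less_power)
  have alg: "(c * L ^ 4 * w ^ 2 / T) * (T * (e * L * (s / q)) / D) = (c * e) * (L ^ 5 * (w\<^sup>2 * s / (q * D)))"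
    if "T \<noteq> 0" "q \<noteq> 0" "D \<noteq> 0" for c e T s q D :: real
  proof -
    have "L ^ 5 = L ^ 4 * L" by (simp add: eval_nat_numeral)
    thus ?thesis using that by (simp add: field_simps)
  qed
  have "3 * (8 * 442368 * L ^ 3 * w ^ 2 * Xi f / real t ^ 2) * L = (24 * 442368 * L ^ 4 * w ^ 2 / real t ^ 2) * Xi f"
    by (simp add: eval_nat_numeral)
  also have "\<dots> \<le> (24 * 442368 * L ^ 4 * w ^ 2 / real t ^ 2) * (real t ^ 2 * (10 ^ 11 * L * (real t ^ 6 / real p)) / \<Delta> ^ 4)"
    using L1 by (intro mult_left_mono Xi) auto
  also have "\<dots> = (24 * 442368 * 10 ^ 11) * (L ^ 5 * (w\<^sup>2 * real t ^ 6 / (real p * \<Delta> ^ 4)))"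
    by (rule alg) (use t0 p0 D0 in auto)
  also have "\<dots> \<le> 10 ^ 19 * (L ^ 5 * (w\<^sup>2 * real t ^ 6 / (real p * \<Delta> ^ 4)))"
    using L1 p0 D0 by (intro mult_right_mono) auto
  finally have 1: "3 * (8 * 442368 * L ^ 3 * w ^ 2 * Xi f / real t ^ 2) * L \<le> 10 ^ 19 * (L ^ 5 * (w\<^sup>2 * real t ^ 6 / (real p * \<Delta> ^ 4)))" .
  have "3 * (3872 * w ^ 2 / real p) ^ 3 * real p = (3 * 3872 ^ 3) * (w ^ 6 / real p ^ 2)"
    using p0 by (simp add: power_mult_distrib power_divide eval_nat_numeral)
  also have "\<dots> \<le> 10 ^ 19 * (w ^ 6 / real p ^ 2)" by (intro mult_right_mono) auto
  finally show ?thesis unfolding Rb_def w[symmetric] distrib_left using 1 by linarith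
qed

text \<open>For this \<mu> both third-moment terms are at most 10^19 L \<mu> t^3, so a single
  summand replaces them.\<close>

lemma balanced_level_inequality:
  assumes f: "chi f" and D0: "\<Delta> > 0" and lev: "\<And>x. f x = 1 \<Longrightarrow> \<Delta> \<le> r x" and w: "w = wt f"
    and t3: "real t ^ 3 \<le> real p ^ 2" and \<mu>0: "\<mu> > 0"
    and \<mu>3: "\<mu> ^ 3 * real t ^ 3 = L ^ 5 * (w\<^sup>2 * real t ^ 6 / (real p * \<Delta> ^ 4)) + w ^ 6 / real p ^ 2"
  shows "((\<Delta> * w / real t)\<^sup>2 * En / real t)\<^sup>2 \<le> (2 * 10 ^ 11 * L * real t ^ 3) * (w * real t ^ 2) +
          (2 * 10 ^ 11 * L * real t ^ 3) * (2 * 10 ^ 19 * L * (\<mu> * real t ^ 3))"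
proof -
  have L1: "L \<ge> 1" by (rule L_ge_1)
  have w0: "w \<ge> 0" unfolding w by (rule wt_nonneg[OF f])
  note E3 = E3b_le[OF t3]
  define m where "m = \<mu> * real t ^ 3"
  have m0: "m \<ge> 0" using \<mu>0 by (simp add: m_def)
  have "((\<Delta> * w / real t)\<^sup>2 * En / real t)\<^sup>2 \<le> (real t ^ 3 + E3b) * (w * real t ^ 2 + Rb f / \<mu>\<^sup>2 + \<mu> * E3b)"
    unfolding w by (rule energy_level_inequality[OF f D0 lev \<mu>0])
  also have "\<dots> \<le> (2 * 10 ^ 11 * L * real t ^ 3) * (w * real t ^ 2 + 2 * 10 ^ 19 * L * m)"
  proof (rule mult_mono)
    have "1 * real t ^ 3 \<le> (10 ^ 11 * L) * real t ^ 3" using L1 by (intro mult_right_mono) auto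
    thus "real t ^ 3 + E3b \<le> 2 * 10 ^ 11 * L * real t ^ 3" using E3 by linarith
    have "Rb f / \<mu>\<^sup>2 \<le> 10 ^ 19 * (\<mu> ^ 3 * real t ^ 3) / \<mu>\<^sup>2"
      unfolding \<mu>3 by (intro divide_right_mono Rb_le[OF f D0 lev w]) auto
    also have "\<dots> = 10 ^ 19 * 1 * m" using \<mu>0 by (simp add: m_def power2_eq_square power3_eq_cube)
    also have "\<dots> \<le> 10 ^ 19 * L * m" using L1 m0 by (intro mult_right_mono mult_left_mono) auto
    finally have 1: "Rb f / \<mu>\<^sup>2 \<le> 10 ^ 19 * L * m" .
    have "\<mu> * E3b \<le> \<mu> * (10 ^ 11 * L * real t ^ 3)" using \<mu>0 by (intro mult_left_mono E3) auto
    also have "\<dots> = 10 ^ 11 * L * m" by (simp add: m_def)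
    also have "\<dots> \<le> 10 ^ 19 * L * m" using L1 m0 by (intro mult_right_mono) auto
    finally show "w * real t ^ 2 + Rb f / \<mu>\<^sup>2 + \<mu> * E3b \<le> w * real t ^ 2 + 2 * 10 ^ 19 * L * m"
      using 1 by linarith
    have "0 \<le> (\<Sum>z\<in>U. rho f z ^ 3)"
    proof (intro sum_nonneg zero_le_power)
      fix z show "rho f z \<ge> 0" using rho_Nats[OF f, of z] by (auto elim: Nats_cases)
    qed
    hence "Rb f \<ge> 0" using sum_rho_cubed[OF f] by linarith
    thus "0 \<le> w * real t ^ 2 + Rb f / \<mu>\<^sup>2 + \<mu> * E3b" using w0 \<mu>0 E3b_nonneg by simp
  qed (use L1 in simp)
  finally show ?thesis unfolding m_def by (simp only: distrib_left)
qed

text \<open>K absorbs all constants and powers of L. In \<open>diag\<close> the difference 0 carries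
  the energy. In \<open>generic\<close> the dominant level lies below Stepanov's cutoff, so the
  energy is bounded by the size t^4/p expected of a random set. In \<open>level\<close> the
  inequality for the dominant level is split according to which of its summands is larger.\<close>

lemma energy_cases:
  assumes big: "10 ^ 30 * L ^ 10 \<le> K" and t3: "real t ^ 3 \<le> real p ^ 2"
  obtains (diag) "En \<le> K * real t ^ 2"
    | (generic) "En \<le> K * real t ^ 4 / real p"
    | (level) \<Delta> w where "\<Delta> > 0" "w > 0" "En \<le> K * \<Delta> ^ 2 * w" "w * \<Delta> ^ 3 \<le> K * real t ^ 3"
       "(\<Delta> * w) ^ 4 * En ^ 2 \<le> K * real t ^ 11 * w \<or>
        (\<exists>\<mu>>0. (\<Delta> * w) ^ 4 * En ^ 2 \<le> K * real t ^ 12 * \<mu> \<and>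
           (\<mu> ^ 3 * \<Delta> ^ 4 * real p \<le> K * real t ^ 3 * w ^ 2 \<or> \<mu> ^ 3 * real t ^ 3 * real p ^ 2 \<le> K * w ^ 6))"
proof -
  have L1: "L \<ge> 1" by (rule L_ge_1)
  have p0: "real p > 0" using p_gt_1 by simp
  have t0: "real t \<ge> 1" using t_pos by simp
  have pt: "real p \<le> real t ^ 2" using p_le_t2 by (metis of_nat_le_iff of_nat_power)
  have Lk: "L ^ i \<le> L ^ 10" if "i \<le> 10" for i using L1 that by (intro power_increasing)
  have KL: "c * L ^ i \<le> K" if "i \<le> 10" "0 \<le> c" "c \<le> 10 ^ 30" for c i
  proof -
    have "c * L ^ i \<le> 10 ^ 30 * L ^ 10" using that Lk[OF that(1)] L1 by (intro mult_mono) auto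
    thus ?thesis using big by linarith
  qed
  have K1: "c \<le> K" if "0 \<le> c" "c \<le> 10 ^ 30" for c using KL[of 0 c] that by simp
  have K0: "K > 0" using K1[of 1] by simp
  obtain \<Delta> f where f: "\<Delta> \<ge> 1" "chi f" "\<And>x. f x = 1 \<Longrightarrow> \<Delta> \<le> r x"
    "(\<Sum>z\<in>U. (r z)\<^sup>2) \<le> 8 * L * \<Delta>\<^sup>2 * wt f" using dyadic_level by blast
  define w where "w = wt f"
  have w0: "w \<ge> 0" unfolding w_def by (rule wt_nonneg[OF f(2)])
  have wp: "w \<le> real p" unfolding w_def by (rule wt_le_p[OF f(2)])
  have En: "En = real t ^ 2 + (\<Sum>z\<in>U. (r z)\<^sup>2)" unfolding En_def F_split by (simp add: r_0)
  have D0: "\<Delta> > 0" using f(1) by simp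
  show thesis
  proof (cases "(\<Sum>z\<in>U. (r z)\<^sup>2) \<le> real t ^ 2")
    case True
    have "En \<le> 2 * real t ^ 2" using True En by simp
    also have "\<dots> \<le> K * real t ^ 2" using K1[of 2] by (intro mult_right_mono) auto
    finally show thesis by (rule diag)
  next
    case False
    have E16: "En \<le> 16 * L * \<Delta>\<^sup>2 * w" using False En f(4) unfolding w_def by linarith
    have wpos: "w > 0"
    proof (rule ccontr)
      assume "\<not> w > 0"
      hence "w = 0" using w0 by simp
      hence "(\<Sum>z\<in>U. (r z)\<^sup>2) \<le> 0" using f(4) unfolding w_def by simp
      thus False using False t0 by (smt (verit) zero_le_power)
    qed
    show thesis
    proof (cases "\<Delta> > 1936 * real t ^ 2 / real p")
      case False
      have "\<Delta>\<^sup>2 * w \<le> (1936 * real t ^ 2 / real p)\<^sup>2 * real p"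
        using False D0 w0 wp by (intro mult_mono power_mono) auto
      also have "\<dots> = 1936\<^sup>2 * (real t ^ 4 / real p)" using p0 by (simp add: power_mult_distrib power_divide power2_eq_square eval_nat_numeral)
      finally have "16 * L * (\<Delta>\<^sup>2 * w) \<le> 16 * L * (1936\<^sup>2 * (real t ^ 4 / real p))" using L1 by (intro mult_left_mono) auto
      also have "\<dots> = (16 * 1936\<^sup>2 * L ^ 1) * (real t ^ 4 / real p)" by simp
      also have "\<dots> \<le> K * (real t ^ 4 / real p)" by (intro mult_right_mono KL) auto
      finally have "En \<le> K * real t ^ 4 / real p" using E16 by (simp add: mult.assoc)
      thus thesis by (rule generic)
    next
      case True
      have "w \<le> real (card {z \<in> U. \<Delta> \<le> r z})"
        unfolding w_def wt_eq_card[OF f(2)] of_nat_le_iff using f(3) by (intro card_mono) (auto intro: finite_subset[of _ U])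
      hence "w * \<Delta> ^ 3 \<le> real (card {z \<in> U. \<Delta> \<le> r z}) * \<Delta> ^ 3" using D0 by (intro mult_right_mono) auto
      also have "\<dots> \<le> 442368 * real t ^ 3" by (rule card_rich_r[OF D0 True])
      also have "\<dots> \<le> K * real t ^ 3" by (intro mult_right_mono K1) auto
      finally have wD: "w * \<Delta> ^ 3 \<le> K * real t ^ 3" .
      have EK: "En \<le> K * \<Delta> ^ 2 * w"
      proof -
        have "16 * L ^ 1 \<le> K" by (rule KL) auto
        hence "16 * L * (\<Delta>\<^sup>2 * w) \<le> K * (\<Delta>\<^sup>2 * w)" using w0 by (intro mult_right_mono) auto
        thus ?thesis using E16 by (simp add: mult.assoc)
      qed
      \<comment> \<open>the value of \<open>\<mu>\<close> balances the two terms \<open>Rb f / \<mu>\<^sup>2\<close> and \<open>\<mu> * E3b\<close>\<close>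
      define Y where "Y = L ^ 5 * (w\<^sup>2 * real t ^ 6 / (real p * \<Delta> ^ 4)) + w ^ 6 / real p ^ 2"
      have Y0: "Y > 0" unfolding Y_def using L1 wpos t0 p0 D0 by (intro add_pos_pos mult_pos_pos divide_pos_pos) auto
      define \<mu> where "\<mu> = root 3 (Y / real t ^ 3)"
      have \<mu>0: "\<mu> > 0" unfolding \<mu>_def using Y0 t0 by simp
      have \<mu>3: "\<mu> ^ 3 * real t ^ 3 = Y" unfolding \<mu>_def using Y0 t0 by (simp add: real_root_pow_pos2)
      have main: "((\<Delta> * w / real t)\<^sup>2 * En / real t)\<^sup>2 \<le> (2 * 10 ^ 11 * L * real t ^ 3) * (w * real t ^ 2) +
          (2 * 10 ^ 11 * L * real t ^ 3) * (2 * 10 ^ 19 * L * (\<mu> * real t ^ 3))"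
        by (rule balanced_level_inequality[OF f(2) D0 f(3) w_def t3 \<mu>0]) (use \<mu>3 Y_def in auto)
      have lhs: "((\<Delta> * w / real t)\<^sup>2 * En / real t)\<^sup>2 = (\<Delta> * w) ^ 4 * En ^ 2 / real t ^ 6"
        by (simp add: power_mult_distrib power_divide flip: power_mult power_add)
      have mv: "(\<Delta> * w) ^ 4 * En ^ 2 \<le> c * real t ^ 6" if "((\<Delta> * w / real t)\<^sup>2 * En / real t)\<^sup>2 \<le> c" for c
        using that t0 unfolding lhs by (simp add: pos_divide_le_eq)
      from main show thesis
      proof (cases rule: add_le_twice_max)
        case 1
        from mv[OF this] have "(\<Delta> * w) ^ 4 * En ^ 2 \<le> (4 * 10 ^ 11 * L ^ 1) * (real t ^ 11 * w)"
          by (simp add: eval_nat_numeral mult_ac)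
        also have "\<dots> \<le> K * (real t ^ 11 * w)" using w0 by (intro mult_right_mono KL) auto
        finally show thesis using level[OF D0 wpos EK wD] by (simp add: mult.assoc)
      next
        case 2
        from mv[OF this] have "(\<Delta> * w) ^ 4 * En ^ 2 \<le> (8 * 10 ^ 30 * L ^ 2) * (real t ^ 12 * \<mu>)"
          by (simp add: eval_nat_numeral mult_ac)
        also have "\<dots> \<le> (8 * K) * (real t ^ 12 * \<mu>)"
        proof (intro mult_right_mono)
          have "10 ^ 30 * L ^ 2 \<le> K" by (rule KL) auto
          thus "8 * 10 ^ 30 * L ^ 2 \<le> 8 * K" by simp
        qed (use \<mu>0 in auto)
        \<comment> \<open>The constant 8 from 2 * (2 * 10^11) * (2 * 10^19) is moved into \<mu>,
          since K absorbs only 10^30.\<close>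
        finally have m1: "(\<Delta> * w) ^ 4 * En ^ 2 \<le> K * real t ^ 12 * (8 * \<mu>)" by (simp add: mult_ac)
        have "Y \<le> L ^ 5 * (w\<^sup>2 * real t ^ 6 / (real p * \<Delta> ^ 4)) + w ^ 6 / real p ^ 2" by (simp add: Y_def)
        hence "(8 * \<mu>) ^ 3 * \<Delta> ^ 4 * real p \<le> K * real t ^ 3 * w ^ 2 \<or> (8 * \<mu>) ^ 3 * real t ^ 3 * real p ^ 2 \<le> K * w ^ 6"
        proof (cases rule: add_le_twice_max)
          case 1
          hence "\<mu> ^ 3 * real t ^ 3 * (real p * \<Delta> ^ 4) \<le> 2 * L ^ 5 * (w\<^sup>2 * real t ^ 6)"
            unfolding \<mu>3 using p0 D0 by (simp add: field_simps)
          hence "real t ^ 3 * (\<mu> ^ 3 * \<Delta> ^ 4 * real p) \<le> real t ^ 3 * (2 * L ^ 5 * (w\<^sup>2 * real t ^ 3))"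
            by (simp add: mult_ac flip: power_add)
          hence "\<mu> ^ 3 * \<Delta> ^ 4 * real p \<le> 2 * L ^ 5 * (w\<^sup>2 * real t ^ 3)" using t0 by (subst (asm) mult_le_cancel_left_pos) auto
          hence "(8 * \<mu>) ^ 3 * \<Delta> ^ 4 * real p \<le> (1024 * L ^ 5) * (w\<^sup>2 * real t ^ 3)" by (simp add: power_mult_distrib mult_ac)
          also have "\<dots> \<le> K * (w\<^sup>2 * real t ^ 3)" by (intro mult_right_mono KL) auto
          finally show ?thesis by (simp add: mult_ac)
        next
          case 2
          hence "\<mu> ^ 3 * real t ^ 3 * real p ^ 2 \<le> 2 * w ^ 6" unfolding \<mu>3 using p0 by (simp add: field_simps)
          hence "(8 * \<mu>) ^ 3 * real t ^ 3 * real p ^ 2 \<le> 1024 * w ^ 6" by (simp add: power_mult_distrib mult_ac)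
          also have "\<dots> \<le> K * w ^ 6" by (intro mult_right_mono K1) auto
          finally show ?thesis by simp
        qed
        thus thesis using level[OF D0 wpos EK wD] m1 \<mu>0 by (metis mult_pos_pos zero_less_numeral)
      qed
    qed
  qed
qed

lemma En_pos: "En > 0"
proof -
  have "En \<ge> (r 0)\<^sup>2" unfolding En_def F_split using sum_nonneg[of U "\<lambda>z. (r z)\<^sup>2"] by simp
  moreover have "(r 0)\<^sup>2 > 0" using t_pos by (simp add: r_0)
  ultimately show ?thesis by linarith
qed

text \<open>In logarithms the level inequalities are linear, and \<Delta>, w and \<mu> can be
  eliminated. At t = p^(1/2) the last three alternatives give the exponents 17/7, 49/20 and 29/12 of
  t; the largest is 49/20.\<close>

lemma energy_log_bound:
  assumes big: "10 ^ 30 * L ^ 10 \<le> K" and t3: "real t ^ 3 \<le> real p ^ 2"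
  defines "lE \<equiv> ln En" and "lt \<equiv> ln (real t)" and "P \<equiv> ln (real p)" and "k \<equiv> ln K"
  shows "lE \<le> 2 * lt + k \<or> lE \<le> 4 * lt - P + k \<or> 7 * lE \<le> 17 * lt + 10 * k \<or>
    20 * lE \<le> 51 * lt - P + 30 * k \<or> 12 * lE \<le> 33 * lt - 2 * P + 30 * k"
proof -
  have p0: "real p > 0" using p_gt_1 by simp
  have t0: "real t > 0" using t_pos by simp
  have "1 \<le> L ^ 10" using L_ge_1 by simp
  hence "1 * 1 \<le> 10 ^ 30 * L ^ 10" by (intro mult_mono) auto
  hence K1: "1 \<le> K" using big by linarith
  hence K0: "K > 0" by linarith
  have k0: "k \<ge> 0" unfolding k_def using K1 by (rule ln_ge_zero)
  note E0 = En_pos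
  show ?thesis
  proof (cases rule: energy_cases[OF big t3])
    case 1
    hence "ln En \<le> ln (K * real t ^ 2)" using E0 by (intro ln_mono) auto
    thus ?thesis using K0 t0 by (simp add: lE_def lt_def k_def ln_mult ln_realpow)
  next
    case 2
    hence "ln En \<le> ln (K * real t ^ 4 / real p)" using E0 by (intro ln_mono) auto
    thus ?thesis using K0 t0 p0 by (simp add: lE_def lt_def k_def P_def ln_mult ln_div ln_realpow)
  next
    case (3 \<Delta> w)
    define d lw where "d = ln \<Delta>" and "lw = ln w"
    have "ln En \<le> ln (K * \<Delta> ^ 2 * w)" using 3 E0 by (intro ln_mono) auto
    hence i1: "lE \<le> k + 2 * d + lw" using K0 3 by (simp add: lE_def k_def d_def lw_def ln_mult ln_realpow)
    have "ln (w * \<Delta> ^ 3) \<le> ln (K * real t ^ 3)" using 3 by (intro ln_mono) auto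
    hence i2: "lw + 3 * d \<le> k + 3 * lt" using K0 t0 3 by (simp add: lt_def k_def d_def lw_def ln_mult ln_realpow)
    have lhs: "ln ((\<Delta> * w) ^ 4 * En ^ 2) = 4 * d + 4 * lw + 2 * lE"
      using 3 E0 by (simp add: lE_def d_def lw_def ln_mult ln_realpow)
    have pos: "(\<Delta> * w) ^ 4 * En ^ 2 > 0" using 3 E0 by simp
    from 3(5) show ?thesis
    proof
      assume "(\<Delta> * w) ^ 4 * En ^ 2 \<le> K * real t ^ 11 * w"
      hence "ln ((\<Delta> * w) ^ 4 * En ^ 2) \<le> ln (K * real t ^ 11 * w)" using pos by (intro ln_mono) auto
      hence "4 * d + 4 * lw + 2 * lE \<le> k + 11 * lt + lw"
        unfolding lhs using K0 t0 3 by (simp add: lt_def k_def lw_def ln_mult ln_realpow)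
      \<comment> \<open>Five times \<open>i1\<close>, twice \<open>i2\<close> and the new inequality
        once eliminate d and lw.\<close>
      hence "7 * lE \<le> 17 * lt + 10 * k" using i1 i2 k0 by linarith
      thus ?thesis by blast
    next
      assume "\<exists>\<mu>>0. (\<Delta> * w) ^ 4 * En ^ 2 \<le> K * real t ^ 12 * \<mu> \<and>
           (\<mu> ^ 3 * \<Delta> ^ 4 * real p \<le> K * real t ^ 3 * w ^ 2 \<or> \<mu> ^ 3 * real t ^ 3 * real p ^ 2 \<le> K * w ^ 6)"
      then obtain \<mu> where \<mu>: "\<mu> > 0" "(\<Delta> * w) ^ 4 * En ^ 2 \<le> K * real t ^ 12 * \<mu>"
        "\<mu> ^ 3 * \<Delta> ^ 4 * real p \<le> K * real t ^ 3 * w ^ 2 \<or> \<mu> ^ 3 * real t ^ 3 * real p ^ 2 \<le> K * w ^ 6" by blast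
      define m where "m = ln \<mu>"
      have "ln ((\<Delta> * w) ^ 4 * En ^ 2) \<le> ln (K * real t ^ 12 * \<mu>)" using pos \<mu>(2) by (intro ln_mono) auto
      hence i3: "4 * d + 4 * lw + 2 * lE \<le> k + 12 * lt + m"
        unfolding lhs using K0 t0 \<mu> by (simp add: lt_def k_def m_def ln_mult ln_realpow)
      from \<mu>(3) show ?thesis
      proof
        assume "\<mu> ^ 3 * \<Delta> ^ 4 * real p \<le> K * real t ^ 3 * w ^ 2"
        hence "ln (\<mu> ^ 3 * \<Delta> ^ 4 * real p) \<le> ln (K * real t ^ 3 * w ^ 2)" using \<mu> 3 p0 by (intro ln_mono) auto
        hence "3 * m + 4 * d + P \<le> k + 3 * lt + 2 * lw"
          using K0 t0 \<mu> 3 p0 by (simp add: lt_def k_def m_def d_def lw_def P_def ln_mult ln_realpow)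
        \<comment> \<open>Three times \<open>i3\<close> plus the new inequality removes m; adding 14
          times \<open>i1\<close> and 4 times \<open>i2\<close> removes d and lw.\<close>
        hence "20 * lE \<le> 51 * lt - P + 30 * k" using i1 i2 i3 k0 by linarith
        thus ?thesis by blast
      next
        assume "\<mu> ^ 3 * real t ^ 3 * real p ^ 2 \<le> K * w ^ 6"
        hence "ln (\<mu> ^ 3 * real t ^ 3 * real p ^ 2) \<le> ln (K * w ^ 6)" using \<mu> t0 p0 by (intro ln_mono) auto
        hence "3 * m + 3 * lt + 2 * P \<le> k + 6 * lw"
          using K0 t0 \<mu> 3 p0 by (simp add: lt_def k_def m_def lw_def P_def ln_mult ln_realpow)
        \<comment> \<open>Three times \<open>i3\<close>, the new inequality and 6 times
          \<open>i1\<close> already cancel m, d and lw.\<close>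
        hence "12 * lE \<le> 33 * lt - 2 * P + 30 * k" using i1 i2 i3 k0 by linarith
        thus ?thesis by blast
      qed
    qed
  qed
qed

end

section \<open>Short sums are small\<close>

context mult_subgroup
begin

section \<open>Counting fractions of small height\<close>

lemma card_Fr_le_square: "real (card (Fr R)) \<le> real R ^ 2"
proof -
  have "card (Fr R) \<le> card ({1..R} \<times> {1..R})" by (rule card_mono) (auto simp: Fr_def)
  also have "\<dots> = R ^ 2" by (simp add: card_cartesian_product power2_eq_square)
  finally have "real (card (Fr R)) \<le> real (R ^ 2)" unfolding of_nat_le_iff .
  thus ?thesis by simp
qed

text \<open>The n-th power of the count is compared with fractions of height R^n, which is near
  p^(1/2); the deviation costs p^(n/160), hence p^(1/160) after the n-th root. The bound n <= 40
  keeps R^n below p, so that T applies, and n >= 6 damps the excess of t over p^(1/2) to its sixth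
  root.\<close>

lemma card_Fr_log_le:
  fixes T :: real and n :: nat
  assumes T: "\<And>m. 1 \<le> m \<Longrightarrow> m \<le> p \<Longrightarrow> real (tau m) \<le> T" and R: "R \<ge> 1" and n: "n \<ge> 6" "n \<le> 40"
    and lR: "\<bar>ln (real R) - ln (real p) / (2 * real n)\<bar> \<le> ln (real p) / 160"
    and lt: "ln (real p) / 2 \<le> ln (real t)" and F0: "Fr R \<noteq> {}"
  shows "ln (real (card (Fr R))) \<le> 6 * ln T + ln 4 + (ln (real t) - ln (real p) / 2) / 6 + ln (real p) / 160 + ln (real R)"
proof -
  have p1: "real p > 1" using p_gt_1 by simp
  have t0: "real t > 0" using t_pos by simp
  have R0: "real R > 0" using R by simp
  define P lr lF where "P = ln (real p)" and "lr = ln (real R)" and "lF = ln (real (card (Fr R)))"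
  have P0: "P > 0" unfolding P_def using p1 by simp
  have cF: "real (card (Fr R)) > 0" using F0 finite_Fr[of R] by (simp add: card_gt_0_iff)
  have T1: "T \<ge> 1" using T[of 1] p1 by (simp add: tau_def)
  have nR: "real n \<ge> 6" "real n \<le> 40" using n by auto
  have nl: "real n * lr \<le> P"
  proof -
    have "lr \<le> P / (2 * real n) + P / 160" using lR unfolding P_def lr_def by linarith
    hence "real n * lr \<le> real n * (P / (2 * real n) + P / 160)" using nR by (intro mult_left_mono) auto
    also have "\<dots> = P / 2 + real n * P / 160" using nR by (simp add: field_simps)
    also have "\<dots> \<le> P / 2 + 40 * P / 160" using nR P0 by (intro add_left_mono divide_right_mono mult_right_mono) auto
    finally show ?thesis using P0 by simp
  qed
  have "ln (real R ^ n) \<le> ln (real p)" using nl R0 by (simp add: ln_realpow P_def lr_def)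
  hence "real R ^ n \<le> real p" using R0 p1 by (simp add: ln_le_cancel_iff)
  hence "real (R ^ n) \<le> real p" by simp
  hence Rp: "R ^ n \<le> p" unfolding of_nat_le_iff .
  obtain k where k: "n = Suc k" using n by (cases n) auto
  have pw: "real (card (Fr R)) ^ Suc k \<le> (T ^ 6) ^ k * real (card (Fr (R ^ Suc k)))"
    by (rule card_Fr_power[OF _ R]) (use T Rp k in auto)
  define Q where "Q = real (R ^ n) ^ 2 / real p"
  have X: "real (card (Fr (R ^ n))) \<le> 2 * real t * (1 + Q)" unfolding Q_def
    by (rule card_Fr_le) (use R in simp)
  have lQ: "ln Q = 2 * (real n * lr) - P" unfolding Q_def using R0 p1 by (simp add: ln_div ln_realpow P_def lr_def)
  have Q0: "Q > 0" unfolding Q_def using R0 p1 by simp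
  \<comment> \<open>Here q will be 0 for Q <= 1 and ln Q for Q > 1, according to whether R^n is
    below or above p^(1/2).\<close>
  have main: "real n * lF \<le> 6 * real k * ln T + ln 4 + ln (real t) + q"
    if "1 + Q \<le> 2 * exp q" for q
  proof -
    have "real (card (Fr R)) ^ n \<le> (T ^ 6) ^ k * (2 * real t * (1 + Q))"
      using pw X T1 unfolding k by (meson mult_left_mono order_trans zero_le_power zero_le_one)
    also have "\<dots> \<le> (T ^ 6) ^ k * (2 * real t * (2 * exp q))" using that T1 by (intro mult_left_mono) auto
    finally have "ln (real (card (Fr R)) ^ n) \<le> ln ((T ^ 6) ^ k * (2 * real t * (2 * exp q)))"
      using cF by (intro ln_mono) auto
    also have "\<dots> = ln ((T ^ 6) ^ k * (4 * (real t * exp q)))" by (simp add: mult_ac)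
    also have "\<dots> = 6 * real k * ln T + ln 4 + ln (real t) + q"
      using T1 t0 by (simp add: ln_mult ln_realpow)
    finally show ?thesis using cF by (simp add: ln_realpow lF_def)
  qed
  have fin: "lF \<le> 6 * ln T + ln 4 + (ln (real t) - P / 2) / 6 + (P / 2 + q) / real n"
    if "1 + Q \<le> 2 * exp q" for q
  proof -
    have "6 * real k * ln T \<le> 6 * real n * ln T" using T1 k by (intro mult_right_mono) auto
    moreover have "ln 4 \<le> real n * ln (4::real)" using nR by (simp add: mult_le_cancel_right1)
    moreover have "real n * (6 * ln T + ln 4) = 6 * real n * ln T + real n * ln 4" by (simp add: algebra_simps)
    ultimately have "real n * lF \<le> real n * (6 * ln T + ln 4) + ln (real t) + q"  using main[OF that] by linarith
    hence "lF \<le> (real n * (6 * ln T + ln 4) + ln (real t) + q) / real n" using nR by (simp add: pos_le_divide_eq mult.commute)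
    also have "\<dots> = 6 * ln T + ln 4 + (ln (real t) - P / 2) / real n + (P / 2 + q) / real n"
      using nR by (simp add: field_simps)
    also have "(ln (real t) - P / 2) / real n \<le> (ln (real t) - P / 2) / 6"
      using lt nR unfolding P_def by (intro divide_left_mono) auto
    finally show ?thesis by simp
  qed
  have half: "P / 2 / real n = P / (2 * real n)" by simp
  show ?thesis
  proof (cases "Q \<le> 1")
    case True
    hence "lF \<le> 6 * ln T + ln 4 + (ln (real t) - P / 2) / 6 + (P / 2 + 0) / real n" by (intro fin) auto
    moreover have "P / (2 * real n) \<le> P / 160 + lr" using lR unfolding P_def lr_def by linarith
    ultimately show ?thesis unfolding P_def lr_def lF_def by simp
  next
    case False
    hence "lF \<le> 6 * ln T + ln 4 + (ln (real t) - P / 2) / 6 + (P / 2 + ln Q) / real n" using Q0 by (intro fin) auto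
    also have "(P / 2 + ln Q) / real n = 2 * lr - P / (2 * real n)" unfolding lQ using nR by (simp add: field_simps)
    finally have "lF \<le> 6 * ln T + ln 4 + (ln (real t) - P / 2) / 6 + (2 * lr - P / (2 * real n))" .
    moreover have "lr - P / (2 * real n) \<le> P / 160" using lR unfolding P_def lr_def by linarith
    ultimately show ?thesis unfolding P_def lr_def lF_def by linarith
  qed
qed

text \<open>The intervals of radius \<open>1/160\<close> around \<open>1/(2n)\<close> for \<open>n = 6, 7, 8, 9, 10, 12, 15, 19, 25, 40\<close>
  cover \<open>[1/160, 43/480]\<close>; the end point \<open>43/480 = 1/12 + 1/160\<close> is what determines the exponent
  of the theorem.\<close>

lemma card_Fr_ratio:
  fixes T :: real
  assumes T: "\<And>m. 1 \<le> m \<Longrightarrow> m \<le> p \<Longrightarrow> real (tau m) \<le> T" and R: "R \<ge> 1"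
    and lR: "ln (real R) \<le> 43 / 480 * ln (real p)" and lt: "ln (real p) / 2 \<le> ln (real t)"
  shows "real (card (Fr R)) \<le> exp (6 * ln T + ln 4 + (ln (real t) - ln (real p) / 2) / 6 + ln (real p) / 160) * real R"
proof (cases "Fr R = {}")
  case True
  thus ?thesis by simp
next
  case False
  have p1: "real p > 1" using p_gt_1 by simp
  have R0: "real R > 0" using R by simp
  define P lr where "P = ln (real p)" and "lr = ln (real R)"
  have P0: "P > 0" unfolding P_def using p1 by simp
  have cF: "real (card (Fr R)) > 0" using False finite_Fr[of R] by (simp add: card_gt_0_iff)
  have T1: "T \<ge> 1" using T[of 1] p1 by (simp add: tau_def)
  have lT: "ln T \<ge> 0" using T1 by simp
  have "ln (real (card (Fr R))) \<le> 6 * ln T + ln 4 + (ln (real t) - P / 2) / 6 + P / 160 + lr"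
  proof (cases "lr \<le> P / 160")
    \<comment> \<open>For R <= p^(1/160) the number of all pairs, R^2, is already small
      enough.\<close>
    case True
    have "ln (real (card (Fr R))) \<le> ln (real R ^ 2)" using card_Fr_le_square cF by (intro ln_mono) auto
    hence "ln (real (card (Fr R))) \<le> 2 * lr" using R0 by (simp add: ln_realpow lr_def)
    moreover have "ln (4::real) \<ge> 0" by simp
    moreover have "0 \<le> (ln (real t) - P / 2) / 6" using lt unfolding P_def by simp
    ultimately show ?thesis using True lT by linarith
  next
    case False
    have "\<exists>n::nat. 6 \<le> n \<and> n \<le> 40 \<and> \<bar>lr - P / (2 * real n)\<bar> \<le> P / 160"
    proof -
      have up: "lr \<le> 43 / 480 * P" using lR by (simp add: lr_def P_def)
      \<comment> \<open>Consecutive intervals overlap and the break points are chosen in the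
        overlaps; the first, 37/480 = 1/12 - 1/160, is the lower end of the interval for n =
        6.\<close>
      consider "37 / 480 * P \<le> lr" | "11 / 160 * P \<le> lr" "lr \<le> 37 / 480 * P" | "3 / 50 * P \<le> lr" "lr \<le> 11 / 160 * P"
        | "1 / 20 * P \<le> lr" "lr \<le> 3 / 50 * P" | "9 / 200 * P \<le> lr" "lr \<le> 1 / 20 * P" | "9 / 250 * P \<le> lr" "lr \<le> 9 / 200 * P"
        | "7 / 250 * P \<le> lr" "lr \<le> 9 / 250 * P" | "21 / 1000 * P \<le> lr" "lr \<le> 7 / 250 * P"
        | "7 / 500 * P \<le> lr" "lr \<le> 21 / 1000 * P" | "lr \<le> 7 / 500 * P" by linarith
      thus ?thesis
      proof cases
        case 1 thus ?thesis using up P0 by (intro exI[of _ 6]) (simp add: abs_if)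
      next
        case 2 thus ?thesis using P0 by (intro exI[of _ 7]) (simp add: abs_if)
      next
        case 3 thus ?thesis using P0 by (intro exI[of _ 8]) (simp add: abs_if)
      next
        case 4 thus ?thesis using P0 by (intro exI[of _ 9]) (simp add: abs_if)
      next
        case 5 thus ?thesis using P0 by (intro exI[of _ 10]) (simp add: abs_if)
      next
        case 6 thus ?thesis using P0 by (intro exI[of _ 12]) (simp add: abs_if)
      next
        case 7 thus ?thesis using P0 by (intro exI[of _ 15]) (simp add: abs_if)
      next
        case 8 thus ?thesis using P0 by (intro exI[of _ 19]) (simp add: abs_if)
      next
        case 9 thus ?thesis using P0 by (intro exI[of _ 25]) (simp add: abs_if)
      next
        case 10 thus ?thesis using False P0 by (intro exI[of _ 40]) (simp add: abs_if)
      qed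
    qed
    then obtain n :: nat where n: "6 \<le> n" "n \<le> 40" "\<bar>lr - P / (2 * real n)\<bar> \<le> P / 160" by blast
    show ?thesis using card_Fr_log_le[OF T R n(1,2) _ lt \<open>Fr R \<noteq> {}\<close>] n(3) unfolding P_def lr_def by simp
  qed
  hence "real (card (Fr R)) \<le> exp (6 * ln T + ln 4 + (ln (real t) - P / 2) / 6 + P / 160 + lr)"
    using cF by (metis exp_le_cancel_iff exp_ln)
  also have "\<dots> = exp (6 * ln T + ln 4 + (ln (real t) - P / 2) / 6 + P / 160) * real R"
    using R0 by (simp add: exp_add lr_def)
  finally show ?thesis unfolding P_def .
qed

end

text \<open>A large short sum is inserted into the fourth-power inequality together with the bounds
  for N and the energy. Shortening h by p^(-\<epsilon>/2) gains 3\<epsilon>/2 in the exponent from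
  the factor h^3, and \<open>err\<close> keeps the accumulated losses below this gain.\<close>

lemma (in stepanov_subgroup) short_sum_small:
  fixes T K \<epsilon> :: real
  assumes T: "\<And>m. 1 \<le> m \<Longrightarrow> m \<le> p \<Longrightarrow> real (tau m) \<le> T"
    and big: "10 ^ 30 * L ^ 10 \<le> K" and t3: "real t ^ 3 \<le> real p ^ 2"
    and h: "h \<ge> 1" "h < p" and lh: "ln (real h) \<le> (43 / 480 - \<epsilon> / 2) * ln (real p)" and \<epsilon>: "\<epsilon> \<ge> 0" "\<epsilon> \<le> 1 / 100"
    and lt: "ln (real p) / 2 \<le> ln (real t)"
    and err: "6 * ln T + ln 4 + ln 256 + ln (2 + ln (real p)) + 2 * ln K < \<epsilon> * ln (real p)"
    and a: "a \<in> U"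
  shows "(\<Sum>c\<in>{1..int h}. norm (S (a * c))) < real t / 4"
proof (rule ccontr)
  assume neg: "\<not> (\<Sum>c\<in>{1..int h}. norm (S (a * c))) < real t / 4"
  define P lE l k where "P = ln (real p)" and "lE = ln En" and "l = ln (real t)" and "k = ln K"
  have p1: "real p > 1" using p_gt_1 by simp
  have t0: "real t > 0" using t_pos by simp
  have P0: "P > 0" unfolding P_def using p1 by simp
  have h0: "real h > 0" using h by simp
  define N where "N = real (Nr h)"
  define g where "g = 6 * ln T + ln 4 + (l - P / 2) / 6 + P / 160"
  have "real h \<le> real p" using h by simp
  hence lhp: "ln (real h) \<le> P" unfolding P_def using h0 by (simp add: ln_le_cancel_iff)
  have lh0: "ln (real h) \<ge> 0" using h by simp
  have N1: "N \<le> real h * exp g * (2 + ln (real h))"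
    unfolding N_def
  proof (rule Nr_le[OF h])
    fix R assume R: "1 \<le> R" "R \<le> h"
    have "ln (real R) \<le> ln (real h)" using R by simp
    also have "\<dots> \<le> (43 / 480 - \<epsilon> / 2) * ln (real p)" by (rule lh)
    also have "\<dots> \<le> 43 / 480 * ln (real p)" using \<epsilon> P0 unfolding P_def by (intro mult_right_mono) auto
    finally show "real (card (Fr R)) \<le> exp g * real R"
      unfolding g_def l_def P_def by (intro card_Fr_ratio[OF T R(1) _ lt])
  qed simp
  have fourth: "(real t / 4) ^ 4 * real t \<le> real h ^ 2 * (N * (real p * En))"
  proof -
    have "(real t / 4) ^ 4 * real t \<le> (\<Sum>c\<in>{1..int h}. norm (S (a * c))) ^ 4 * real t"
      using neg by (intro mult_right_mono power_mono) auto
    also have "\<dots> \<le> real h ^ 2 * (N * (real p * En))" unfolding N_def by (rule short_sum_fourth_power[OF a h(2)])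
    finally show ?thesis .
  qed
  also have "\<dots> \<le> real h ^ 2 * ((real h * exp g * (2 + ln (real h))) * (real p * En))"
    using N1 En_pos p1 by (intro mult_left_mono mult_right_mono) auto
  finally have "ln ((real t / 4) ^ 4 * real t) \<le> ln (real h ^ 2 * ((real h * exp g * (2 + ln (real h))) * (real p * En)))"
    using t0 by (intro ln_mono) auto
  moreover have "ln ((real t / 4) ^ 4 * real t) = 5 * l - ln 256"
  proof -
    have "(real t / 4) ^ 4 * real t = real t ^ 5 / 256" by (simp add: power_divide eval_nat_numeral)
    moreover have "ln (real t ^ 5 / 256) = 5 * l - ln 256" using t0 by (simp add: ln_div ln_realpow l_def)
    ultimately show ?thesis by (simp only:)
  qed
  moreover have "ln (real h ^ 2 * ((real h * exp g * (2 + ln (real h))) * (real p * En))) =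
      3 * ln (real h) + g + ln (2 + ln (real h)) + P + lE"
  proof -
    have alg: "ln (x ^ 2 * ((x * exp g * b) * (y * z))) = 3 * ln x + g + ln b + ln y + ln z"
      if "x > 0" "b > 0" "y > 0" "z > 0" for x b y z :: real
      using that by (simp add: ln_mult ln_realpow)
    show ?thesis unfolding P_def lE_def by (rule alg) (use h0 lh0 p1 En_pos in linarith)+
  qed
  moreover have "ln (2 + ln (real h)) \<le> ln (2 + P)" using lh0 lhp by (intro ln_mono) auto
  moreover have "3 * ln (real h) \<le> 3 * (43 / 480 * P) - 3 / 2 * (\<epsilon> * P)" using lh unfolding P_def by (simp add: algebra_simps)
  ultimately have main: "5 * l \<le> 129 / 480 * P - 3 / 2 * (\<epsilon> * P) + g + P + lE + ln (2 + P) + ln 256" by linarith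
  have "1 \<le> L ^ 10" using L_ge_1 by simp
  hence "1 * 1 \<le> 10 ^ 30 * L ^ 10" by (intro mult_mono) auto
  hence "1 \<le> K" using big by linarith
  hence k0: "k \<ge> 0" unfolding k_def by simp
  have eP: "0 \<le> \<epsilon> * P" "\<epsilon> * P \<le> P / 100" using \<epsilon> P0 mult_right_mono[of \<epsilon> "1 / 100" P] by auto
  have lP: "P / 2 \<le> l" using lt unfolding P_def l_def .
  have er: "6 * ln T + ln 4 + ln 256 + ln (2 + P) + 2 * k < \<epsilon> * P" using err unfolding P_def k_def .
  have T1: "T \<ge> 1" using T[of 1] p1 by (simp add: tau_def)
  have nn: "0 \<le> 6 * ln T" "0 \<le> ln (4::real)" "0 \<le> ln (256::real)" "0 \<le> ln (2 + P)" using T1 P0 by auto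
  define z s where "z = \<epsilon> * P" and "s = 6 * ln T + ln 4 + ln 256 + ln (2 + P)"
  have "(l - P / 2) / 6 = l / 6 - P / 12" by (simp add: field_simps)
  hence main': "5 * l \<le> 129 / 480 * P - 3 / 2 * z + s + l / 6 - P / 12 + P / 160 + P + lE"
    using main unfolding g_def z_def s_def by linarith
  have sz: "s + 2 * k < z" "0 \<le> s" "z \<le> P / 100" using er eP nn unfolding z_def s_def by linarith+
  \<comment> \<open>At l = P/2 the fourth alternative is an equality in the leading terms, 5/2 =
    43/160 + 1/160 + 1 + 49/40, so the gain 3z/2 decides. The other alternatives leave room there,
    and larger l only helps.\<close>
  from energy_log_bound[OF big t3, folded P_def lE_def l_def k_def] show False
    using main' sz lP k0 P0 by (elim disjE) linarith+
qed

section \<open>Gaps\<close>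

text \<open>By Lagrange the subgroup consists of roots of X^t - 1. There are at most t of these in a
  field, so the cardinality forces equality.\<close>

lemma subgroup_of_order_eq_roots:
  assumes p: "prime p" and t: "t dvd p - 1"
  shows "subgroup_of_order p t = {x \<in> {0..<int p}. [x ^ t = 1] (mod int p)}"
proof -
  interpret residues_prime p "Fp p"
    by unfold_locales (use p in auto)
  interpret G: group "Fp_units p" by (rule field_mult_group)
  define \<Gamma> where "\<Gamma> = subgroup_of_order p t"
  have S: "subgroup \<Gamma> (Fp_units p)" "card \<Gamma> = t" unfolding \<Gamma>_def by (rule subgroup_of_order[OF p t])+
  have p1: "p > 1" using p prime_gt_1_nat by blast
  have t0: "t > 0" using t p1 by (metis dvd_0_left_iff gr0I zero_less_diff less_numeral_extra(3))
  define Z where "Z = {x \<in> carrier (Fp p). x [^]\<^bsub>Fp p\<^esub> t = \<one>\<^bsub>Fp p\<^esub>}"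
  have Z: "finite Z" "card Z \<le> t"
    unfolding Z_def using num_roots_le_deg[OF finite, of t] t0 by (auto intro: finite_subset[OF _ finite])
  interpret S: group "(Fp_units p)\<lparr>carrier := \<Gamma>\<rparr>"
    using S(1) G.subgroup_imp_group by blast
  have sub: "\<Gamma> \<subseteq> carrier (Fp_units p)" using S(1) by (rule subgroup.subset)
  have "\<Gamma> \<subseteq> Z"
  proof
    fix x assume x: "x \<in> \<Gamma>"
    have "x [^]\<^bsub>(Fp_units p)\<lparr>carrier := \<Gamma>\<rparr>\<^esub> t = \<one>\<^bsub>(Fp_units p)\<lparr>carrier := \<Gamma>\<rparr>\<^esub>"
      using S.pow_order_eq_1[of x] x S(2) by (simp add: Coset.order_def)
    hence "x [^]\<^bsub>Fp_units p\<^esub> t = \<one>\<^bsub>Fp_units p\<^esub>"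
      by (simp add: nat_pow_consistent[symmetric] G.nat_pow_consistent[symmetric])
    thus "x \<in> Z" using x sub unfolding Z_def by (auto simp: nat_pow_mult_of)
  qed
  hence "\<Gamma> = Z" using Z S(2) by (metis card_seteq)
  also have "Z = {x \<in> {0..<int p}. [x ^ t = 1] (mod int p)}"
  proof -
    have "x [^]\<^bsub>Fp p\<^esub> t = x ^ t mod int p" if "x \<in> {0..<int p}" for x
      using pow_cong[of x t] that by simp
    moreover have "carrier (Fp p) = {0..<int p}" by (auto simp: res_carrier_eq)
    moreover have "1 mod int p = 1" using p1 by simp
    ultimately show ?thesis unfolding Z_def by (auto simp: res_one_eq unique_euclidean_semiring_class.cong_def)
  qed
  finally show ?thesis unfolding \<Gamma>_def .
qed

lemma mult_subgroup_of_order: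
  assumes p: "prime p" and t: "t dvd p - 1"
  shows "mult_subgroup p t"
proof
  show "card {x \<in> {0..<int p}. [x ^ t = 1] (mod int p)} = t"
    using subgroup_of_order(2)[OF p t] unfolding subgroup_of_order_eq_roots[OF p t] .
  have "p > 1" using p prime_gt_1_nat by blast
  thus "t \<ge> 1" using t by (metis One_nat_def Suc_leI dvd_0_left_iff gr0I zero_less_diff less_numeral_extra(3))
qed (rule p)

lemma is_gapE:
  assumes p: "prime p" and t: "t dvd p - 1" and H: "is_gap p t H"
  obtains a u where "a \<in> {1..<int p}"
    "\<And>j g. 1 \<le> j \<Longrightarrow> j \<le> int H \<Longrightarrow> mult_subgroup.\<gamma> p t g = 1 \<Longrightarrow> \<not> [u + j = a * g] (mod int p)"
proof -
  interpret mult_subgroup p t by (rule mult_subgroup_of_order[OF p t])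
  interpret residues_prime p "Fp p"
    by unfold_locales (use p in auto)
  from H obtain a u where a: "a \<in> carrier (Fp_units p)"
    and gap: "\<And>j. j \<in> {1..H} \<Longrightarrow>
      u \<oplus>\<^bsub>Fp p\<^esub> (int j mod int p) \<notin> a <#\<^bsub>Fp_units p\<^esub> subgroup_of_order p t"
    unfolding is_gap_def by blast
  have aU: "a \<in> {1..<int p}" using a by (auto simp: res_carrier_eq res_zero_eq)
  show thesis
  proof (rule that[OF aU])
    fix j g assume j: "1 \<le> j" "j \<le> int H" and g: "\<gamma> g = 1"
    show "\<not> [u + j = a * g] (mod int p)"
    proof
      assume "[u + j = a * g] (mod int p)"
      hence e: "(u + j) mod int p = (a * g) mod int p" by (simp only: unique_euclidean_semiring_class.cong_def)
      have "\<gamma> (g mod int p) = 1" using g perD[OF per_\<gamma> mod_cong_self[of g]] by simp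
      hence "g mod int p \<in> subgroup_of_order p t"
        unfolding subgroup_of_order_eq_roots[OF p t] using mod_in_F[of g] by (simp add: \<gamma>_eq_1)
      moreover have "u \<oplus>\<^bsub>Fp p\<^esub> (int (nat j) mod int p) = a \<otimes>\<^bsub>Fp_units p\<^esub> (g mod int p)"
        using e j by (simp add: res_add_eq res_mult_eq mod_simps)
      ultimately have "u \<oplus>\<^bsub>Fp p\<^esub> (int (nat j) mod int p) \<in> a <#\<^bsub>Fp_units p\<^esub> subgroup_of_order p t"
        unfolding l_coset_def by blast
      moreover have "nat j \<in> {1..H}" using j by auto
      ultimately show False using gap by blast
    qed
  qed
qed

text \<open>The product hM exceeds p^(1 + e/2) up to the factor 4k, so the base is at most p^(-e/4).
  As ke >= 8, the k-th power is at most p^(-2), which beats the number p of frequencies.\<close>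

lemma kernel_tail_small:
  fixes p e H h M :: real and k :: nat
  assumes p: "p \<ge> 2" and e: "e > 0" and k: "real k * e \<ge> 8" and kp: "8 * real k * p powr (- e / 2) \<le> p powr (- e / 4)"
    and h: "h \<ge> p powr (43 / 480 - e / 2) / 2" and M: "M \<ge> p powr (437 / 480 + e) / (2 * real k)"
  shows "p * (2 * p / (h * M)) ^ k \<le> 1 / 2"
proof -
  have k0: "real k > 0" using k e by (cases k) auto
  have hM: "p powr (1 + e / 2) / (4 * real k) \<le> h * M"
  proof -
    have "p powr (1 + e / 2) = p powr (43 / 480 - e / 2) * p powr (437 / 480 + e)"
      by (simp flip: powr_add)
    hence "p powr (1 + e / 2) / (4 * real k) = (p powr (43 / 480 - e / 2) / 2) * (p powr (437 / 480 + e) / (2 * real k))" by simp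
    also have "\<dots> \<le> h * M"
    proof (rule mult_mono[OF h M])
      have "0 \<le> p powr (43 / 480 - e / 2) / 2" by simp
      thus "0 \<le> h" using h by linarith
    qed (use k0 in simp)
    finally show ?thesis .
  qed
  have pos: "p powr (1 + e / 2) / (4 * real k) > 0" using p k0 by simp
  have hM0: "h * M > 0" using hM pos by linarith
  have "2 * p / (h * M) \<le> 2 * p / (p powr (1 + e / 2) / (4 * real k))"
    using p by (intro divide_left_mono[OF hM _ mult_pos_pos[OF hM0 pos]]) simp
  also have "\<dots> = 8 * real k * (p powr 1 / p powr (1 + e / 2))" using p k0 by simp
  also have "p powr 1 / p powr (1 + e / 2) = p powr (- e / 2)" by (subst powr_diff[symmetric]) simp
  also have "8 * real k * p powr (- e / 2) \<le> p powr (- e / 4)" by (rule kp)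
  finally have le: "2 * p / (h * M) \<le> p powr (- e / 4)" .
  have "(2 * p / (h * M)) ^ k \<le> (p powr (- e / 4)) ^ k" using le p hM0 by (intro power_mono) auto
  also have "\<dots> = p powr (- e / 4 * real k)" using p by (simp add: powr_powr flip: powr_realpow)
  also have "\<dots> \<le> p powr (- 2)" using p k by (intro powr_mono) (auto simp: mult.commute)
  also have "\<dots> = 1 / p ^ 2" using p by (simp add: powr_minus divide_inverse powr_realpow[of _ 2, simplified])
  finally have "p * (2 * p / (h * M)) ^ k \<le> p * (1 / p ^ 2)" using p by (intro mult_left_mono) auto
  also have "\<dots> \<le> 1 / 2" using p by (simp add: power2_eq_square field_simps)
  finally show ?thesis .
qed

theorem theorem21:
  shows "\<forall>\<epsilon>::real. \<epsilon> > 0 \<longrightarrow>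
    (\<exists>p\<^sub>0::nat. \<forall>p::nat. \<forall>t::nat.
      prime p \<and> p \<ge> p\<^sub>0 \<and> t dvd p - 1 \<and> real t \<ge> real p powr (1/2) \<longrightarrow>
      real (max_gap p t) \<le> real p powr (437/480 + \<epsilon>))"
proof (intro allI impI)
  fix \<epsilon> :: real assume \<epsilon>0: "\<epsilon> > 0"
  \<comment> \<open>Capping at 1/100 only shortens the forbidden gap length and keeps the exponent
    of h positive.\<close>
  define e where "e = min \<epsilon> (1 / 100)"
  have e: "e > 0" "e \<le> 1 / 100" "e \<le> \<epsilon>" using \<epsilon>0 by (auto simp: e_def)
  \<comment> \<open>T enters with weight 6 and K with weight 2, so the exponents e/100 and e/1000
    lose less than e in total.\<close>
  obtain C where C: "C \<ge> 1" "\<And>n. n \<ge> 1 \<Longrightarrow> real (tau n) \<le> C * real n powr (e / 100)"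
    using divisor_bound[of "e / 100"] e by auto
  define k where "k = nat \<lceil>8 / e\<rceil>"
  have ke: "real k * e \<ge> 8"
  proof -
    have "8 / e \<le> real k" unfolding k_def by linarith
    thus ?thesis using e by (simp add: pos_divide_le_eq)
  qed
  have k0: "real k > 0" using ke e by (cases k) auto
  have "\<forall>\<^sub>F x in at_top. 10 ^ 30 * (1 + ln x) ^ 10 \<le> x powr (e / 1000)" using e(1) by real_asymp
  moreover have "\<forall>\<^sub>F x in at_top. 6 * (ln C + e / 100 * ln x) + ln 4 + ln 256 + ln (2 + ln x) + 2 * (e / 1000 * ln x) < e * ln x"
    using e(1) by real_asymp
  moreover have "\<forall>\<^sub>F x in at_top. 1024 * (x powr (3 / 5)) ^ 4 \<le> (x::real) ^ 3" by real_asymp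
  moreover have "\<forall>\<^sub>F x in at_top. (x powr (3 / 5)) ^ 3 \<le> (x::real) ^ 2" by real_asymp
  moreover have "\<forall>\<^sub>F x in at_top. 8 * real k * x powr (- e / 2) \<le> x powr (- e / 4)" using e(1) k0 by real_asymp
  moreover have "\<forall>\<^sub>F x in at_top. 2 * real k \<le> x powr (437 / 480)" by real_asymp
  moreover have "\<forall>\<^sub>F x in at_top. 2 * x powr (43 / 480) < (x::real)" by real_asymp
  moreover have "\<forall>\<^sub>F x in at_top. x powr (43 / 480) * sqrt x < x powr (3 / 5) / (4::real)" by real_asymp
  moreover have "\<forall>\<^sub>F x in at_top. (2::real) \<le> x" by (rule eventually_ge_at_top)
  ultimately have "\<forall>\<^sub>F x in at_top. 10 ^ 30 * (1 + ln x) ^ 10 \<le> x powr (e / 1000) \<and>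
      6 * (ln C + e / 100 * ln x) + ln 4 + ln 256 + ln (2 + ln x) + 2 * (e / 1000 * ln x) < e * ln x \<and>
      1024 * (x powr (3 / 5)) ^ 4 \<le> x ^ 3 \<and> (x powr (3 / 5)) ^ 3 \<le> x ^ 2 \<and>
      8 * real k * x powr (- e / 2) \<le> x powr (- e / 4) \<and> 2 * real k \<le> x powr (437 / 480) \<and>
      2 * x powr (43 / 480) < x \<and> x powr (43 / 480) * sqrt x < x powr (3 / 5) / 4 \<and> 2 \<le> x"
    by (simp only: eventually_conj_iff)
  then obtain X where X: "\<And>x. x \<ge> X \<Longrightarrow> 10 ^ 30 * (1 + ln x) ^ 10 \<le> x powr (e / 1000) \<and>
      6 * (ln C + e / 100 * ln x) + ln 4 + ln 256 + ln (2 + ln x) + 2 * (e / 1000 * ln x) < e * ln x \<and>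
      1024 * (x powr (3 / 5)) ^ 4 \<le> x ^ 3 \<and> (x powr (3 / 5)) ^ 3 \<le> x ^ 2 \<and>
      8 * real k * x powr (- e / 2) \<le> x powr (- e / 4) \<and> 2 * real k \<le> x powr (437 / 480) \<and>
      2 * x powr (43 / 480) < x \<and> x powr (43 / 480) * sqrt x < x powr (3 / 5) / 4 \<and> 2 \<le> x"
    unfolding eventually_at_top_linorder by blast
  show "\<exists>p\<^sub>0::nat. \<forall>p t::nat. prime p \<and> p \<ge> p\<^sub>0 \<and> t dvd p - 1 \<and> real t \<ge> real p powr (1/2) \<longrightarrow>
      real (max_gap p t) \<le> real p powr (437/480 + \<epsilon>)"
  proof (intro exI[of _ "nat \<lceil>X\<rceil>"] allI impI, elim conjE)
    fix p t :: nat
    assume p: "prime p" and pX: "nat \<lceil>X\<rceil> \<le> p" and t: "t dvd p - 1" and tp: "real p powr (1 / 2) \<le> real t"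
    have "X \<le> real p" using pX by linarith
    note big = X[OF this]
    have p2: "real p \<ge> 2" using big by blast
    interpret mult_subgroup p t by (rule mult_subgroup_of_order[OF p t])
    have t0: "real t > 0" using t_pos by simp
    show "real (max_gap p t) \<le> real p powr (437/480 + \<epsilon>)"
    proof (rule ccontr)
      assume "\<not> real (max_gap p t) \<le> real p powr (437/480 + \<epsilon>)"
      moreover have "real p powr (437/480 + e) \<le> real p powr (437/480 + \<epsilon>)" using p2 e by (intro powr_mono) auto
      ultimately have Hbig: "real p powr (437/480 + e) \<le> real (max_gap p t)" by linarith
      define H where "H = max_gap p t"
      obtain a u where au: "a \<in> U"
        "\<And>j g. 1 \<le> j \<Longrightarrow> j \<le> int H \<Longrightarrow> \<gamma> g = 1 \<Longrightarrow> \<not> [u + j = a * g] (mod int p)"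
        using is_gapE[OF p t is_gap_max_gap[OF p t]] unfolding H_def by blast
      \<comment> \<open>Since p/H <= p^(43/480 - e), this exceeds p/H by a factor at least p^(e/2);
        that surplus makes the kernel small beyond h.\<close>
      define y where "y = real p powr (43 / 480 - e / 2)"
      have "real p powr 0 \<le> y" unfolding y_def using p2 e by (intro powr_mono) auto
      hence y1: "y \<ge> 1" using p2 by simp
      define h where "h = nat \<lfloor>y\<rfloor>"
      have "1 \<le> \<lfloor>y\<rfloor>" using y1 by (simp add: le_floor_iff)
      hence h: "real h \<le> y" "y / 2 \<le> real h" "h \<ge> 1" unfolding h_def by linarith+
      have yle: "y \<le> real p powr (43 / 480)" unfolding y_def using p2 e by (intro powr_mono) auto
      have "2 * real h < real p" using h(1) yle big by linarith
      hence h2: "2 * h < p" by linarith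
      \<comment> \<open>Sums of k elements of [1, M] must stay inside the gap, hence kM <=
        H.\<close>
      define M where "M = H div k"
      have kn: "k > 0" using k0 by simp
      have "real p powr (437/480) \<le> real p powr (437/480 + e)" using p2 e by (intro powr_mono) auto
      hence "2 * real k \<le> real H" using big Hbig unfolding H_def by linarith
      hence "2 * k \<le> H" by linarith
      hence M1: "M \<ge> 1" unfolding M_def using kn by (simp add: less_eq_div_iff_mult_less_eq)
      have "H < k * (M + 1)" unfolding M_def using kn by (simp add: dividend_less_times_div)
      also have "\<dots> \<le> k * (2 * M)" using M1 by (intro mult_le_mono2) simp
      finally have "real H \<le> real (k * (2 * M))" unfolding of_nat_le_iff by simp
      hence "real H / (2 * real k) \<le> real M" using k0 by (simp add: pos_divide_le_eq mult_ac)
      moreover have "real p powr (437/480 + e) / (2 * real k) \<le> real H / (2 * real k)"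
        using Hbig k0 unfolding H_def by (intro divide_right_mono) auto
      ultimately have Mge: "real p powr (437/480 + e) / (2 * real k) \<le> real M" by linarith
      have kM: "k * M \<le> H" unfolding M_def by simp
      have "real t \<le> 2 * (\<Sum>c\<in>{1..int h}. norm (S (a * c))) + real p * real t * (2 * real p / (real h * real M)) ^ k"
      proof (rule gap_forces_large_sum[OF au(1) _ M1 h(3) h2])
        fix j g assume "1 \<le> j" "j \<le> int (k * M)" "\<gamma> g = 1"
        thus "\<not> [u + j = a * g] (mod int p)" using au(2)[of j g] kM by linarith
      qed (use kn in simp)
      moreover have "real p * (2 * real p / (real h * real M)) ^ k \<le> 1 / 2"
        by (rule kernel_tail_small[OF p2 e(1) ke]) (use big h(2) Mge in \<open>auto simp: y_def\<close>)
      hence "real t * (real p * (2 * real p / (real h * real M)) ^ k) \<le> real t * (1 / 2)" by (intro mult_left_mono) auto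
      hence "real p * real t * (2 * real p / (real h * real M)) ^ k \<le> real t / 2" by (simp add: mult_ac)
      ultimately have large: "real t / 4 \<le> (\<Sum>c\<in>{1..int h}. norm (S (a * c)))" by linarith
      show False
      \<comment> \<open>Above p^(3/5) the bound |S| <= p^(1/2) suffices, because 43/480 + 1/2 =
        283/480 < 288/480. Below it t^3 <= p^2 and 1024 t^4 <= p^3 hold for large p, as the energy
        estimate requires.\<close>
      proof (cases "real t \<ge> real p powr (3 / 5)")
        case True
        have "(\<Sum>c\<in>{1..int h}. norm (S (a * c))) \<le> (\<Sum>c\<in>{1..int h}. sqrt (real p))"
        proof (rule sum_mono)
          fix c assume "c \<in> {1..int h}"
          hence "c \<in> U" using h2 by auto
          thus "norm (S (a * c)) \<le> sqrt (real p)" using au(1) U_iff by (intro norm_S_le_sqrt) (auto simp: dvd_mult_p)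
        qed
        also have "\<dots> = real h * sqrt (real p)" by simp
        also have "\<dots> \<le> real p powr (43 / 480) * sqrt (real p)" using h(1) yle by (intro mult_right_mono) auto
        also have "\<dots> < real p powr (3 / 5) / 4" using big by blast
        finally show False using large True by linarith
      next
        case False
        hence tl: "real t \<le> real p powr (3 / 5)" by simp
        have "real p = (real p powr (1 / 2)) ^ 2" using p2 by (simp add: powr_half_sqrt)
        also have "\<dots> \<le> real t ^ 2" using tp by (intro power_mono) auto
        finally have "real p \<le> real (t\<^sup>2)" by simp
        hence pt: "p \<le> t\<^sup>2" unfolding of_nat_le_iff .
        have "1024 * real t ^ 4 \<le> 1024 * (real p powr (3 / 5)) ^ 4" using tl by (intro mult_left_mono power_mono) auto
        hence "1024 * real t ^ 4 \<le> real p ^ 3" using big by linarith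
        hence "real (1024 * t ^ 4) \<le> real (p ^ 3)" by simp
        hence ts: "1024 * t ^ 4 \<le> p ^ 3" unfolding of_nat_le_iff .
        interpret stepanov_subgroup p t by unfold_locales (rule pt, rule ts)
        have "real t ^ 3 \<le> (real p powr (3 / 5)) ^ 3" using tl by (intro power_mono) auto
        hence t3: "real t ^ 3 \<le> real p ^ 2" using big by linarith
        have "(\<Sum>c\<in>{1..int h}. norm (S (a * c))) < real t / 4"
        proof (rule short_sum_small[of "C * real p powr (e / 100)" "real p powr (e / 1000)" h e])
          fix m :: nat assume m: "1 \<le> m" "m \<le> p"
          have "real (tau m) \<le> C * real m powr (e / 100)" using C(2) m by blast
          also have "\<dots> \<le> C * real p powr (e / 100)" using C(1) m e by (intro mult_left_mono powr_mono2) auto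
          finally show "real (tau m) \<le> C * real p powr (e / 100)" .
        next
          show "10 ^ 30 * L ^ 10 \<le> real p powr (e / 1000)" using big unfolding L_def by blast
          show "ln (real h) \<le> (43 / 480 - e / 2) * ln (real p)"
          proof -
            have "ln (real h) \<le> ln y" using h by (intro ln_mono) auto
            thus ?thesis using p2 by (simp add: y_def ln_powr)
          qed
          have "ln (real p powr (1 / 2)) \<le> ln (real t)" using tp p2 by (intro ln_mono) auto
          thus "ln (real p) / 2 \<le> ln (real t)" using p2 by (simp add: ln_powr)
          show "6 * ln (C * real p powr (e / 100)) + ln 4 + ln 256 + ln (2 + ln (real p)) + 2 * ln (real p powr (e / 1000)) < e * ln (real p)"
            using big C(1) p2 by (simp add: ln_mult ln_powr)
        qed (use t3 h h2 e au(1) in auto)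
        thus False using large by linarith
      qed
    qed
  qed
qed

end
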